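(* Let $b\in(0,1]$, $C_0\ge0$ and $\delta\in(0,1]$. There are constants $C>0$ and $\rho\in\mathbb{R}$ depending only on $b,C_0,\delta$ such that the following holds. Let $\mu$ be a probability distribution on $\Omega=\{\pm1\}^n$ with full support, and use the canonical transition rates $q_i^\star(x)=\frac12\sqrt{\mu(x^i)/\mu(x)}$ and weights $w_i^\star(x)=\sqrt{\mu(x^i)/\mu(x)}$. Assume $w_i^\star(x)\in[b,1/b]$ for all $x\in\Omega$, $i\in[n]$, and that the Dobrushin influence matrix $R$ of $\mu$ satisfies $\|R\|_1\le C_0$ and $\|R\|_2\le1-\delta$. Then: (1) (Local Bobkov) for all $f:\Omega\to[0,1]$ and $t\ge0$, pointwise on $\Omega$, $\ \mathcal I(P_tf)\le P_t\left(\sqrt{\mathcal I(f)^2+\gamma(t)\Gamma^\star(f)}\right)$, where $\gamma(t)=\frac{2(1-e^{-2\rho t})}{b\rho}$ if $\rho\ne0$ and $\gamma(t)=\frac{4t}{b}$ if $\rho=0$; (2) (Talagrand's variance–surface-area) for all $f:\Omega\to\{0,1\}$, $\ A^\star(f)\ge C\,\mathrm{Var}_\mu(f)\sqrt{\log\frac{e}{\mathrm{Var}_\mu(f)}}$; (3) ($L^1$–$L^2$ inequalities) for all $f:\Omega\to\mathbb{R}$, $$C\,\mathrm{Var}_\mu(f)\le\sum_{i=1}^n\frac{I_i^\star(f)}{1+\log\left(\sqrt{I_i^\star(f)}/\mathbb{E}_\mu[|\delta_i^\star f|]\right)},$$ $$I(f)\ge C\,\mathrm{Var}_\mu(f)\left(1+\log\frac{I^\star(f)}{J^\star(f)}\right),\qquad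 I(f)\ge C\,\mathrm{Var}_\mu(f)\left(1+\log\frac{I^\star(f)}{A^\star(f)^2}\right);$$ (4) (KKL) for all $f:\Omega\to\{\pm1\}$, with $\mathcal M^\star(f)=\max_{i\in[n]}I_i^\star(f)$, $$I^\star(f)\ge C\log(1/\mathcal M^\star(f))\,\mathrm{Var}_\mu(f),\qquad \mathcal M^\star(f)\ge C\,\frac{\log n}{n}\,\mathrm{Var}_\mu(f);$$ (5) (Eldan–Gross) for all $f:\Omega\to\{\pm1\}$, $\ A^\star(f)\ge C\,\mathrm{Var}_\mu(f)\sqrt{\log\left(1+\frac{e}{J^\star(f)}\right)}$.
   Context: Notation: $x^i$ is $x\in\Omega$ with its $i$-th coordinate flipped; $[n]=\{1,\dots,n\}$; $\log$ is natural. The semigroup is $P_t=e^{tL}$ with $Lf(x)=\sum_{i=1}^nq_i^\star(x)(f(x^i)-f(x))$. $\delta_i^\star f(x)=q_i^\star(x)(f(x^i)-f(x))$; $\Gamma^\star(f)=\sum_{i=1}^n(\delta_i^\star f)^2$; $I_i^\star(f)=\mathbb{E}_\mu[(\delta_i^\star f)^2]$; $I^\star(f)=\sum_iI_i^\star(f)=\mathbb{E}_\mu[\Gamma^\star(f)]$; $A^\star(f)=\mathbb{E}_\mu[\sqrt{\Gamma^\star(f)}]$; $J^\star(f)=\sum_{i=1}^n(\mathbb{E}_\mu[|\delta_i^\star f|])^2$. The unweighted total influence is $I(f)=\mathbb{E}_\mu\left[\frac12\sum_{i=1}^nq_i^\star(x)(f(x^i)-f(x))^2\right]$. $\mathcal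 I:[0,1]\to\mathbb{R}_+$ is the Gaussian isoperimetric profile $\mathcal I(x)=\varphi(\Phi^{-1}(x))$ ($\mathcal I(0)=\mathcal I(1)=0$), with $\varphi,\Phi$ the standard Gaussian density and distribution function. The Dobrushin influence matrix is $R_{ii}=0$ and $R_{ij}=\max_{x\in\Omega} d_{\mathrm{TV}}\big(\mu_i(\cdot\mid x_{-i}),\mu_i(\cdot\mid (x^j)_{-i})\big)$ for $i\neq j$, where $\mu_i(\cdot\mid y)$ is the conditional law of coordinate $i$ given that the other coordinates equal $y$. $\|\cdot\|_1$ is the maximum absolute column sum, $\|\cdot\|_2$ the spectral norm. Conventions: a summand with $I_i^\star(f)=0$ is $0$; right-hand sides containing the factor $\mathrm{Var}_\mu(f)$ are $0$ if $\mathrm{Var}_\mu(f)=0$. *)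

theory Defs
  imports "HOL-Probability.Probability"
begin

text \<open>
  The dimension is a term-level natural number, because the constants of the theorem must not
  depend on it. A spin configuration is a function on the naturals of which only the coordinates
  \<open>1, \<dots>, n\<close> matter; points of the cube are \<open>undefined\<close> elsewhere, so that the cube has \<open>2 ^ n\<close>
  elements. Functions on the cube are total functions whose values off the cube are irrelevant:
  flipping a coordinate in \<open>{1..n}\<close> preserves the cube, and the distributions considered are
  supported on it.

  Degenerate cases: a quotient with numerator \<open>0\<close> and a product with a factor \<open>0\<close> are \<open>0\<close> whatever
  the value of the denominator or of the logarithm, so a summand with vanishing influence and a
  bound with vanishing variance are \<open>0\<close>, as the usual conventions demand.
\<close>

type_synonym config = "nat \<Rightarrow> int"

definition cube :: "nat \<Rightarrow> config set" where
  "cube n = {1..n} \<rightarrow>\<^sub>E {-1, 1}"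

definition flip :: "nat \<Rightarrow> config \<Rightarrow> config" where
  "flip i x = x(i := - x i)"

definition weight :: "config pmf \<Rightarrow> nat \<Rightarrow> config \<Rightarrow> real" where
  "weight \<mu> i x = sqrt (pmf \<mu> (flip i x) / pmf \<mu> x)"

definition rate :: "config pmf \<Rightarrow> nat \<Rightarrow> config \<Rightarrow> real" where
  "rate \<mu> i x = 1/2 * sqrt (pmf \<mu> (flip i x) / pmf \<mu> x)"

definition delta :: "config pmf \<Rightarrow> nat \<Rightarrow> (config \<Rightarrow> real) \<Rightarrow> config \<Rightarrow> real" where
  "delta \<mu> i f x = rate \<mu> i x * (f (flip i x) - f x)"

definition generator :: "nat \<Rightarrow> config pmf \<Rightarrow> (config \<Rightarrow> real) \<Rightarrow> config \<Rightarrow> real" where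
  "generator n \<mu> f x = (\<Sum>i\<in>{1..n}. rate \<mu> i x * (f (flip i x) - f x))"

text \<open>The operator exponential of \<open>t\<close> times the generator, as its (pointwise) power series.\<close>

definition heat_semigroup :: "nat \<Rightarrow> config pmf \<Rightarrow> real \<Rightarrow> (config \<Rightarrow> real) \<Rightarrow> config \<Rightarrow> real" where
  "heat_semigroup n \<mu> t f x = (\<Sum>k. t ^ k / fact k * (generator n \<mu> ^^ k) f x)"

definition Gamma_star :: "nat \<Rightarrow> config pmf \<Rightarrow> (config \<Rightarrow> real) \<Rightarrow> config \<Rightarrow> real" where
  "Gamma_star n \<mu> f x = (\<Sum>i\<in>{1..n}. (delta \<mu> i f x)\<^sup>2)"

definition coord_influence :: "config pmf \<Rightarrow> nat \<Rightarrow> (config \<Rightarrow> real) \<Rightarrow> real" where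
  "coord_influence \<mu> i f = measure_pmf.expectation \<mu> (\<lambda>x. (delta \<mu> i f x)\<^sup>2)"

definition coord_L1 :: "config pmf \<Rightarrow> nat \<Rightarrow> (config \<Rightarrow> real) \<Rightarrow> real" where
  "coord_L1 \<mu> i f = measure_pmf.expectation \<mu> (\<lambda>x. \<bar>delta \<mu> i f x\<bar>)"

definition I_star :: "nat \<Rightarrow> config pmf \<Rightarrow> (config \<Rightarrow> real) \<Rightarrow> real" where
  "I_star n \<mu> f = (\<Sum>i\<in>{1..n}. coord_influence \<mu> i f)"

definition A_star :: "nat \<Rightarrow> config pmf \<Rightarrow> (config \<Rightarrow> real) \<Rightarrow> real" where
  "A_star n \<mu> f = measure_pmf.expectation \<mu> (\<lambda>x. sqrt (Gamma_star n \<mu> f x))"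

definition J_star :: "nat \<Rightarrow> config pmf \<Rightarrow> (config \<Rightarrow> real) \<Rightarrow> real" where
  "J_star n \<mu> f = (\<Sum>i\<in>{1..n}. (coord_L1 \<mu> i f)\<^sup>2)"

definition M_star :: "nat \<Rightarrow> config pmf \<Rightarrow> (config \<Rightarrow> real) \<Rightarrow> real" where
  "M_star n \<mu> f = Max ((\<lambda>i. coord_influence \<mu> i f) ` {1..n})"

definition total_influence :: "nat \<Rightarrow> config pmf \<Rightarrow> (config \<Rightarrow> real) \<Rightarrow> real" where
  "total_influence n \<mu> f =
     measure_pmf.expectation \<mu>
       (\<lambda>x. 1/2 * (\<Sum>i\<in>{1..n}. rate \<mu> i x * (f (flip i x) - f x)\<^sup>2))"

abbreviation Var :: "config pmf \<Rightarrow> (config \<Rightarrow> real) \<Rightarrow> real" where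
  "Var \<mu> f \<equiv> measure_pmf.variance \<mu> f"

text \<open>
  On the open unit interval \<open>inv\<close> is the genuine inverse, as the Gaussian distribution function is
  a bijection from the reals onto it.
\<close>

definition gauss_profile :: "real \<Rightarrow> real" where
  "gauss_profile p =
     (if 0 < p \<and> p < 1 then std_normal_density (inv (cdf std_normal_distribution) p) else 0)"

definition bobkov_gamma :: "real \<Rightarrow> real \<Rightarrow> real \<Rightarrow> real" where
  "bobkov_gamma b \<rho> t =
     (if \<rho> = 0 then 4 * t / b else 2 * (1 - exp (- 2 * \<rho> * t)) / (b * \<rho>))"

definition tv_dist :: "'a pmf \<Rightarrow> 'a pmf \<Rightarrow> real" where
  "tv_dist p q = (SUP A. \<bar>measure_pmf.prob p A - measure_pmf.prob q A\<bar>)"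

definition cond_law :: "nat \<Rightarrow> config pmf \<Rightarrow> nat \<Rightarrow> config \<Rightarrow> int pmf" where
  "cond_law n \<mu> i y = map_pmf (\<lambda>x. x i) (cond_pmf \<mu> {x. \<forall>k\<in>{1..n} - {i}. x k = y k})"

definition dobrushin_matrix :: "nat \<Rightarrow> config pmf \<Rightarrow> nat \<Rightarrow> nat \<Rightarrow> real" where
  "dobrushin_matrix n \<mu> i j =
     (if i = j then 0
      else Max ((\<lambda>x. tv_dist (cond_law n \<mu> i x) (cond_law n \<mu> i (flip j x))) ` cube n))"

text \<open>
  The norms below are meant for \<open>n \<ge> 1\<close>; the spectral norm is the operator norm induced by the
  Euclidean norm on the coordinates \<open>{1..n}\<close>.
\<close>

definition max_col_sum :: "nat \<Rightarrow> (nat \<Rightarrow> nat \<Rightarrow> real) \<Rightarrow> real" where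
  "max_col_sum n A = Max ((\<lambda>j. \<Sum>i\<in>{1..n}. \<bar>A i j\<bar>) ` {1..n})"

definition spectral_norm :: "nat \<Rightarrow> (nat \<Rightarrow> nat \<Rightarrow> real) \<Rightarrow> real" where
  "spectral_norm n A =
     (SUP v\<in>{v. L2_set v {1..n} \<le> 1}. L2_set (\<lambda>i. \<Sum>j\<in>{1..n}. A i j * v j) {1..n})"

end

theory Submission
  imports Defs "HOL-Real_Asymp.Real_Asymp"
begin

text \<open>
  Two consequences of the hypotheses carry the proof, both with constants independent of the
  dimension: a lower curvature bound for the heat semigroup and a logarithmic Sobolev inequality.

  For the canonical rates, flipping \<open>i\<close> then \<open>j\<close> has the same rate product as flipping \<open>j\<close> then \<open>i\<close>.
  Therefore the commutator of a discrete derivative with the generator involves first differences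
  only (\<open>delta_generator\<close>), with coefficients that are controlled by the entries of the Dobrushin matrix;
  its column sums give a curvature bound \<open>- 2 \<kappa>\<close>. Differentiating
  \<open>P s (sqrt (I (P (t - s) f)\<^sup>2 + \<gamma> s * \<Gamma> (P (t - s) f)))\<close> in \<open>s\<close> yields the local Bobkov inequality
  (\<open>local_Bobkov\<close>); the Gaussian profile enters through one tangent inequality. The same
  interpolation shows that derivatives commute with the semigroup up to a factor \<open>exp (4 \<kappa> t)\<close>
  (\<open>gradient_commutation\<close>).

  The logarithmic Sobolev inequality (\<open>log_Sobolev\<close>) is an approximate tensorization of entropy, in
  the spirit of Marton. Entropy is decomposed by the chain rule, averaging over which coordinate is
  revealed; the entropy of one marginal is at most a constant times its squared deviation, and a
  Dobrushin comparison argument bounds the vector of these deviations by the vector of local ones, losing \<open>1 / \<delta>\<close> in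
  Euclidean norm. Induction over the set of free coordinates keeps the constant fixed.

  The logarithmic Sobolev inequality gives a Poincare inequality and a decay of the second moment of
  \<open>P t h\<close> driven by the ratio of the \<open>L2\<close> and \<open>L1\<close> norms of \<open>h\<close> (\<open>hypercontractive_decay\<close>). Applied to the
  derivatives of \<open>f\<close> and combined with commutation, it gives \<open>L1_L2_inequality\<close>, from which the two
  bounds on the total influence and the KKL inequalities follow by elementary estimates.
  Applied to a Boolean function, it shows that \<open>P 1 f\<close> is mostly small when the mean is
  small; the local Bobkov inequality then gives Talagrand's surface-area bound. For the
  Eldan-Gross inequality the local Bobkov inequality is used at a time of order \<open>1 / ln (1 / J)\<close>, at
  which a fixed part of the variance has been lost (\<open>variance_halves_quickly\<close>).
\<close>

section \<open>The Gaussian isoperimetric profile\<close>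

abbreviation Phi :: "real \<Rightarrow> real" where
  "Phi \<equiv> cdf std_normal_distribution"

interpretation gauss: real_distribution std_normal_distribution
  by (rule real_dist_normal_dist)

lemma continuous_std_normal_density: "continuous_on S std_normal_density"
  unfolding normal_density_def by (intro continuous_intros) auto

text \<open>
  The density is continuous, so the distribution function is an antiderivative of it. The integral
  starts at \<open>a - 1\<close> because the fundamental theorem used below asks for two-sided derivatives at the
  endpoint \<open>a\<close>.
\<close>

lemma Phi_increment:
  assumes "a < y"
  shows "Phi y - Phi a = integral {a..y} std_normal_density"
proof -
  let ?F = "\<lambda>u. integral {a - 1..u} std_normal_density"
  have int: "std_normal_density integrable_on {u..v}" for u v
    by (intro integrable_continuous_interval continuous_std_normal_density)
  have "emeasure std_normal_distribution {a<..y} =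
      (\<integral>\<^sup>+t. ennreal (std_normal_density t) * indicator {a<..y} t \<partial>lborel)"
    by (subst emeasure_density) auto
  also have "\<dots> = (\<integral>\<^sup>+t. ennreal (std_normal_density t) * indicator {a..y} t \<partial>lborel)"
  proof (rule nn_integral_cong_AE)
    have "AE t in lborel. t \<noteq> a"
      by (rule AE_lborel_singleton)
    then show "AE t in lborel. ennreal (std_normal_density t) * indicator {a<..y} t =
        ennreal (std_normal_density t) * indicator {a..y} t"
      by eventually_elim (auto simp: indicator_def)
  qed
  also have "\<dots> = ennreal (?F y - ?F a)"
  proof (rule nn_integral_FTC_Icc)
    fix x assume "x \<in> {a..y}"
    then have "(?F has_real_derivative std_normal_density x) (at x within {a - 1..y + 1})"
      by (intro integral_has_real_derivative continuous_std_normal_density) auto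
    then show "(?F has_real_derivative std_normal_density x) (at x)"
      using \<open>x \<in> {a..y}\<close> by (simp add: at_within_Icc_at)
  qed (use assms normal_density_nonneg in auto)
  also have "?F y - ?F a = integral {a..y} std_normal_density"
    using Henstock_Kurzweil_Integration.integral_combine[OF _ _ int, of "a - 1" a y] assms by simp
  finally have "emeasure std_normal_distribution {a<..y} =
      ennreal (integral {a..y} std_normal_density)" .
  moreover have "0 \<le> integral {a..y} std_normal_density"
    by (rule integral_nonneg) (auto intro: int)
  ultimately show ?thesis
    using gauss.cdf_diff_eq[OF assms] by (simp add: measure_def)
qed

lemma Phi_has_derivative: "(Phi has_real_derivative std_normal_density x) (at x)"
proof -
  let ?F = "\<lambda>u. Phi (x - 1) + integral {x - 1..u} std_normal_density"
  have "((\<lambda>u. integral {x - 1..u} std_normal_density) has_real_derivative std_normal_density x)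
      (at x within {x - 1..x + 1})"
    by (intro integral_has_real_derivative continuous_std_normal_density) auto
  then have "(?F has_real_derivative std_normal_density x) (at x within {x - 1..x + 1})"
    by (auto intro!: derivative_eq_intros)
  then have "(?F has_real_derivative std_normal_density x) (at x)"
    by (simp add: at_within_Icc_at)
  then show ?thesis
  proof (rule has_field_derivative_transform_within_open[where S = "{x - 1<..<x + 1}"])
    fix u assume "u \<in> {x - 1<..<x + 1}"
    then show "?F u = Phi u"
      using Phi_increment[of "x - 1" u] by simp
  qed auto
qed

lemma Phi_strict_mono: "x < y \<Longrightarrow> Phi x < Phi y"
  using DERIV_pos_imp_increasing[of x y Phi] Phi_has_derivative
  by (meson normal_density_pos zero_less_one)

lemma Phi_less_iff: "Phi x < Phi y \<longleftrightarrow> x < y"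
  using Phi_strict_mono by (metis linorder_neqE not_less_iff_gr_or_eq)

lemma Phi_inj: "inj Phi"
proof (rule injI)
  fix x y assume "Phi x = Phi y"
  then show "x = y"
    using Phi_less_iff[of x y] Phi_less_iff[of y x] by linarith
qed

lemma Phi_pos: "0 < Phi x"
  using Phi_strict_mono[of "x - 1" x] gauss.cdf_nonneg[of "x - 1"] by simp

lemma Phi_less_1: "Phi x < 1"
  using Phi_strict_mono[of x "x + 1"] gauss.cdf_bounded_prob[of "x + 1"] by simp

lemma Phi_surj:
  assumes "0 < p" "p < 1"
  shows "\<exists>x. Phi x = p"
proof -
  have "\<forall>\<^sub>F x in at_bot. Phi x < p"
    using gauss.cdf_lim_at_bot assms(1) by (rule order_tendstoD)
  then obtain u where u: "Phi u < p"
    by (auto simp: eventually_at_bot_linorder)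
  have "\<forall>\<^sub>F x in at_top. p < Phi x"
    using gauss.cdf_lim_at_top_prob assms(2) by (rule order_tendstoD)
  then obtain v where v: "p < Phi v"
    by (auto simp: eventually_at_top_linorder)
  have "u \<le> v"
    using u v Phi_less_iff[of u v] by simp
  then show ?thesis
    using IVT[of Phi u p v] u v Phi_has_derivative
    by (meson DERIV_isCont less_imp_le)
qed

abbreviation gauss_quantile :: "real \<Rightarrow> real" where
  "gauss_quantile \<equiv> inv Phi"

lemma Phi_quantile:
  assumes "0 < p" "p < 1"
  shows "Phi (gauss_quantile p) = p"
  using Phi_surj[OF assms] by (metis f_inv_into_f rangeI)

lemma quantile_Phi: "gauss_quantile (Phi x) = x"
  by (simp add: Phi_inj)

lemma quantile_less_iff:
  assumes "0 < p" "p < 1"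
  shows "gauss_quantile p < x \<longleftrightarrow> p < Phi x" "x < gauss_quantile p \<longleftrightarrow> Phi x < p"
  using Phi_less_iff Phi_quantile[OF assms] by metis+

lemma quantile_isCont:
  assumes "0 < p" "p < 1"
  shows "isCont gauss_quantile p"
proof -
  let ?x = "gauss_quantile p"
  have "isCont gauss_quantile (Phi ?x)"
    by (rule isCont_inverse_function[where d = 1])
       (auto simp: quantile_Phi intro: DERIV_isCont[OF Phi_has_derivative])
  then show ?thesis
    by (simp add: Phi_quantile assms)
qed

lemma quantile_has_derivative:
  assumes "0 < p" "p < 1"
  shows "(gauss_quantile has_real_derivative 1 / gauss_profile p) (at p)"
proof -
  have "(gauss_quantile has_real_derivative inverse (std_normal_density (gauss_quantile p))) (at p)"
    by (rule DERIV_inverse_function[where a = 0 and b = 1 and f = Phi])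
       (auto simp: Phi_quantile assms quantile_isCont Phi_has_derivative
         intro!: less_imp_neq[symmetric] normal_density_pos)
  then show ?thesis
    using assms by (simp add: gauss_profile_def inverse_eq_divide)
qed

lemma std_normal_density_has_derivative:
  "(std_normal_density has_real_derivative - x * std_normal_density x) (at x)"
  unfolding normal_density_def
  by (auto intro!: derivative_eq_intros simp: power2_eq_square field_simps)

lemma gauss_profile_pos: "0 < p \<Longrightarrow> p < 1 \<Longrightarrow> 0 < gauss_profile p"
  by (simp add: gauss_profile_def normal_density_pos)

lemma gauss_profile_nonneg: "0 \<le> gauss_profile p"
  by (simp add: gauss_profile_def normal_density_nonneg)

lemma gauss_profile_endpoints [simp]: "gauss_profile 0 = 0" "gauss_profile 1 = 0"
  by (simp_all add: gauss_profile_def)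

text \<open>
  The profile satisfies \<open>I' = - Phi^-1\<close> and hence \<open>I'' = - 1 / I\<close>: it is concave, with a
  curvature that is controlled by its own value. All later properties come from these two identities.
\<close>

lemma gauss_profile_has_derivative:
  assumes "0 < p" "p < 1"
  shows "(gauss_profile has_real_derivative - gauss_quantile p) (at p)"
proof -
  have "((\<lambda>p. std_normal_density (gauss_quantile p)) has_real_derivative - gauss_quantile p) (at p)"
    using DERIV_chain2[OF std_normal_density_has_derivative quantile_has_derivative[OF assms]]
      gauss_profile_pos[OF assms] assms
    by (simp add: gauss_profile_def)
  then show ?thesis
    by (rule has_field_derivative_transform_within_open[where S = "{0<..<1}"])
       (use assms in \<open>auto simp: gauss_profile_def\<close>)
qed

lemma gauss_profile_tendsto_0:
  "(gauss_profile \<longlongrightarrow> 0) (at_right 0)" "(gauss_profile \<longlongrightarrow> 0) (at_left 1)"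
proof -
  have lims: "(std_normal_density \<longlongrightarrow> 0) at_bot" "(std_normal_density \<longlongrightarrow> 0) at_top"
    unfolding normal_density_def by real_asymp+
  have *: "\<forall>\<^sub>F p in at_right 0. 0 < p \<and> p < (1::real)"
    by (auto simp: eventually_at_right_less intro!: eventually_conj eventually_at_rightI[of 0 1])
  have **: "\<forall>\<^sub>F p in at_left 1. 0 < p \<and> p < (1::real)"
    by (auto intro!: eventually_at_leftI[of 0 1])
  have "filterlim gauss_quantile at_bot (at_right 0)"
    unfolding filterlim_at_bot_dense
  proof
    fix Z
    have "\<forall>\<^sub>F p in at_right 0. 0 < p \<and> p < Phi Z"
      using Phi_pos[of Z] by (auto intro!: eventually_at_rightI[of 0 "Phi Z"])
    then show "\<forall>\<^sub>F p in at_right 0. gauss_quantile p < Z"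
      using * by eventually_elim (simp add: quantile_less_iff)
  qed
  then have "((\<lambda>p. std_normal_density (gauss_quantile p)) \<longlongrightarrow> 0) (at_right 0)"
    by (rule filterlim_compose[OF lims(1)])
  then show "(gauss_profile \<longlongrightarrow> 0) (at_right 0)"
    by (rule Lim_transform_eventually) (use * in eventually_elim, simp add: gauss_profile_def)
  have "filterlim gauss_quantile at_top (at_left 1)"
    unfolding filterlim_at_top_dense
  proof
    fix Z
    have "\<forall>\<^sub>F p in at_left 1. Phi Z < p \<and> p < 1"
      using Phi_less_1[of Z] by (auto intro!: eventually_at_leftI[of "Phi Z" 1])
    then show "\<forall>\<^sub>F p in at_left 1. Z < gauss_quantile p"
      using ** by eventually_elim (simp add: quantile_less_iff)
  qed
  then have "((\<lambda>p. std_normal_density (gauss_quantile p)) \<longlongrightarrow> 0) (at_left 1)"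
    by (rule filterlim_compose[OF lims(2)])
  then show "(gauss_profile \<longlongrightarrow> 0) (at_left 1)"
    by (rule Lim_transform_eventually) (use ** in eventually_elim, simp add: gauss_profile_def)
qed

lemma gauss_profile_continuous: "continuous_on {0..1} gauss_profile"
  unfolding continuous_on_def
proof
  fix x :: real assume x: "x \<in> {0..1}"
  consider "x = 0" | "x = 1" | "0 < x" "x < 1"
    using x by fastforce
  then show "(gauss_profile \<longlongrightarrow> gauss_profile x) (at x within {0..1})"
  proof cases
    case 1
    then show ?thesis using gauss_profile_tendsto_0(1)
      by (simp add: at_within_Icc_at_right)
  next
    case 2
    then show ?thesis using gauss_profile_tendsto_0(2)
      by (simp add: at_within_Icc_at_left)
  next
    case 3
    then show ?thesis
      using DERIV_isCont[OF gauss_profile_has_derivative[of x]]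
      by (metis at_within_Icc_at isCont_def)
  qed
qed

lemma quantile_mono:
  assumes "0 < p" "p \<le> q" "q < 1"
  shows "gauss_quantile p \<le> gauss_quantile q"
  using assms Phi_quantile[of p] Phi_quantile[of q] Phi_less_iff[of "gauss_quantile q" "gauss_quantile p"]
  by linarith

text \<open>
  Concavity and the zero boundary values, through the mean value theorem on \<open>[0, p]\<close> and on
  \<open>[p, 1]\<close>: the profile lies above both of its chords to the endpoints, whose slopes are compared
  with the tangent slope \<open>- Phi^-1 p\<close>.
\<close>

lemma gauss_profile_ge_quantile:
  assumes p: "0 < p" "p < 1"
  shows "p * (1 - p) * \<bar>gauss_quantile p\<bar> \<le> gauss_profile p"
proof -
  have mvt: "\<exists>z. a < z \<and> z < b \<and> gauss_profile b - gauss_profile a = (b - a) * (- gauss_quantile z)"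
    if "0 \<le> a" "a < b" "b \<le> 1" for a b
  proof -
    have "continuous_on {a..b} gauss_profile"
      using that by (intro continuous_on_subset[OF gauss_profile_continuous]) auto
    moreover have "(gauss_profile has_real_derivative - gauss_quantile z) (at z)" if "a < z" "z < b" for z
      using that \<open>0 \<le> a\<close> \<open>b \<le> 1\<close> by (intro gauss_profile_has_derivative) auto
    ultimately obtain l z where "a < z" "z < b" "(gauss_profile has_real_derivative l) (at z)"
      "gauss_profile b - gauss_profile a = (b - a) * l"
      using MVT[of a b gauss_profile] \<open>a < b\<close> real_differentiable_def by metis
    moreover from this have "l = - gauss_quantile z"
      using that by (intro DERIV_unique[OF _ gauss_profile_has_derivative]) auto
    ultimately show ?thesis by blast
  qed
  obtain z where z: "0 < z" "z < p" "gauss_profile p = p * (- gauss_quantile z)"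
    using mvt[of 0 p] p by auto
  obtain w where w: "p < w" "w < 1" "gauss_profile p = (1 - p) * gauss_quantile w"
    using mvt[of p 1] p by auto
  have 1: "p * (- gauss_quantile p) \<le> gauss_profile p"
    unfolding z(3) using z p quantile_mono[of z p] by (intro mult_left_mono) auto
  have 2: "(1 - p) * gauss_quantile p \<le> gauss_profile p"
    unfolding w(3) using w p quantile_mono[of p w] by (intro mult_left_mono) auto
  show ?thesis
  proof (cases "0 \<le> gauss_quantile p")
    case True
    have "p * ((1 - p) * gauss_quantile p) \<le> 1 * ((1 - p) * gauss_quantile p)"
      using p True by (intro mult_right_mono) auto
    then show ?thesis using 2 True by (simp add: mult.assoc)
  next
    case False
    have "(1 - p) * (p * - gauss_quantile p) \<le> 1 * (p * - gauss_quantile p)"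
      using p False by (intro mult_right_mono mult_nonneg_nonneg) auto
    then show ?thesis using 1 False by (simp add: mult_ac)
  qed
qed

definition profile_const :: real where
  "profile_const = exp (- 1 / 2) / sqrt (2 * pi)"

lemma profile_const_pos: "0 < profile_const"
  by (simp add: profile_const_def)

lemma profile_const_le_1: "profile_const \<le> 1"
proof -
  have "1 \<le> sqrt (2 * pi)"
    using pi_gt3 by simp
  then show ?thesis
    unfolding profile_const_def by (intro divide_le_eq_1_pos[THEN iffD2]) (auto intro: order_trans[of _ 1])
qed

lemma gauss_profile_ge_variance:
  assumes p: "0 \<le> p" "p \<le> 1"
  shows "profile_const * (p * (1 - p)) \<le> gauss_profile p"
proof (cases "p = 0 \<or> p = 1")
  case False
  then have p: "0 < p" "p < 1" using p by auto
  then have var: "0 \<le> p * (1 - p)" "p * (1 - p) \<le> 1"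
    using mult_le_one[of p "1 - p"] by auto
  let ?q = "gauss_quantile p"
  show ?thesis
  proof (cases "1 \<le> \<bar>?q\<bar>")
    case True
    have "profile_const * (p * (1 - p)) \<le> \<bar>?q\<bar> * (p * (1 - p))"
      using var True profile_const_le_1 by (intro mult_right_mono) auto
    then show ?thesis
      using gauss_profile_ge_quantile[OF p] by (simp add: mult_ac)
  next
    case False
    then have "?q\<^sup>2 \<le> 1"
      by (simp add: abs_square_le_1)
    then have "profile_const \<le> std_normal_density ?q"
      by (auto simp: profile_const_def std_normal_density_def intro!: divide_right_mono)
    moreover have "profile_const * (p * (1 - p)) \<le> profile_const * 1"
      using var profile_const_pos by (intro mult_left_mono) auto
    ultimately show ?thesis
      using p by (simp add: gauss_profile_def)
  qed
qed auto

text \<open>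
  The Gaussian tail behaviour of the profile without estimates of Gaussian tails: with
  \<open>x = Phi^-1 p\<close>, either \<open>x\<^sup>2 \<ge> ln (1/p)\<close> and the chord bound above gives
  the factor \<open>sqrt (ln (1/p))\<close>, or \<open>I p = exp (- x\<^sup>2 / 2) / sqrt (2 pi)\<close> is at least of order
  \<open>sqrt p\<close>, which is larger still.
\<close>

lemma gauss_profile_ge_log:
  assumes p: "0 \<le> p" "p \<le> 1"
  shows "profile_const * (p * (1 - p) * sqrt (ln (1 / p))) \<le> gauss_profile p"
proof (cases "p = 0 \<or> p = 1")
  case False
  then have p: "0 < p" "p < 1" using p by auto
  let ?q = "gauss_quantile p" and ?l = "ln (1 / p)"
  have l: "0 \<le> ?l" using p by simp
  have var: "0 \<le> p * (1 - p)" using p by simp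
  show ?thesis
  proof (cases "?l \<le> ?q\<^sup>2")
    case True
    then have "sqrt ?l \<le> \<bar>?q\<bar>"
      by (metis real_sqrt_abs real_sqrt_le_mono)
    then have "p * (1 - p) * sqrt ?l \<le> gauss_profile p"
      using gauss_profile_ge_quantile[OF p] mult_left_mono[OF _ var] by fastforce
    moreover have "profile_const * (p * (1 - p) * sqrt ?l) \<le> 1 * (p * (1 - p) * sqrt ?l)"
      using profile_const_le_1 var l by (intro mult_right_mono) auto
    ultimately show ?thesis by simp
  next
    case False
    have sq: "exp (- ?l / 2) = sqrt p"
    proof -
      have "(exp (- ?l / 2))\<^sup>2 = exp (- ?l)"
        by (simp add: power2_eq_square flip: exp_add)
      also have "\<dots> = p" using p by (simp add: ln_div)
      finally show ?thesis by (simp add: real_sqrt_unique)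
    qed
    have "?l \<le> 1 / p - 1"
      using p by (intro ln_le_minus_one) auto
    then have "p * p * ?l \<le> p * p * (1 / p - 1)"
      using p by (intro mult_left_mono) auto
    also have "\<dots> = p - p * p" using p by (simp add: field_simps)
    also have "\<dots> \<le> p" using p by simp
    finally have "sqrt (p * p * ?l) \<le> sqrt p"
      by simp
    then have "p * sqrt ?l \<le> sqrt p"
      using p by (simp add: real_sqrt_mult)
    then have "(1 - p) * (p * sqrt ?l) \<le> 1 * sqrt p"
      using p l by (intro mult_mono) auto
    then have "profile_const * (p * (1 - p) * sqrt ?l) \<le> profile_const * sqrt p"
      using profile_const_pos by (intro mult_left_mono) (auto simp: mult_ac)
    also have "\<dots> \<le> exp (- ?q\<^sup>2 / 2) / sqrt (2 * pi)"
    proof -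
      have "exp (- 1 / 2) * exp (- ?l / 2) \<le> 1 * exp (- ?q\<^sup>2 / 2)"
        using False by (intro mult_mono) auto
      then show ?thesis
        unfolding profile_const_def sq[symmetric] by (simp add: divide_right_mono)
    qed
    also have "\<dots> = gauss_profile p"
      using p by (simp add: gauss_profile_def std_normal_density_def)
    finally show ?thesis .
  qed
qed auto

lemma gauss_profile_chord:
  assumes "0 < a" "a < 1" "0 < b" "b < 1" "0 \<le> u" "u \<le> 1"
  shows "u * gauss_profile a \<le> gauss_profile (u * a + (1 - u) * b)"
proof -
  have "concave_on {0<..<1} gauss_profile"
  proof (rule f''_le0_imp_concave)
    fix x :: real assume "x \<in> {0<..<1}"
    then show "(gauss_profile has_real_derivative - gauss_quantile x) (at x)"
      "((\<lambda>x. - gauss_quantile x) has_real_derivative - (1 / gauss_profile x)) (at x)"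
      "- (1 / gauss_profile x) \<le> 0"
      using gauss_profile_has_derivative quantile_has_derivative gauss_profile_nonneg
      by (auto intro!: derivative_intros)
  qed auto
  then have "u * gauss_profile a + (1 - u) * gauss_profile b \<le> gauss_profile (u * a + (1 - u) * b)"
    using assms unfolding concave_on_iff by auto
  then show ?thesis
    using gauss_profile_nonneg[of b] assms by (smt (verit) mult_nonneg_nonneg)
qed

text \<open>
  This inequality is the only property of the profile that enters the local Bobkov inequality.
  The defect \<open>w s\<close> of the tangent at \<open>s\<close>, evaluated at the fixed point \<open>b\<close>, has derivative
  \<open>- I a (b - s) / I s\<close> since \<open>I'' = - 1 / I\<close>; concavity bounds \<open>I s\<close> below by
  \<open>I a (b - s) / (b - a)\<close>, so the derivative is at most \<open>|b - a|\<close> in modulus and the mean value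
  theorem finishes.
\<close>

lemma gauss_profile_tangent:
  assumes a: "0 < a" "a < 1" and b: "0 < b" "b < 1"
  shows "- (b - a)\<^sup>2 \<le> gauss_profile a * (gauss_profile b - gauss_profile a + gauss_quantile a * (b - a))"
proof (cases "a = b")
  case False
  define w where "w s = gauss_profile a * (gauss_profile s - gauss_quantile s * (b - s) - gauss_profile b)" for s
  define w' where "w' s = - (gauss_profile a * ((b - s) / gauss_profile s))" for s
  have der: "(w has_real_derivative w' s) (at s)" if "0 < s" "s < 1" for s
    unfolding w_def w'_def
    using that gauss_profile_has_derivative[OF that] quantile_has_derivative[OF that]
    by (auto intro!: derivative_eq_intros simp: algebra_simps diff_divide_distrib)
  have bound: "\<bar>w' s\<bar> \<le> \<bar>b - a\<bar>" if s: "s \<in> open_segment a b" for s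
  proof -
    from s obtain u where u: "0 < u" "u < 1" "s = (1 - u) * a + u * b"
      by (auto simp: in_segment)
    have s01: "0 < s" "s < 1"
      using u a b by (auto intro!: add_pos_pos simp: convex_bound_lt)
    have "(1 - u) * gauss_profile a \<le> gauss_profile s"
      using gauss_profile_chord[of a b "1 - u"] u a b by simp
    then have le_1: "gauss_profile a * (1 - u) / gauss_profile s \<le> 1"
      using gauss_profile_pos[OF s01] by (simp add: mult.commute)
    moreover have "b - s = (1 - u) * (b - a)"
      using u by (simp add: algebra_simps)
    ultimately have "\<bar>w' s\<bar> = (gauss_profile a * (1 - u) / gauss_profile s) * \<bar>b - a\<bar>"
      using u gauss_profile_pos[OF s01] gauss_profile_pos[OF a]
      by (simp add: w'_def abs_mult)
    also have "\<dots> \<le> 1 * \<bar>b - a\<bar>"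
      using le_1 by (rule mult_right_mono) simp
    finally show ?thesis by simp
  qed
  obtain s where s: "s \<in> open_segment a b" "w b - w a = (b - a) * w' s"
  proof (cases "a < b")
    case True
    then obtain s where "a < s" "s < b" "w b - w a = (b - a) * w' s"
      using MVT2[of a b w w'] der a b by force
    then show ?thesis using that[of s] True by (simp add: open_segment_eq_real_ivl)
  next
    case False
    then have "b < a" using \<open>a \<noteq> b\<close> by simp
    then obtain s where "b < s" "s < a" "w a - w b = (a - b) * w' s"
      using MVT2[of b a w w'] der a b by force
    then show ?thesis using that[of s] \<open>b < a\<close>
      by (simp add: open_segment_eq_real_ivl algebra_simps)
  qed
  have "w b = 0" by (simp add: w_def)
  then have "w a \<le> \<bar>b - a\<bar> * \<bar>w' s\<bar>"
    using s(2) by (metis abs_ge_self abs_minus_cancel abs_mult diff_0)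
  also have "\<dots> \<le> \<bar>b - a\<bar> * \<bar>b - a\<bar>"
    using bound[OF s(1)] by (rule mult_left_mono) simp
  finally show ?thesis
    by (simp add: w_def power2_eq_square algebra_simps)
qed auto

lemma finite_cube [simp]: "finite (cube n)"
  unfolding cube_def by (intro finite_PiE) auto

lemma cube_nonempty: "cube n \<noteq> {}"
  unfolding cube_def by (auto simp: PiE_eq_empty_iff)

lemma flip_in_cube [simp]: "x \<in> cube n \<Longrightarrow> i \<in> {1..n} \<Longrightarrow> flip i x \<in> cube n"
  unfolding cube_def flip_def by (fastforce simp: PiE_iff extensional_def)

lemma flip_flip [simp]: "flip i (flip i x) = x"
  by (simp add: flip_def)

lemma flip_commute: "flip i (flip j x) = flip j (flip i x)"
  by (auto simp: flip_def)

lemma sum_cube_flip: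
  assumes "i \<in> {1..n}"
  shows "(\<Sum>x\<in>cube n. h (flip i x)) = (\<Sum>x\<in>cube n. h x)"
  by (rule sum.reindex_bij_witness[of _ "flip i" "flip i"]) (use assms in auto)

section \<open>Reversible spin systems on the cube\<close>

text \<open>
  The bounds on the weights make the jump rates comparable to constants: they lie between \<open>b / 2\<close>
  and \<open>1 / (2 b)\<close>.
\<close>

locale spin_system =
  fixes n :: nat and \<mu> :: "config pmf" and b :: real
  assumes dim: "1 \<le> n" and supp: "set_pmf \<mu> = cube n" and b: "0 < b" "b \<le> 1"
    and weights: "\<And>x i. x \<in> cube n \<Longrightarrow> i \<in> {1..n} \<Longrightarrow> weight \<mu> i x \<in> {b..1/b}"
begin

abbreviation L :: "(config \<Rightarrow> real) \<Rightarrow> config \<Rightarrow> real" where "L \<equiv> generator n \<mu>"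
abbreviation P :: "real \<Rightarrow> (config \<Rightarrow> real) \<Rightarrow> config \<Rightarrow> real" where "P \<equiv> heat_semigroup n \<mu>"
abbreviation q :: "nat \<Rightarrow> config \<Rightarrow> real" where "q \<equiv> rate \<mu>"

definition mean :: "(config \<Rightarrow> real) \<Rightarrow> real" where
  "mean h = (\<Sum>x\<in>cube n. pmf \<mu> x * h x)"

lemma expectation_eq_mean: "measure_pmf.expectation \<mu> h = mean h"
  unfolding mean_def
  by (subst integral_measure_pmf_real[of "cube n"]) (auto simp: supp mult.commute)

lemma pmf_pos: "x \<in> cube n \<Longrightarrow> 0 < pmf \<mu> x"
  using supp by (metis pmf_positive)

lemma sum_pmf: "(\<Sum>x\<in>cube n. pmf \<mu> x) = 1"
  using sum_pmf_eq_1[of "cube n" \<mu>] supp by simp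

lemma mean_const [simp]: "mean (\<lambda>_. c) = c"
  unfolding mean_def by (simp add: sum_pmf flip: sum_distrib_right)

lemma mean_add: "mean (\<lambda>x. g x + h x) = mean g + mean h"
  unfolding mean_def by (simp add: distrib_left sum.distrib)

lemma mean_diff: "mean (\<lambda>x. g x - h x) = mean g - mean h"
  unfolding mean_def by (simp add: right_diff_distrib sum_subtractf)

lemma mean_cmult: "mean (\<lambda>x. c * h x) = c * mean h"
  unfolding mean_def by (simp add: sum_distrib_left mult_ac)

lemma mean_sum: "mean (\<lambda>x. \<Sum>i\<in>A. h i x) = (\<Sum>i\<in>A. mean (h i))"
  unfolding mean_def by (simp add: sum_distrib_left sum.swap[of _ A])

lemma mean_mono: "(\<And>x. x \<in> cube n \<Longrightarrow> g x \<le> h x) \<Longrightarrow> mean g \<le> mean h"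
  unfolding mean_def by (intro sum_mono mult_left_mono) auto

lemma mean_nonneg: "(\<And>x. x \<in> cube n \<Longrightarrow> 0 \<le> h x) \<Longrightarrow> 0 \<le> mean h"
  unfolding mean_def by (intro sum_nonneg mult_nonneg_nonneg) auto

lemma mean_cong: "(\<And>x. x \<in> cube n \<Longrightarrow> g x = h x) \<Longrightarrow> mean g = mean h"
  unfolding mean_def by (intro sum.cong) auto

lemma mean_eq_0_iff:
  assumes "\<And>x. x \<in> cube n \<Longrightarrow> 0 \<le> h x"
  shows "mean h = 0 \<longleftrightarrow> (\<forall>x\<in>cube n. h x = 0)"
proof -
  have "mean h = 0 \<longleftrightarrow> (\<forall>x\<in>cube n. pmf \<mu> x * h x = 0)"
    unfolding mean_def using assms by (intro sum_nonneg_eq_0_iff) auto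
  then show ?thesis using pmf_pos by fastforce
qed

lemma mean_has_derivative:
  assumes "\<And>x. x \<in> cube n \<Longrightarrow> ((\<lambda>t. u t x) has_real_derivative u' x) (at t within S)"
  shows "((\<lambda>t. mean (u t)) has_real_derivative mean u') (at t within S)"
  unfolding mean_def by (rule DERIV_sum) (auto intro!: derivative_eq_intros assms)

lemma variance_eq: "Var \<mu> f = mean (\<lambda>x. (f x - mean f)\<^sup>2)"
  by (simp add: expectation_eq_mean)

lemma variance_eq': "Var \<mu> f = mean (\<lambda>x. (f x)\<^sup>2) - (mean f)\<^sup>2"
proof -
  have "(f x - mean f)\<^sup>2 = (f x)\<^sup>2 - 2 * mean f * f x + (mean f)\<^sup>2" for x
    by (simp add: power2_eq_square algebra_simps)
  then have "Var \<mu> f = mean (\<lambda>x. (f x)\<^sup>2 - 2 * mean f * f x + (mean f)\<^sup>2)"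
    by (simp add: variance_eq)
  also have "\<dots> = mean (\<lambda>x. (f x)\<^sup>2) - 2 * mean f * mean f + (mean f)\<^sup>2"
    by (subst mean_add, subst mean_diff, subst mean_cmult) simp
  finally show ?thesis by (simp add: power2_eq_square)
qed

lemma rate_eq_weight: "q i x = weight \<mu> i x / 2"
  by (simp add: rate_def weight_def)

lemma rate_bounds:
  assumes "x \<in> cube n" "i \<in> {1..n}"
  shows "b / 2 \<le> q i x" "q i x \<le> 1 / (2 * b)" "0 < q i x"
  using weights[OF assms] b by (auto simp: rate_eq_weight field_simps)

text \<open>Reversibility of the canonical rates, along one edge and around a square of the cube.\<close>

lemma detailed_balance:
  assumes "x \<in> cube n" "i \<in> {1..n}"
  shows "pmf \<mu> x * q i x = pmf \<mu> (flip i x) * q i (flip i x)"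
proof -
  have *: "c * sqrt (d / c) = sqrt c * sqrt d" if "0 < c" "0 < d" for c d :: real
    using that by (simp add: real_sqrt_divide real_div_sqrt field_simps)
  show ?thesis
    using *[of "pmf \<mu> x" "pmf \<mu> (flip i x)"] *[of "pmf \<mu> (flip i x)" "pmf \<mu> x"]
      pmf_pos[OF assms(1)] pmf_pos[OF flip_in_cube[OF assms]]
    by (simp add: rate_def)
qed

lemma rate_square:
  assumes "x \<in> cube n" "i \<in> {1..n}" "j \<in> {1..n}"
  shows "q i x * q j (flip i x) = q j x * q i (flip j x)"
  using pmf_pos[OF assms(1)] pmf_pos[OF flip_in_cube[OF assms(1,2)]]
    pmf_pos[OF flip_in_cube[OF assms(1,3)]]
  by (simp add: rate_def real_sqrt_divide flip_commute[of i j])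

section \<open>The heat semigroup\<close>

lemma generator_cong: "(\<And>x. x \<in> cube n \<Longrightarrow> f x = g x) \<Longrightarrow> x \<in> cube n \<Longrightarrow> L f x = L g x"
  unfolding generator_def by (intro sum.cong) auto

lemma generator_sum:
  "L (\<lambda>z. \<Sum>y\<in>A. c y * h y z) x = (\<Sum>y\<in>A. c y * L (h y) x)"
proof -
  have "L (\<lambda>z. \<Sum>y\<in>A. c y * h y z) x = (\<Sum>i\<in>{1..n}. \<Sum>y\<in>A. q i x * (c y * h y (flip i x)) - q i x * (c y * h y x))"
    unfolding generator_def by (simp only: right_diff_distrib sum_distrib_left sum_subtractf)
  also have "\<dots> = (\<Sum>y\<in>A. \<Sum>i\<in>{1..n}. q i x * (c y * h y (flip i x)) - q i x * (c y * h y x))"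
    by (rule sum.swap)
  also have "\<dots> = (\<Sum>y\<in>A. c y * L (h y) x)"
    unfolding generator_def sum_distrib_left by (intro sum.cong refl) (simp add: algebra_simps)
  finally show ?thesis .
qed

lemma generator_pow_cong:
  assumes "\<And>x. x \<in> cube n \<Longrightarrow> f x = g x"
  shows "x \<in> cube n \<Longrightarrow> (L ^^ k) f x = (L ^^ k) g x"
  by (induction k arbitrary: x) (auto simp: assms intro!: generator_cong)

lemma generator_pow_sum: "(L ^^ k) (\<lambda>z. \<Sum>y\<in>A. c y * h y z) x = (\<Sum>y\<in>A. c y * (L ^^ k) (h y) x)"
proof (induction k arbitrary: x)
  case (Suc k)
  then have "(L ^^ k) (\<lambda>z. \<Sum>y\<in>A. c y * h y z) = (\<lambda>z. \<Sum>y\<in>A. c y * (L ^^ k) (h y) z)"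
    by auto
  then show ?case by (simp add: generator_sum)
qed simp

text \<open>
  On the finite cube the generator is bounded, so the exponential series converges for all times and
  may be differentiated term by term.
\<close>

lemma generator_bound:
  assumes "\<And>x. x \<in> cube n \<Longrightarrow> \<bar>f x\<bar> \<le> M" "x \<in> cube n"
  shows "\<bar>L f x\<bar> \<le> (real n / b) * M"
proof -
  have "\<bar>L f x\<bar> \<le> (\<Sum>i\<in>{1..n}. \<bar>q i x * (f (flip i x) - f x)\<bar>)"
    unfolding generator_def by (rule sum_abs)
  also have "\<dots> \<le> (\<Sum>i\<in>{1..n}. 1 / (2 * b) * (2 * M))"
  proof (rule sum_mono)
    fix i assume i: "i \<in> {1..n}"
    have "\<bar>f (flip i x) - f x\<bar> \<le> 2 * M"
      using assms(1)[OF assms(2)] assms(1)[OF flip_in_cube[OF assms(2) i]] by linarith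
    then show "\<bar>q i x * (f (flip i x) - f x)\<bar> \<le> 1 / (2 * b) * (2 * M)"
      using rate_bounds[OF assms(2) i] b unfolding abs_mult by (intro mult_mono) auto
  qed
  finally show ?thesis using b by simp
qed

lemma generator_pow_bound:
  assumes "\<And>x. x \<in> cube n \<Longrightarrow> \<bar>f x\<bar> \<le> M"
  shows "x \<in> cube n \<Longrightarrow> \<bar>(L ^^ k) f x\<bar> \<le> (real n / b) ^ k * M"
proof (induction k arbitrary: x)
  case (Suc k)
  then show ?case using generator_bound[of "(L ^^ k) f" "(real n / b) ^ k * M" x] by (simp add: mult.assoc)
qed (simp add: assms)

lemma bounded_on_cube: "\<exists>M. \<forall>x\<in>cube n. \<bar>f x\<bar> \<le> (M::real)"
  by (rule exI[of _ "\<Sum>x\<in>cube n. \<bar>f x\<bar>"]) (auto intro: member_le_sum)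

lemma semigroup_summable:
  assumes "x \<in> cube n"
  shows "summable (\<lambda>k. (L ^^ k) f x / fact k * t ^ k)"
proof -
  obtain M where M: "\<And>x. x \<in> cube n \<Longrightarrow> \<bar>f x\<bar> \<le> M"
    using bounded_on_cube[of f] by auto
  have "summable (\<lambda>k. M * ((real n / b * \<bar>t\<bar>) ^ k /\<^sub>R fact k))"
    by (intro summable_mult summable_exp_generic)
  then show ?thesis
  proof (rule summable_comparison_test[rotated], intro exI allI impI)
    fix k
    have "\<bar>(L ^^ k) f x\<bar> * \<bar>t\<bar> ^ k \<le> (real n / b) ^ k * M * \<bar>t\<bar> ^ k"
      by (intro mult_right_mono generator_pow_bound M assms) auto
    then have "\<bar>(L ^^ k) f x\<bar> * \<bar>t\<bar> ^ k / fact k \<le> (real n / b) ^ k * M * \<bar>t\<bar> ^ k / fact k"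
      by (rule divide_right_mono) simp
    then show "norm ((L ^^ k) f x / fact k * t ^ k) \<le> M * ((real n / b * \<bar>t\<bar>) ^ k /\<^sub>R fact k)"
      by (simp add: abs_mult power_abs power_mult_distrib divide_inverse mult_ac power_divide)
  qed
qed

lemma semigroup_series: "P t f x = (\<Sum>k. (L ^^ k) f x / fact k * t ^ k)"
  unfolding heat_semigroup_def by (intro suminf_cong) simp

lemma semigroup_0 [simp]: "P 0 f = f"
proof
  fix x
  have "(\<lambda>k. (L ^^ k) f x / fact k * 0 ^ k) = (\<lambda>k. if k = 0 then f x else 0)"
    by auto
  then show "P 0 f x = f x"
    unfolding semigroup_series using sums_unique[OF sums_single[of 0 "\<lambda>_. f x"]] by simp
qed

lemma semigroup_has_derivative:
  assumes "x \<in> cube n"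
  shows "((\<lambda>t. P t f x) has_real_derivative P t (L f) x) (at t within S)"
proof -
  let ?c = "\<lambda>k. (L ^^ k) f x / fact k"
  have "((\<lambda>t. \<Sum>k. ?c k * t ^ k) has_real_derivative (\<Sum>k. diffs ?c k * t ^ k)) (at t)"
    by (rule termdiffs_strong_converges_everywhere) (rule semigroup_summable[OF assms])
  moreover have "diffs ?c k = (L ^^ k) (L f) x / fact k" for k
    by (simp add: diffs_def funpow_swap1 del: funpow.simps(2) of_nat_Suc)
       (simp add: funpow_Suc_right del: funpow.simps)
  ultimately show ?thesis
    unfolding semigroup_series by (simp add: has_field_derivative_at_within)
qed

lemma semigroup_cong:
  assumes "\<And>x. x \<in> cube n \<Longrightarrow> f x = g x" "x \<in> cube n"
  shows "P t f x = P t g x"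
  unfolding semigroup_series using generator_pow_cong[OF assms] by simp

lemma semigroup_sum:
  assumes "x \<in> cube n"
  shows "P t (\<lambda>z. \<Sum>y\<in>A. c y * h y z) x = (\<Sum>y\<in>A. c y * P t (h y) x)"
proof -
  have "P t (\<lambda>z. \<Sum>y\<in>A. c y * h y z) x = (\<Sum>k. \<Sum>y\<in>A. c y * ((L ^^ k) (h y) x / fact k * t ^ k))"
    unfolding semigroup_series generator_pow_sum sum_divide_distrib sum_distrib_right
    by (simp add: mult.assoc)
  also have "\<dots> = (\<Sum>y\<in>A. \<Sum>k. c y * ((L ^^ k) (h y) x / fact k * t ^ k))"
    by (intro suminf_sum summable_mult semigroup_summable assms)
  also have "\<dots> = (\<Sum>y\<in>A. c y * P t (h y) x)"
    unfolding semigroup_series by (intro sum.cong refl suminf_mult semigroup_summable assms)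
  finally show ?thesis .
qed

text \<open>
  The transition probabilities of the semigroup. Writing \<open>P t f\<close> as a finite sum over the cube makes
  limits and derivatives of \<open>P\<close> applied to a time-dependent function routine.
\<close>

definition kern :: "real \<Rightarrow> config \<Rightarrow> config \<Rightarrow> real" where
  "kern t x y = P t (\<lambda>z. if z = y then 1 else 0) x"

lemma expand_point_masses:
  "x \<in> cube n \<Longrightarrow> f x = (\<Sum>y\<in>cube n. f y * (if x = y then 1 else 0 :: real))"
  by (simp add: if_distrib[of "\<lambda>z. f _ * z"] cong: if_cong)

lemma semigroup_kern:
  assumes "x \<in> cube n"
  shows "P t f x = (\<Sum>y\<in>cube n. f y * kern t x y)"
  unfolding kern_def semigroup_sum[OF assms, symmetric]
  by (rule semigroup_cong[OF _ assms]) (rule expand_point_masses)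

lemma semigroup_generator_commute:
  assumes "x \<in> cube n"
  shows "L (P t f) x = P t (L f) x"
proof -
  let ?s = "\<lambda>z k. (L ^^ k) f z / fact k * t ^ k"
  have "L (P t f) x = (\<Sum>i\<in>{1..n}. q i x * ((\<Sum>k. ?s (flip i x) k) - (\<Sum>k. ?s x k)))"
    unfolding generator_def[of _ _ "P t f"] semigroup_series ..
  also have "\<dots> = (\<Sum>i\<in>{1..n}. \<Sum>k. q i x * (?s (flip i x) k - ?s x k))"
  proof (intro sum.cong refl)
    fix i assume "i \<in> {1..n}"
    then have "flip i x \<in> cube n" using assms by simp
    then have s: "summable (?s (flip i x))" "summable (?s x)"
      using semigroup_summable assms by blast+
    show "q i x * ((\<Sum>k. ?s (flip i x) k) - (\<Sum>k. ?s x k)) = (\<Sum>k. q i x * (?s (flip i x) k - ?s x k))"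
      unfolding suminf_diff[OF s] by (rule suminf_mult[OF summable_diff[OF s], symmetric])
  qed
  also have "\<dots> = (\<Sum>k. \<Sum>i\<in>{1..n}. q i x * (?s (flip i x) k - ?s x k))"
    using assms by (intro suminf_sum[symmetric] summable_mult summable_diff semigroup_summable flip_in_cube)
  also have "\<dots> = (\<Sum>k. (L (\<lambda>z. ?s z k)) x)"
    unfolding generator_def[of _ _ "\<lambda>z. ?s z _"] ..
  also have "\<dots> = (\<Sum>k. (L ^^ k) (L f) x / fact k * t ^ k)"
  proof (rule suminf_cong)
    fix k
    have "(L (\<lambda>z. (L ^^ k) f z / fact k * t ^ k)) x = L ((L ^^ k) f) x / fact k * t ^ k"
      unfolding generator_def[of _ _ "(L ^^ k) f"] generator_def[of _ _ "\<lambda>z. (L ^^ k) f z / fact k * t ^ k"]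
        sum_divide_distrib sum_distrib_right
      by (simp add: diff_divide_distrib algebra_simps)
    also have "L ((L ^^ k) f) x = (L ^^ k) (L f) x"
      by (metis funpow_swap1)
    finally show "(L (\<lambda>z. (L ^^ k) f z / fact k * t ^ k)) x = (L ^^ k) (L f) x / fact k * t ^ k" .
  qed
  finally show ?thesis unfolding semigroup_series .
qed

lemma kern_has_derivative:
  assumes "x \<in> cube n"
  shows "((\<lambda>s. kern s x y) has_real_derivative P s (L (\<lambda>z. if z = y then 1 else 0)) x) (at s within S)"
  unfolding kern_def by (rule semigroup_has_derivative[OF assms])

lemma semigroup_add:
  "x \<in> cube n \<Longrightarrow> P t (\<lambda>y. f y + g y) x = P t f x + P t g x"
  by (simp add: semigroup_kern distrib_right sum.distrib)

lemma semigroup_diff: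
  "x \<in> cube n \<Longrightarrow> P t (\<lambda>y. f y - g y) x = P t f x - P t g x"
  by (simp add: semigroup_kern left_diff_distrib sum_subtractf)

lemma semigroup_cmult:
  "x \<in> cube n \<Longrightarrow> P t (\<lambda>y. c * f y) x = c * P t f x"
  by (simp add: semigroup_kern sum_distrib_left mult_ac)

text \<open>
  The semigroup argument behind both gradient estimates: to compare \<open>P t (F t)\<close> with \<open>F 0\<close> it
  suffices to know the sign of \<open>L (F s) + d/ds (F s)\<close>.
\<close>

lemma interpolation_has_derivative:
  assumes x: "x \<in> cube n"
    and F: "\<And>y. y \<in> cube n \<Longrightarrow> ((\<lambda>s. F s y) has_real_derivative F' y) (at s)"
  shows "((\<lambda>s. P s (F s) x) has_real_derivative P s (\<lambda>y. L (F s) y + F' y) x) (at s)"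
proof -
  let ?e = "\<lambda>y z. if z = y then 1 else 0 :: real"
  have "((\<lambda>s. \<Sum>y\<in>cube n. F s y * kern s x y) has_real_derivative
      (\<Sum>y\<in>cube n. F s y * P s (L (?e y)) x + F' y * kern s x y)) (at s)"
    by (rule DERIV_sum) (auto intro!: derivative_eq_intros F kern_has_derivative x)
  moreover have "(\<Sum>y\<in>cube n. F s y * P s (L (?e y)) x) = P s (L (F s)) x"
  proof -
    have "P s (L (F s)) x = P s (\<lambda>z. \<Sum>y\<in>cube n. F s y * L (?e y) z) x"
    proof (rule semigroup_cong[OF _ x])
      fix z assume "z \<in> cube n"
      then show "L (F s) z = (\<Sum>y\<in>cube n. F s y * L (?e y) z)"
        unfolding generator_sum[symmetric]
        by (intro generator_cong expand_point_masses)
    qed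
    then show ?thesis by (simp add: semigroup_sum[OF x])
  qed
  ultimately show ?thesis
    by (simp add: semigroup_kern[OF x, of _ "F _"] semigroup_kern[OF x, of s F'] semigroup_add[OF x]
        sum.distrib)
qed

definition dirichlet :: "(config \<Rightarrow> real) \<Rightarrow> (config \<Rightarrow> real) \<Rightarrow> real" where
  "dirichlet g h = 1/2 * mean (\<lambda>x. \<Sum>i\<in>{1..n}. q i x * ((g (flip i x) - g x) * (h (flip i x) - h x)))"

lemma mean_flip_symmetric:
  assumes "i \<in> {1..n}"
  shows "mean (\<lambda>x. q i x * h (flip i x)) = mean (\<lambda>x. q i x * h x)"
proof -
  have "mean (\<lambda>x. q i x * h (flip i x)) = (\<Sum>x\<in>cube n. pmf \<mu> (flip i x) * q i (flip i x) * h (flip i x))"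
    unfolding mean_def
  proof (rule sum.cong)
    fix x assume "x \<in> cube n"
    then show "pmf \<mu> x * (q i x * h (flip i x)) = pmf \<mu> (flip i x) * q i (flip i x) * h (flip i x)"
      using detailed_balance[OF _ assms, of x] by (simp add: mult.assoc[symmetric])
  qed simp
  also have "\<dots> = mean (\<lambda>x. q i x * h x)"
    unfolding mean_def using sum_cube_flip[OF assms, of "\<lambda>x. pmf \<mu> x * q i x * h x"]
    by (simp add: mult_ac)
  finally show ?thesis .
qed

text \<open>
  Integration by parts; it expresses the reversibility of the generator.
\<close>

lemma mean_generator: "mean (\<lambda>x. g x * L h x) = - dirichlet g h"
proof -
  have "mean (\<lambda>x. q i x * (g x * (h (flip i x) - h x))) =
      - 1/2 * mean (\<lambda>x. q i x * ((g (flip i x) - g x) * (h (flip i x) - h x)))" if i: "i \<in> {1..n}" for i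
  proof -
    have "mean (\<lambda>x. q i x * (g x * (h (flip i x) - h x))) =
        mean (\<lambda>x. q i x * (g (flip i x) * (h x - h (flip i x))))"
      using mean_flip_symmetric[OF i, of "\<lambda>x. g x * (h (flip i x) - h x)"] by simp
    then have "2 * mean (\<lambda>x. q i x * (g x * (h (flip i x) - h x))) =
        mean (\<lambda>x. q i x * (g x * (h (flip i x) - h x))) + mean (\<lambda>x. q i x * (g (flip i x) * (h x - h (flip i x))))"
      by simp
    also have "\<dots> = mean (\<lambda>x. - 1 * (q i x * ((g (flip i x) - g x) * (h (flip i x) - h x))))"
      unfolding mean_add[symmetric] by (rule mean_cong) (simp add: algebra_simps)
    finally show ?thesis unfolding mean_cmult by simp
  qed
  then show ?thesis
    unfolding generator_def dirichlet_def
    by (simp add: sum_distrib_left mean_sum mult_ac sum_negf)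
qed

lemma mean_generator_0: "mean (L h) = 0"
  using mean_generator[of "\<lambda>_. 1" h] by (simp add: dirichlet_def mean_def)

lemma mean_semigroup: "mean (P t f) = mean f"
proof -
  have "((\<lambda>t. mean (P t f)) has_real_derivative mean (P t (L f))) (at t)" for t
    by (rule mean_has_derivative) (rule semigroup_has_derivative)
  moreover have "mean (P t (L f)) = 0" for t
    using mean_cong[of "L (P t f)" "P t (L f)"] mean_generator_0[of "P t f"]
    by (simp add: semigroup_generator_commute)
  ultimately have "mean (P t f) = mean (P 0 f)"
    using DERIV_isconst_all[of "\<lambda>t. mean (P t f)" t 0] by simp
  then show ?thesis by simp
qed

lemma negative_part_square_has_derivative:
  "((\<lambda>u::real. (max 0 (- u))\<^sup>2) has_real_derivative - 2 * max 0 (- u)) (at u)"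
proof -
  consider "u < 0" | "u = 0" | "0 < u" by linarith
  then show ?thesis
  proof cases
    case 1
    have "((\<lambda>u::real. u\<^sup>2) has_real_derivative - 2 * max 0 (- u)) (at u)"
      using 1 by (auto intro!: derivative_eq_intros)
    then show ?thesis
      by (rule has_field_derivative_transform_within_open[of _ _ _ "{..<0}"]) (use 1 in auto)
  next
    case 2
    have "((\<lambda>h::real. ((max 0 (- h))\<^sup>2) / h) \<longlongrightarrow> 0) (at 0)"
    proof (rule tendsto_0_le[of _ _ _ 1])
      show "((\<lambda>h::real. h) \<longlongrightarrow> 0) (at 0)" by (rule tendsto_ident_at)
      have "norm ((max 0 (- h))\<^sup>2 / h) \<le> norm h * 1" for h :: real
        by (auto simp: max_def power2_eq_square abs_mult)
      then show "\<forall>\<^sub>F h in at 0. norm ((max 0 (- h))\<^sup>2 / h) \<le> norm (h::real) * 1" by simp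
    qed
    then show ?thesis using 2 by (simp add: DERIV_def)
  next
    case 3
    have "((\<lambda>u::real. 0) has_real_derivative - 2 * max 0 (- u)) (at u)"
      using 3 by (auto intro!: derivative_eq_intros)
    then show ?thesis
      by (rule has_field_derivative_transform_within_open[of _ _ _ "{0<..}"]) (use 3 in auto)
  qed
qed

text \<open>
  The energy of the negative part of \<open>P t f\<close> does not increase, because \<open>u \<mapsto> max 0 (- u)\<close> is
  decreasing and the Dirichlet form is a sum over edges with positive weights. It starts at \<open>0\<close>.
\<close>

lemma semigroup_nonneg:
  assumes f: "\<And>x. x \<in> cube n \<Longrightarrow> 0 \<le> f x" and t: "0 \<le> t" and x: "x \<in> cube n"
  shows "0 \<le> P t f x"
proof -
  define neg :: "real \<Rightarrow> real" where "neg u = max 0 (- u)" for u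
  define W where "W t = mean (\<lambda>x. (neg (P t f x))\<^sup>2)" for t
  have "(W has_real_derivative mean (\<lambda>x. - 2 * neg (P t f x) * P t (L f) x)) (at t)" for t
    unfolding W_def neg_def
    by (rule mean_has_derivative)
       (rule DERIV_chain2[OF negative_part_square_has_derivative semigroup_has_derivative])
  moreover have "mean (\<lambda>x. - 2 * neg (P t f x) * P t (L f) x) \<le> 0" for t
  proof -
    have "mean (\<lambda>x. - 2 * neg (P t f x) * P t (L f) x) =
        mean (\<lambda>x. - 2 * (neg (P t f x) * L (P t f) x))"
      by (rule mean_cong) (simp add: semigroup_generator_commute)
    also have "\<dots> = 2 * dirichlet (\<lambda>x. neg (P t f x)) (P t f)"
      unfolding mean_cmult by (simp add: mean_generator)
    also have "\<dots> \<le> 0"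
    proof -
      have "mean (\<lambda>x. \<Sum>i\<in>{1..n}. q i x * ((neg (P t f (flip i x)) - neg (P t f x)) * (P t f (flip i x) - P t f x)))
          \<le> mean (\<lambda>_. 0)"
      proof (rule mean_mono, rule sum_nonpos)
        fix y i assume "y \<in> cube n" "i \<in> {1..n}"
        then have "0 \<le> q i y"
          using rate_bounds(3)[of y i] by simp
        moreover have "(neg u - neg v) * (u - v) \<le> 0" for u v
          by (auto simp: neg_def max_def mult_le_0_iff)
        ultimately show "q i y * ((neg (P t f (flip i y)) - neg (P t f y)) * (P t f (flip i y) - P t f y)) \<le> 0"
          by (rule mult_nonneg_nonpos)
      qed
      then show ?thesis by (simp add: dirichlet_def)
    qed
    finally show ?thesis .
  qed
  ultimately have "W t \<le> W 0"
    using t by (intro DERIV_nonpos_imp_nonincreasing[of 0 t W]) blast+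
  moreover have "W 0 = 0"
    unfolding W_def using f by (subst mean_eq_0_iff) (auto simp: neg_def)
  moreover have "0 \<le> W t"
    unfolding W_def by (intro mean_nonneg) auto
  ultimately have "W t = 0" by simp
  then have "neg (P t f x) = 0"
    unfolding W_def using x by (subst (asm) mean_eq_0_iff) auto
  then show ?thesis by (simp add: neg_def max_def split: if_splits)
qed

lemma semigroup_mono:
  assumes "\<And>x. x \<in> cube n \<Longrightarrow> f x \<le> g x" "0 \<le> t" "x \<in> cube n"
  shows "P t f x \<le> P t g x"
  using semigroup_nonneg[of "\<lambda>x. g x - f x" t x] assms by (simp add: semigroup_diff)

lemma semigroup_const [simp]:
  assumes "x \<in> cube n"
  shows "P t (\<lambda>_. c) x = c"
proof -
  have "L (\<lambda>_. c) = (\<lambda>_. 0)"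
    by (auto simp: generator_def)
  moreover have "P t (\<lambda>_. 0) x = 0" for t
    using semigroup_cmult[OF assms, of t 0 "\<lambda>_. 0"] by simp
  ultimately have "((\<lambda>t. P t (\<lambda>_. c) x) has_real_derivative 0) (at t)" for t
    using semigroup_has_derivative[OF assms, of "\<lambda>_. c" t] by simp
  then have "P t (\<lambda>_. c) x = P 0 (\<lambda>_. c) x"
    using DERIV_isconst_all[of "\<lambda>t. P t (\<lambda>_. c) x" t 0] by blast
  then show ?thesis by simp
qed

end

section \<open>The commutator of derivatives and generator\<close>

lemma sqrt_has_derivative:
  assumes "(u has_real_derivative d) (at s)" "0 < u s"
  shows "((\<lambda>s. sqrt (u s)) has_real_derivative d / (2 * sqrt (u s))) (at s)"
proof (rule DERIV_cong[OF DERIV_chain2[OF DERIV_real_sqrt[OF assms(2)] assms(1)]])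
  show "inverse (sqrt (u s)) / 2 * d = d / (2 * sqrt (u s))"
    by (simp add: inverse_eq_divide)
qed

context spin_system
begin

text \<open>
  How much flipping coordinate \<open>i\<close> changes the rate of coordinate \<open>j\<close>, weighted so that the
  quantity is symmetric. It vanishes for product measures.
\<close>

definition coupling :: "nat \<Rightarrow> nat \<Rightarrow> config \<Rightarrow> real" where
  "coupling i j x = q i x * (q j (flip i x) - q j x)"

lemma coupling_commute:
  assumes "x \<in> cube n" "i \<in> {1..n}" "j \<in> {1..n}"
  shows "coupling i j x = coupling j i x"
  using rate_square[OF assms] by (simp add: coupling_def algebra_simps)

lemma delta_flip:
  assumes "x \<in> cube n" "j \<in> {1..n}"
  shows "q j x * delta \<mu> j g (flip j x) = - (q j (flip j x) * delta \<mu> j g x)"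
  by (simp add: delta_def algebra_simps)

text \<open>
  The commutator of the discrete derivative with the generator contains no second differences: the
  value of \<open>g\<close> at the doubly flipped configuration cancels because the canonical rates satisfy
  \<open>rate_square\<close>. The diagonal term \<open>i = j\<close> commutes exactly.
\<close>

lemma delta_generator:
  assumes x: "x \<in> cube n" and j: "j \<in> {1..n}"
  shows "delta \<mu> j (L g) x = L (delta \<mu> j g) x
    - (\<Sum>i\<in>{1..n} - {j}. coupling i j x * (g (flip j x) - g (flip i x)))"
proof -
  let ?a = "\<lambda>i. q j x * (q i (flip j x) * (g (flip i (flip j x)) - g (flip j x))
    - q i x * (g (flip i x) - g x))"
  let ?c = "\<lambda>i. q i x * (delta \<mu> j g (flip i x) - delta \<mu> j g x)"
  have eq_j: "?a j = ?c j"
    by (simp add: delta_def algebra_simps)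
  have eq: "?a i = ?c i - coupling i j x * (g (flip j x) - g (flip i x))" if i: "i \<in> {1..n}" for i
  proof -
    have "?c i - coupling i j x * (g (flip j x) - g (flip i x)) - ?a i =
      (q i x * q j (flip i x) - q j x * q i (flip j x)) * (g (flip i (flip j x)) - g (flip j x))"
      by (simp add: coupling_def delta_def flip_commute[of j i] algebra_simps)
    then show ?thesis using rate_square[OF x i j] by simp
  qed
  have "delta \<mu> j (L g) x = (\<Sum>i\<in>{1..n}. ?a i)"
    unfolding delta_def generator_def by (simp add: sum_subtractf sum_distrib_left right_diff_distrib)
  also have "\<dots> = ?a j + (\<Sum>i\<in>{1..n} - {j}. ?a i)"
    using j by (intro sum.remove) auto
  also have "(\<Sum>i\<in>{1..n} - {j}. ?a i) =
      (\<Sum>i\<in>{1..n} - {j}. ?c i - coupling i j x * (g (flip j x) - g (flip i x)))"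
    using eq by (intro sum.cong) auto
  also have "?a j + \<dots> = (?c j + (\<Sum>i\<in>{1..n} - {j}. ?c i))
      - (\<Sum>i\<in>{1..n} - {j}. coupling i j x * (g (flip j x) - g (flip i x)))"
    unfolding sum_subtractf eq_j by simp
  also have "?c j + (\<Sum>i\<in>{1..n} - {j}. ?c i) = L (delta \<mu> j g) x"
    unfolding generator_def using j by (intro sum.remove[symmetric]) auto
  finally show ?thesis .
qed

lemma delta_has_derivative:
  assumes x: "x \<in> cube n" and i: "i \<in> {1..n}"
    and u: "\<And>y. y \<in> cube n \<Longrightarrow> ((\<lambda>t. u t y) has_real_derivative u' y) (at t)"
  shows "((\<lambda>t. delta \<mu> i (u t) x) has_real_derivative delta \<mu> i u' x) (at t)"
  unfolding delta_def using u[OF x] u[OF flip_in_cube[OF x i]] by (auto intro!: derivative_eq_intros)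

lemma backward_semigroup_has_derivative:
  assumes "x \<in> cube n"
  shows "((\<lambda>s. P (t - s) f x) has_real_derivative - L (P (t - s) f) x) (at s)"
proof -
  have "((\<lambda>s. P (t - s) f x) has_real_derivative P (t - s) (L f) x * (- 1)) (at s)"
    by (rule DERIV_chain2[OF semigroup_has_derivative[OF assms]]) (auto intro!: derivative_eq_intros)
  then show ?thesis by (simp add: semigroup_generator_commute[OF assms])
qed

lemma delta_minus: "delta \<mu> i (\<lambda>y. - h y) x = - delta \<mu> i h x"
  by (simp add: delta_def algebra_simps)

lemma Gamma_star_nonneg: "0 \<le> Gamma_star n \<mu> f x"
  unfolding Gamma_star_def by (intro sum_nonneg) auto

end

text \<open>
  A dimension-free lower curvature bound: a constant symmetric matrix dominates the couplings relative
  to the rates, and its column sums are at most \<open>\<kappa>\<close>.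
\<close>

locale curved_spin_system = spin_system +
  fixes \<kappa> :: real and \<rho> :: "nat \<Rightarrow> nat \<Rightarrow> real"
  assumes curv_nonneg: "\<And>i j. 0 \<le> \<rho> i j"
    and curv_sym: "\<And>i j. \<rho> i j = \<rho> j i"
    and curv_sum: "\<And>j. j \<in> {1..n} \<Longrightarrow> (\<Sum>i\<in>{1..n}. \<rho> i j) \<le> \<kappa>"
    and coupling_le: "\<And>x i j. x \<in> cube n \<Longrightarrow> i \<in> {1..n} \<Longrightarrow> j \<in> {1..n} \<Longrightarrow> i \<noteq> j \<Longrightarrow>
      \<bar>coupling i j x\<bar> \<le> \<rho> i j * q j x"
begin

lemma curv_bound_nonneg: "0 \<le> \<kappa>"
proof -
  have "0 \<le> (\<Sum>i\<in>{1..n}. \<rho> i 1)"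
    by (intro sum_nonneg curv_nonneg)
  also have "\<dots> \<le> \<kappa>"
    using dim by (intro curv_sum) simp
  finally show ?thesis .
qed

lemma curv_quadratic_form:
  "(\<Sum>j\<in>{1..n}. \<Sum>i\<in>{1..n}. \<rho> i j * (v j * (v j + v i))) \<le> 2 * \<kappa> * (\<Sum>j\<in>{1..n}. (v j)\<^sup>2)"
proof -
  have "(\<Sum>j\<in>{1..n}. \<Sum>i\<in>{1..n}. \<rho> i j * (v j * (v j + v i))) \<le>
      (\<Sum>j\<in>{1..n}. \<Sum>i\<in>{1..n}. 3 / 2 * (\<rho> i j * (v j)\<^sup>2) + 1 / 2 * (\<rho> i j * (v i)\<^sup>2))"
  proof (intro sum_mono)
    fix i j
    have "v j * (v j + v i) \<le> 3 / 2 * (v j)\<^sup>2 + 1 / 2 * (v i)\<^sup>2"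
      using sum_squares_ge_zero[of "v j - v i" 0] by (simp add: power2_eq_square algebra_simps)
    then show "\<rho> i j * (v j * (v j + v i)) \<le> 3 / 2 * (\<rho> i j * (v j)\<^sup>2) + 1 / 2 * (\<rho> i j * (v i)\<^sup>2)"
      using mult_left_mono[OF _ curv_nonneg[of i j]] by (fastforce simp: algebra_simps)
  qed
  also have "\<dots> = 3 / 2 * (\<Sum>j\<in>{1..n}. \<Sum>i\<in>{1..n}. \<rho> i j * (v j)\<^sup>2)
      + 1 / 2 * (\<Sum>j\<in>{1..n}. \<Sum>i\<in>{1..n}. \<rho> i j * (v i)\<^sup>2)"
    by (simp only: sum.distrib sum_distrib_left)
  also have "(\<Sum>j\<in>{1..n}. \<Sum>i\<in>{1..n}. \<rho> i j * (v i)\<^sup>2) = (\<Sum>j\<in>{1..n}. \<Sum>i\<in>{1..n}. \<rho> i j * (v j)\<^sup>2)"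
    by (subst sum.swap, intro sum.cong refl, subst curv_sym, rule refl)
  also have "3 / 2 * (\<Sum>j\<in>{1..n}. \<Sum>i\<in>{1..n}. \<rho> i j * (v j)\<^sup>2) + 1 / 2 * (\<Sum>j\<in>{1..n}. \<Sum>i\<in>{1..n}. \<rho> i j * (v j)\<^sup>2)
      = 2 * (\<Sum>j\<in>{1..n}. (\<Sum>i\<in>{1..n}. \<rho> i j) * (v j)\<^sup>2)"
    by (simp add: sum_distrib_right)
  also have "\<dots> \<le> 2 * (\<Sum>j\<in>{1..n}. \<kappa> * (v j)\<^sup>2)"
    by (intro mult_left_mono sum_mono mult_right_mono curv_sum) auto
  finally show ?thesis by (simp add: sum_distrib_left mult_ac)
qed

text \<open>
  Each difference in the commutator is split through \<open>g x\<close> and re-expressed by derivatives. This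
  uses the coupling bound relative to both rates, which is where the symmetry of the coupling enters.
\<close>

lemma commutator_bound:
  assumes x: "x \<in> cube n" and j: "j \<in> {1..n}"
  shows "\<bar>L (delta \<mu> j g) x - delta \<mu> j (L g) x\<bar> \<le>
    (\<Sum>i\<in>{1..n}. \<rho> i j * (\<bar>delta \<mu> j g x\<bar> + \<bar>delta \<mu> i g x\<bar>))"
proof -
  have "\<bar>L (delta \<mu> j g) x - delta \<mu> j (L g) x\<bar> =
      \<bar>\<Sum>i\<in>{1..n} - {j}. coupling i j x * (g (flip j x) - g (flip i x))\<bar>"
    by (simp add: delta_generator[OF x j])
  also have "\<dots> \<le> (\<Sum>i\<in>{1..n} - {j}. \<bar>coupling i j x * (g (flip j x) - g (flip i x))\<bar>)"
    by (rule sum_abs)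
  also have "\<dots> \<le> (\<Sum>i\<in>{1..n} - {j}. \<rho> i j * (\<bar>delta \<mu> j g x\<bar> + \<bar>delta \<mu> i g x\<bar>))"
  proof (rule sum_mono)
    fix i assume "i \<in> {1..n} - {j}"
    then have i: "i \<in> {1..n}" "i \<noteq> j" by auto
    have c: "\<bar>coupling i j x\<bar> \<le> \<rho> i j * q j x" "\<bar>coupling i j x\<bar> \<le> \<rho> i j * q i x"
      using coupling_le[OF x i(1) j i(2)] coupling_le[OF x j i(1)] i(2)
      by (auto simp: coupling_commute[OF x j i(1)] curv_sym[of j i])
    have "\<bar>coupling i j x * (g (flip j x) - g (flip i x))\<bar> \<le>
        \<bar>coupling i j x\<bar> * (\<bar>g (flip j x) - g x\<bar> + \<bar>g (flip i x) - g x\<bar>)"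
      unfolding abs_mult by (rule mult_left_mono) auto
    also have "\<dots> \<le> \<rho> i j * q j x * \<bar>g (flip j x) - g x\<bar> + \<rho> i j * q i x * \<bar>g (flip i x) - g x\<bar>"
      unfolding distrib_left by (intro add_mono mult_right_mono c) auto
    also have "\<dots> = \<rho> i j * (\<bar>delta \<mu> j g x\<bar> + \<bar>delta \<mu> i g x\<bar>)"
      using rate_bounds(3)[OF x j] rate_bounds(3)[OF x i(1)]
      unfolding delta_def abs_mult distrib_left by (simp add: mult_ac)
    finally show "\<bar>coupling i j x * (g (flip j x) - g (flip i x))\<bar> \<le>
        \<rho> i j * (\<bar>delta \<mu> j g x\<bar> + \<bar>delta \<mu> i g x\<bar>)" .
  qed
  also have "\<dots> \<le> (\<Sum>i\<in>{1..n}. \<rho> i j * (\<bar>delta \<mu> j g x\<bar> + \<bar>delta \<mu> i g x\<bar>))"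
    by (intro sum_mono2) (auto intro!: mult_nonneg_nonneg curv_nonneg)
  finally show ?thesis .
qed

section \<open>The local Bobkov inequality\<close>

lemma sqrt_Cauchy_Schwarz:
  fixes u v :: "nat \<Rightarrow> real"
  assumes "0 \<le> c"
  shows "\<bar>a\<bar> * \<bar>d\<bar> + c * (\<Sum>j\<in>A. \<bar>u j\<bar> * \<bar>v j\<bar>) \<le>
    sqrt (a\<^sup>2 + c * (\<Sum>j\<in>A. (u j)\<^sup>2)) * sqrt (d\<^sup>2 + c * (\<Sum>j\<in>A. (v j)\<^sup>2))"
proof -
  have "(sqrt c * L2_set u A) * (sqrt c * L2_set v A) = (sqrt c * sqrt c) * (L2_set u A * L2_set v A)"
    by (simp only: mult_ac)
  also have "sqrt c * sqrt c = c" using assms by simp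
  finally have eq: "(sqrt c * L2_set u A) * (sqrt c * L2_set v A) = c * (L2_set u A * L2_set v A)" .
  have "\<bar>a\<bar> * \<bar>d\<bar> + c * (\<Sum>j\<in>A. \<bar>u j\<bar> * \<bar>v j\<bar>) \<le> \<bar>a\<bar> * \<bar>d\<bar> + (sqrt c * L2_set u A) * (sqrt c * L2_set v A)"
    unfolding eq using mult_left_mono[OF L2_set_mult_ineq[of u v A] assms] by simp
  also have "\<dots> \<le> sqrt (a\<^sup>2 + (sqrt c * L2_set u A)\<^sup>2) * sqrt (d\<^sup>2 + (sqrt c * L2_set v A)\<^sup>2)"
  proof -
    have "(\<bar>a\<bar> * \<bar>d\<bar> + x * y)\<^sup>2 \<le> (a\<^sup>2 + x\<^sup>2) * (d\<^sup>2 + y\<^sup>2)" for x y :: real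
      using zero_le_power2[of "\<bar>a\<bar> * y - \<bar>d\<bar> * x"]
      by (simp add: power2_eq_square algebra_simps)
    then show ?thesis
      unfolding real_sqrt_mult[symmetric] by (rule real_le_rsqrt)
  qed
  finally show ?thesis
    using assms by (simp add: power_mult_distrib L2_set_def sum_nonneg)
qed

text \<open>
  Up to the factor \<open>F x\<close>, the expression is \<open>L F + d/ds F\<close> for the interpolation from \<open>I (P t f)\<close> to
  \<open>P t (sqrt (I\<^sup>2 + \<gamma> \<Gamma>))\<close>. By Cauchy-Schwarz the product \<open>F x * F (flip i x)\<close> dominates the inner
  product of the vectors whose norms are \<open>F x\<close> and \<open>F (flip i x)\<close>; the sign of the \<open>i\<close>-th entry may be
  changed freely, and it is, because the \<open>i\<close>-th derivative changes sign under the flip. What remains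
  separates into the tangent inequality for the profile, paid by \<open>2 / b\<close> times \<open>\<Gamma>\<close>, and the
  commutator, paid by \<open>2 \<kappa> c\<close> times \<open>\<Gamma>\<close>.
\<close>

lemma local_Bobkov_differential_inequality:
  assumes g: "\<And>y. y \<in> cube n \<Longrightarrow> 0 < g y \<and> g y < 1" and c: "0 \<le> c" and x: "x \<in> cube n"
  defines "F \<equiv> \<lambda>y. sqrt ((gauss_profile (g y))\<^sup>2 + c * Gamma_star n \<mu> g y)"
  shows "0 \<le> F x * L F x + gauss_profile (g x) * gauss_quantile (g x) * L g x
    + (2 / b + 2 * \<kappa> * c) * Gamma_star n \<mu> g x
    - c * (\<Sum>j\<in>{1..n}. delta \<mu> j g x * delta \<mu> j (L g) x)"
proof -
  let ?I = "gauss_profile" and ?d = "\<lambda>j. delta \<mu> j g"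
  have F_sq: "F x * F x = (?I (g x))\<^sup>2 + c * (\<Sum>j\<in>{1..n}. (?d j x)\<^sup>2)"
    using c unfolding F_def Gamma_star_def[symmetric] by (simp add: Gamma_star_nonneg)
  \<comment> \<open>Cauchy-Schwarz with the sign of the \<open>i\<close>-th derivative reversed.\<close>
  have pair: "(?I (g x)) * (?I (g (flip i x))) + c * (\<Sum>j\<in>{1..n}. ?d j x * ?d j (flip i x))
      - 2 * c * (?d i x * ?d i (flip i x)) \<le> F x * F (flip i x)" if i: "i \<in> {1..n}" for i
  proof -
    have "(\<Sum>j\<in>{1..n}. ?d j x * ?d j (flip i x)) =
        ?d i x * ?d i (flip i x) + (\<Sum>j\<in>{1..n} - {i}. ?d j x * ?d j (flip i x))"
      using i by (intro sum.remove) auto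
    then have "(\<Sum>j\<in>{1..n}. ?d j x * ?d j (flip i x)) - 2 * (?d i x * ?d i (flip i x)) =
        - (?d i x * ?d i (flip i x)) + (\<Sum>j\<in>{1..n} - {i}. ?d j x * ?d j (flip i x))"
      by simp
    also have "\<dots> \<le> \<bar>?d i x\<bar> * \<bar>?d i (flip i x)\<bar> + (\<Sum>j\<in>{1..n} - {i}. \<bar>?d j x\<bar> * \<bar>?d j (flip i x)\<bar>)"
      unfolding abs_mult[symmetric] by (intro add_mono sum_mono abs_ge_self abs_ge_minus_self)
    also have "\<dots> = (\<Sum>j\<in>{1..n}. \<bar>?d j x\<bar> * \<bar>?d j (flip i x)\<bar>)"
      using i by (intro sum.remove[symmetric]) auto
    finally have "c * ((\<Sum>j\<in>{1..n}. ?d j x * ?d j (flip i x)) - 2 * (?d i x * ?d i (flip i x))) \<le>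
        c * (\<Sum>j\<in>{1..n}. \<bar>?d j x\<bar> * \<bar>?d j (flip i x)\<bar>)"
      using c by (rule mult_left_mono)
    then show ?thesis
      using sqrt_Cauchy_Schwarz[OF c, of "?I (g x)" "?I (g (flip i x))" "\<lambda>j. ?d j x" "\<lambda>j. ?d j (flip i x)" "{1..n}"]
      unfolding F_def Gamma_star_def by (simp add: gauss_profile_nonneg right_diff_distrib)
  qed
  have "F x * L F x = (\<Sum>i\<in>{1..n}. q i x * (F x * F (flip i x) - F x * F x))"
    unfolding generator_def sum_distrib_left by (intro sum.cong) (auto simp: algebra_simps)
  also have "\<dots> \<ge> (\<Sum>i\<in>{1..n}. q i x * ((?I (g x)) * (?I (g (flip i x))) + c * (\<Sum>j\<in>{1..n}. ?d j x * ?d j (flip i x))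
      - 2 * c * (?d i x * ?d i (flip i x)) - ((?I (g x))\<^sup>2 + c * (\<Sum>j\<in>{1..n}. (?d j x)\<^sup>2))))"
    unfolding F_sq using pair rate_bounds(3)[OF x]
    by (intro sum_mono mult_left_mono diff_right_mono) (auto intro: less_imp_le)
  finally have 1: "(\<Sum>i\<in>{1..n}. q i x * ((?I (g x)) * (?I (g (flip i x))) + c * (\<Sum>j\<in>{1..n}. ?d j x * ?d j (flip i x))
      - 2 * c * (?d i x * ?d i (flip i x)) - ((?I (g x))\<^sup>2 + c * (\<Sum>j\<in>{1..n}. (?d j x)\<^sup>2)))) \<le> F x * L F x" .
  have split: "q i x * ((?I (g x)) * (?I (g (flip i x))) + c * (\<Sum>j\<in>{1..n}. ?d j x * ?d j (flip i x))
      - 2 * c * (?d i x * ?d i (flip i x)) - ((?I (g x))\<^sup>2 + c * (\<Sum>j\<in>{1..n}. (?d j x)\<^sup>2))) =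
      q i x * (?I (g x) * (?I (g (flip i x)) - ?I (g x))) +
      c * (\<Sum>j\<in>{1..n}. ?d j x * (q i x * (?d j (flip i x) - ?d j x))) + 2 * c * (q i (flip i x) * (?d i x)\<^sup>2)"
    if i: "i \<in> {1..n}" for i
  proof -
    have "(\<Sum>j\<in>{1..n}. ?d j x * (q i x * (?d j (flip i x) - ?d j x))) =
        q i x * ((\<Sum>j\<in>{1..n}. ?d j x * ?d j (flip i x)) - (\<Sum>j\<in>{1..n}. (?d j x)\<^sup>2))"
      unfolding sum_subtractf[symmetric] sum_distrib_left
      by (intro sum.cong) (auto simp: power2_eq_square algebra_simps)
    moreover have "q i x * (?d i x * ?d i (flip i x)) = - (q i (flip i x) * (?d i x)\<^sup>2)"
      unfolding mult.left_commute[of "q i x"] delta_flip[OF x i, of g] by (simp add: power2_eq_square)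
    moreover have "k * (a * a' + c * S - 2 * c * X - (a\<^sup>2 + c * S')) = k * (a * (a' - a)) + c * T + 2 * c * W"
      if "T = k * (S - S')" "k * X = - W" for k a a' S S' T X W :: real
    proof -
      have "k * (a * a' + c * S - 2 * c * X - (a\<^sup>2 + c * S')) = k * (a * (a' - a)) + c * (k * (S - S')) - 2 * c * (k * X)"
        by (simp add: power2_eq_square algebra_simps)
      then show ?thesis using that by simp
    qed
    ultimately show ?thesis by blast
  qed
  have 2: "(\<Sum>i\<in>{1..n}. q i x * (?I (g x) * (?I (g (flip i x)) - ?I (g x))))
      + c * (\<Sum>j\<in>{1..n}. ?d j x * L (?d j) x) \<le> F x * L F x"
  proof -
    have "(\<Sum>i\<in>{1..n}. \<Sum>j\<in>{1..n}. ?d j x * (q i x * (?d j (flip i x) - ?d j x))) =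
        (\<Sum>j\<in>{1..n}. ?d j x * L (?d j) x)"
      by (subst sum.swap) (simp add: generator_def sum_distrib_left)
    moreover have "0 \<le> (\<Sum>i\<in>{1..n}. 2 * c * (q i (flip i x) * (?d i x)\<^sup>2))"
    proof (rule sum_nonneg)
      fix i assume i: "i \<in> {1..n}"
      then have "0 < q i (flip i x)" using rate_bounds(3) x by simp
      then show "0 \<le> 2 * c * (q i (flip i x) * (?d i x)\<^sup>2)" using c by simp
    qed
    moreover have "(\<Sum>i\<in>{1..n}. q i x * (?I (g x) * (?I (g (flip i x)) - ?I (g x))) +
      c * (\<Sum>j\<in>{1..n}. ?d j x * (q i x * (?d j (flip i x) - ?d j x))) + 2 * c * (q i (flip i x) * (?d i x)\<^sup>2)) \<le> F x * L F x"
      by (rule ord_eq_le_trans[OF sum.cong[OF refl split[symmetric]] 1])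
    ultimately show ?thesis by (simp only: sum.distrib sum_distrib_left[symmetric])
  qed
  \<comment> \<open>The tangent inequality; \<open>rate \<ge> b / 2\<close> turns one factor of the rate into \<open>2 / b\<close> times its square.\<close>
  have 3: "- (2 / b) * Gamma_star n \<mu> g x \<le>
      (\<Sum>i\<in>{1..n}. q i x * (?I (g x) * (?I (g (flip i x)) - ?I (g x)))) + ?I (g x) * gauss_quantile (g x) * L g x"
  proof -
    have "- (2 / b) * Gamma_star n \<mu> g x = (\<Sum>i\<in>{1..n}. - (2 / b) * (?d i x)\<^sup>2)"
      unfolding Gamma_star_def by (rule sum_distrib_left)
    also have "\<dots> \<le> (\<Sum>i\<in>{1..n}. q i x * (?I (g x) * (?I (g (flip i x)) - ?I (g x)
        + gauss_quantile (g x) * (g (flip i x) - g x))))"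
    proof (rule sum_mono)
      fix i assume i: "i \<in> {1..n}"
      let ?e = "g (flip i x) - g x"
      have q: "0 < q i x" "1 \<le> 2 / b * q i x"
        using rate_bounds[OF x i] b by (auto simp: field_simps)
      have "1 * (q i x * ?e\<^sup>2) \<le> (2 / b * q i x) * (q i x * ?e\<^sup>2)"
        using q by (intro mult_right_mono) auto
      then have "- (2 / b) * (?d i x)\<^sup>2 \<le> q i x * (- ?e\<^sup>2)"
        by (simp add: delta_def power2_eq_square mult_ac)
      also have "\<dots> \<le> q i x * (?I (g x) * (?I (g (flip i x)) - ?I (g x) + gauss_quantile (g x) * ?e))"
        using g[OF x] g[OF flip_in_cube[OF x i]] q
        by (intro mult_left_mono gauss_profile_tangent) auto
      finally show "- (2 / b) * (?d i x)\<^sup>2 \<le> q i x * (?I (g x) * (?I (g (flip i x)) - ?I (g x) + gauss_quantile (g x) * ?e))" .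
    qed
    also have "\<dots> = (\<Sum>i\<in>{1..n}. q i x * (?I (g x) * (?I (g (flip i x)) - ?I (g x)))) + ?I (g x) * gauss_quantile (g x) * L g x"
      unfolding generator_def sum_distrib_left sum.distrib[symmetric]
      by (intro sum.cong) (auto simp: algebra_simps)
    finally show ?thesis .
  qed
  have 4: "- (2 * \<kappa>) * Gamma_star n \<mu> g x \<le>
      (\<Sum>j\<in>{1..n}. ?d j x * L (?d j) x) - (\<Sum>j\<in>{1..n}. ?d j x * delta \<mu> j (L g) x)"
  proof -
    have "(\<Sum>j\<in>{1..n}. - (\<Sum>i\<in>{1..n}. \<rho> i j * (\<bar>?d j x\<bar> * (\<bar>?d j x\<bar> + \<bar>?d i x\<bar>)))) \<le>
        (\<Sum>j\<in>{1..n}. ?d j x * (L (?d j) x - delta \<mu> j (L g) x))"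
    proof (rule sum_mono)
      fix j assume j: "j \<in> {1..n}"
      have "- (?d j x * (L (?d j) x - delta \<mu> j (L g) x)) \<le> \<bar>?d j x\<bar> * \<bar>L (?d j) x - delta \<mu> j (L g) x\<bar>"
        by (simp add: abs_mult[symmetric])
      also have "\<dots> \<le> \<bar>?d j x\<bar> * (\<Sum>i\<in>{1..n}. \<rho> i j * (\<bar>?d j x\<bar> + \<bar>?d i x\<bar>))"
        by (intro mult_left_mono commutator_bound x j) auto
      finally show "- (\<Sum>i\<in>{1..n}. \<rho> i j * (\<bar>?d j x\<bar> * (\<bar>?d j x\<bar> + \<bar>?d i x\<bar>))) \<le>
          ?d j x * (L (?d j) x - delta \<mu> j (L g) x)"
        by (simp add: sum_distrib_left mult_ac)
    qed
    then show ?thesis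
      using curv_quadratic_form[of "\<lambda>j. \<bar>?d j x\<bar>"]
      unfolding Gamma_star_def by (simp add: sum_negf right_diff_distrib sum_subtractf)
  qed
  have "c * (- (2 * \<kappa>) * Gamma_star n \<mu> g x) \<le>
      c * ((\<Sum>j\<in>{1..n}. ?d j x * L (?d j) x) - (\<Sum>j\<in>{1..n}. ?d j x * delta \<mu> j (L g) x))"
    using 4 c by (rule mult_left_mono)
  then show ?thesis using 2 3 by (simp add: algebra_simps)
qed

text \<open>
  The differential equation that makes the time derivative of \<open>\<gamma>\<close> pay for both terms of the
  differential inequality when the rate is at most \<open>- 2 \<kappa>\<close>.
\<close>

lemma bobkov_gamma_has_derivative:
  assumes "r < 0"
  shows "(bobkov_gamma b r has_real_derivative 4 / b - 2 * r * bobkov_gamma b r s) (at s)"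
proof -
  have "((\<lambda>s. 2 * (1 - exp (- 2 * r * s)) / (b * r)) has_real_derivative
      4 / b - 2 * r * (2 * (1 - exp (- 2 * r * s)) / (b * r))) (at s)"
    using assms b by (auto intro!: derivative_eq_intros simp: field_simps)
  then show ?thesis using assms by (simp add: bobkov_gamma_def[abs_def])
qed

lemma bobkov_gamma_nonneg:
  assumes "r < 0" "0 \<le> s"
  shows "0 \<le> bobkov_gamma b r s"
proof -
  have "1 - exp (- 2 * r * s) \<le> 0"
    using assms by (simp add: mult_nonpos_nonneg)
  moreover have "b * r \<le> 0" using assms b by (simp add: mult_nonneg_nonpos)
  ultimately show ?thesis using assms by (simp add: bobkov_gamma_def divide_nonpos_nonpos)
qed

lemma semigroup_strict_bounds:
  assumes f: "\<And>y. y \<in> cube n \<Longrightarrow> 0 < f y \<and> f y < 1" and "0 \<le> t" "x \<in> cube n"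
  shows "0 < P t f x \<and> P t f x < 1"
proof -
  let ?a = "Min (f ` cube n)" and ?b = "Max (f ` cube n)"
  have "?a \<in> f ` cube n" "?b \<in> f ` cube n"
    using cube_nonempty by (auto intro!: Min_in Max_in)
  then have "0 < ?a" "?b < 1" using f by auto
  moreover have "P t (\<lambda>_. ?a) x \<le> P t f x" "P t f x \<le> P t (\<lambda>_. ?b) x"
    by (rule semigroup_mono; use assms in auto)+
  ultimately show ?thesis using assms by simp
qed

text \<open>
  Values strictly between \<open>0\<close> and \<open>1\<close> keep the profile positive and smooth, and the square root away
  from \<open>0\<close>.
\<close>

lemma local_Bobkov_interior:
  assumes f: "\<And>y. y \<in> cube n \<Longrightarrow> 0 < f y \<and> f y < 1"
    and r: "r < 0" "r \<le> - 2 * \<kappa>" and t: "0 \<le> t" and x: "x \<in> cube n"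
  shows "gauss_profile (P t f x) \<le>
    P t (\<lambda>y. sqrt ((gauss_profile (f y))\<^sup>2 + bobkov_gamma b r t * Gamma_star n \<mu> f y)) x"
proof -
  let ?I = "gauss_profile" and ?Q = "gauss_quantile" and ?\<gamma> = "bobkov_gamma b r"
  define g where "g s = P (t - s) f" for s
  define F where "F s y = sqrt ((?I (g s y))\<^sup>2 + ?\<gamma> s * Gamma_star n \<mu> (g s) y)" for s y
  define D where "D s y = 2 * (?I (g s y) * ?Q (g s y) * L (g s) y)
      + (4 / b - 2 * r * ?\<gamma> s) * Gamma_star n \<mu> (g s) y
      - 2 * ?\<gamma> s * (\<Sum>j\<in>{1..n}. delta \<mu> j (g s) y * delta \<mu> j (L (g s)) y)" for s y
  define F' where "F' s y = D s y / (2 * F s y)" for s y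
  have g: "0 < g s y \<and> g s y < 1" if "y \<in> cube n" "s \<le> t" for s y
    unfolding g_def using f that by (intro semigroup_strict_bounds) auto
  have F_pos: "0 < F s y" if "y \<in> cube n" "0 \<le> s" "s \<le> t" for s y
    unfolding F_def using that g[OF that(1,3)] bobkov_gamma_nonneg[OF r(1) that(2)]
    by (auto intro!: add_pos_nonneg mult_nonneg_nonneg Gamma_star_nonneg zero_less_power gauss_profile_pos)
  have F_der: "((\<lambda>s. F s y) has_real_derivative F' s y) (at s)"
    if y: "y \<in> cube n" and s: "0 \<le> s" "s \<le> t" for s y
  proof -
    have g_der: "((\<lambda>s. g s y) has_real_derivative - L (g s) y) (at s)" if "y \<in> cube n" for y
      unfolding g_def by (rule backward_semigroup_has_derivative[OF that])
    have d_der: "((\<lambda>s. delta \<mu> j (g s) y) has_real_derivative - delta \<mu> j (L (g s)) y) (at s)"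
      if "j \<in> {1..n}" for j
      using delta_has_derivative[OF y that g_der] by (simp add: delta_minus)
    have I_der: "((\<lambda>s. ?I (g s y)) has_real_derivative ?Q (g s y) * L (g s) y) (at s)"
      using DERIV_chain2[OF gauss_profile_has_derivative g_der[OF y]] g[OF y s(2)] by simp
    have Gamma_der: "((\<lambda>s. Gamma_star n \<mu> (g s) y) has_real_derivative
        - 2 * (\<Sum>j\<in>{1..n}. delta \<mu> j (g s) y * delta \<mu> j (L (g s)) y)) (at s)"
      unfolding Gamma_star_def sum_distrib_left
      by (rule DERIV_sum) (auto intro!: derivative_eq_intros d_der)
    have "((\<lambda>s. (?I (g s y))\<^sup>2 + ?\<gamma> s * Gamma_star n \<mu> (g s) y) has_real_derivative D s y) (at s)"
      by (auto intro!: derivative_eq_intros I_der Gamma_der bobkov_gamma_has_derivative[OF r(1)]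
          simp: D_def algebra_simps)
    moreover have "0 < (?I (g s y))\<^sup>2 + ?\<gamma> s * Gamma_star n \<mu> (g s) y"
      using F_pos[OF y s] unfolding F_def by simp
    ultimately show ?thesis
      unfolding F'_def F_def[of _ y] by (rule sqrt_has_derivative)
  qed
  have "P 0 (F 0) x \<le> P t (F t) x"
  proof (rule DERIV_nonneg_imp_nondecreasing[OF t])
    fix s assume s: "0 \<le> s" "s \<le> t"
    have "0 \<le> P s (\<lambda>y. L (F s) y + F' s y) x"
    proof (rule semigroup_nonneg[OF _ s(1) x])
      fix y assume y: "y \<in> cube n"
      let ?G = "Gamma_star n \<mu> (g s) y"
      have "0 \<le> ?\<gamma> s" by (rule bobkov_gamma_nonneg[OF r(1) s(1)])
      then have "2 * \<kappa> * ?\<gamma> s \<le> - r * ?\<gamma> s"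
        using r(2) by (intro mult_right_mono) auto
      then have "(2 / b + 2 * \<kappa> * ?\<gamma> s) * ?G \<le> (2 / b - r * ?\<gamma> s) * ?G"
        by (intro mult_right_mono Gamma_star_nonneg) auto
      then have "0 \<le> F s y * L (F s) y + ?I (g s y) * ?Q (g s y) * L (g s) y + (2 / b - r * ?\<gamma> s) * ?G
          - ?\<gamma> s * (\<Sum>j\<in>{1..n}. delta \<mu> j (g s) y * delta \<mu> j (L (g s)) y)"
        using local_Bobkov_differential_inequality[of "g s" "?\<gamma> s" y] g s y \<open>0 \<le> ?\<gamma> s\<close>
        unfolding F_def by force
      also have "\<dots> = F s y * (L (F s) y + F' s y)"
        using F_pos[OF y s] unfolding F'_def D_def by (simp add: field_simps)
      finally show "0 \<le> L (F s) y + F' s y"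
        using F_pos[OF y s] by (simp add: zero_le_mult_iff)
    qed
    then show "\<exists>d. ((\<lambda>s. P s (F s) x) has_real_derivative d) (at s) \<and> 0 \<le> d"
      using interpolation_has_derivative[where F = F and F' = "F' s", OF x F_der[OF _ s]] by blast
  qed
  moreover have "P 0 (F 0) x = ?I (P t f x)"
    using r by (simp add: F_def g_def bobkov_gamma_def gauss_profile_nonneg)
  ultimately show ?thesis by (simp add: F_def[abs_def] g_def)
qed

text \<open>
  The general case follows by replacing \<open>f\<close> with \<open>\<epsilon> + (1 - 2 \<epsilon>) f\<close>, since the profile is continuous up
  to the endpoints.
\<close>

theorem local_Bobkov:
  assumes f: "\<And>y. y \<in> cube n \<Longrightarrow> f y \<in> {0..1}"
    and r: "r < 0" "r \<le> - 2 * \<kappa>" and t: "0 \<le> t" and x: "x \<in> cube n"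
  shows "gauss_profile (P t f x) \<le>
    P t (\<lambda>y. sqrt ((gauss_profile (f y))\<^sup>2 + bobkov_gamma b r t * Gamma_star n \<mu> f y)) x"
proof -
  let ?I = "gauss_profile" and ?\<gamma> = "bobkov_gamma b r t"
  define h where "h \<epsilon> y = \<epsilon> + (1 - 2 * \<epsilon>) * f y" for \<epsilon> y
  have small: "\<forall>\<^sub>F \<epsilon> in at_right 0. 0 < \<epsilon> \<and> \<epsilon> < (1/2::real)"
    by (intro eventually_at_rightI[of 0 "1/2"]) auto
  have inner: "0 < \<epsilon> + (1 - 2 * \<epsilon>) * u \<and> \<epsilon> + (1 - 2 * \<epsilon>) * u < 1"
    if "0 < \<epsilon>" "\<epsilon> < 1/2" "u \<in> {0..1}" for \<epsilon> u :: real
  proof -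
    have "0 \<le> (1 - 2 * \<epsilon>) * u" "(1 - 2 * \<epsilon>) * u \<le> 1 - 2 * \<epsilon>"
      using that by (auto intro: mult_left_le)
    then show ?thesis using that by linarith
  qed
  have P_h: "P t (h \<epsilon>) x = \<epsilon> + (1 - 2 * \<epsilon>) * P t f x" for \<epsilon>
    unfolding h_def using x by (simp add: semigroup_add semigroup_cmult)
  have P_f: "P t f x \<in> {0..1}"
    using semigroup_mono[of "\<lambda>_. 0" f t x] semigroup_mono[of f "\<lambda>_. 1" t x] f t x by simp
  have Gamma_h: "Gamma_star n \<mu> (h \<epsilon>) y = (1 - 2 * \<epsilon>)\<^sup>2 * Gamma_star n \<mu> f y" for \<epsilon> y
    unfolding Gamma_star_def h_def delta_def sum_distrib_left
    by (intro sum.cong) (auto simp: power2_eq_square algebra_simps)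
  have lim: "((\<lambda>\<epsilon>. ?I (\<epsilon> + (1 - 2 * \<epsilon>) * u)) \<longlongrightarrow> ?I u) (at_right 0)" if "u \<in> {0..1}" for u
  proof (rule continuous_on_tendsto_compose[OF gauss_profile_continuous _ that])
    show "((\<lambda>\<epsilon>. \<epsilon> + (1 - 2 * \<epsilon>) * u) \<longlongrightarrow> u) (at_right 0)"
      by (auto intro!: tendsto_eq_intros)
    show "\<forall>\<^sub>F \<epsilon> in at_right 0. \<epsilon> + (1 - 2 * \<epsilon>) * u \<in> {0..1}"
      using small by eventually_elim (use inner[OF _ _ that] in \<open>force intro: less_imp_le\<close>)
  qed
  show ?thesis
  proof (rule tendsto_le)
    show "((\<lambda>\<epsilon>. ?I (P t (h \<epsilon>) x)) \<longlongrightarrow> ?I (P t f x)) (at_right 0)"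
      unfolding P_h by (rule lim[OF P_f])
    show "((\<lambda>\<epsilon>. P t (\<lambda>y. sqrt ((?I (h \<epsilon> y))\<^sup>2 + ?\<gamma> * Gamma_star n \<mu> (h \<epsilon>) y)) x) \<longlongrightarrow>
        P t (\<lambda>y. sqrt ((?I (f y))\<^sup>2 + ?\<gamma> * Gamma_star n \<mu> f y)) x) (at_right 0)"
      unfolding semigroup_kern[OF x] Gamma_h unfolding h_def
      by (intro tendsto_intros lim f) (auto intro!: tendsto_eq_intros)
    show "\<forall>\<^sub>F \<epsilon> in at_right 0. ?I (P t (h \<epsilon>) x) \<le>
        P t (\<lambda>y. sqrt ((?I (h \<epsilon> y))\<^sup>2 + ?\<gamma> * Gamma_star n \<mu> (h \<epsilon>) y)) x"
      using small
    proof eventually_elim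
      case (elim \<epsilon>)
      show ?case
        using inner elim f by (intro local_Bobkov_interior r t x) (simp add: h_def)
    qed
  qed simp
qed

section \<open>Commutation of the discrete gradient with the semigroup\<close>

text \<open>
  The vector of derivatives of the semigroup solves a linear system coupled only through the
  commutator, so the absolute values of its entries are subsolutions of the system with the constant
  coefficients \<open>\<rho>\<close>. Interpolating \<open>P s |\<delta> (P (t - s) f)|\<close> in \<open>s\<close> compares the two ends; the quadratic
  form bound for \<open>\<rho>\<close> controls the growth of the sum of squares. The square root of
  \<open>(\<delta> f)\<^sup>2 + \<epsilon>\<^sup>2\<close> replaces the absolute value, which is not differentiable. A general nonnegative
  weight \<open>\<nu>\<close> is kept: point masses give \<open>L2\<close> bounds, and \<open>\<mu>\<close> gives the \<open>L1\<close> bound.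
\<close>

lemma gradient_commutation_regularized:
  assumes \<nu>: "\<And>x. x \<in> cube n \<Longrightarrow> 0 \<le> \<nu> x" and t: "0 \<le> t" and \<epsilon>: "0 < \<epsilon>"
  shows "(\<Sum>j\<in>{1..n}. (\<Sum>x\<in>cube n. \<nu> x * \<bar>delta \<mu> j (P t f) x\<bar>)\<^sup>2) \<le>
    exp (4 * \<kappa> * t) * (\<Sum>j\<in>{1..n}. (\<Sum>x\<in>cube n. \<nu> x * P t (\<lambda>y. sqrt ((delta \<mu> j f y)\<^sup>2 + \<epsilon>\<^sup>2)) x)\<^sup>2)"
proof -
  define g where "g s = P (t - s) f" for s
  define N where "N j s y = sqrt ((delta \<mu> j (g s) y)\<^sup>2 + \<epsilon>\<^sup>2)" for j s y
  define N' where "N' j s y = - (delta \<mu> j (g s) y * delta \<mu> j (L (g s)) y) / N j s y" for j s y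
  define Y where "Y j s = (\<Sum>x\<in>cube n. \<nu> x * P s (N j s) x)" for j s
  define Y' where "Y' j s = (\<Sum>x\<in>cube n. \<nu> x * P s (\<lambda>y. L (N j s) y + N' j s y) x)" for j s
  have N_pos: "0 < N j s y" for j s y
    unfolding N_def using \<epsilon> by (simp add: add_nonneg_pos)
  have N_sq: "N j s y * N j s y = (delta \<mu> j (g s) y)\<^sup>2 + \<epsilon>\<^sup>2" for j s y
    unfolding N_def by simp
  have N_ge: "\<bar>delta \<mu> j (g s) y\<bar> \<le> N j s y" for j s y
    unfolding N_def by (rule real_le_rsqrt) simp
  have N_der: "((\<lambda>s. N j s y) has_real_derivative N' j s y) (at s)"
    if j: "j \<in> {1..n}" and y: "y \<in> cube n" for j s y
  proof -
    have "((\<lambda>s. delta \<mu> j (g s) y) has_real_derivative - delta \<mu> j (L (g s)) y) (at s)"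
      unfolding delta_minus[symmetric] g_def
      by (rule delta_has_derivative[OF y j]) (rule backward_semigroup_has_derivative)
    then have "((\<lambda>s. (delta \<mu> j (g s) y)\<^sup>2 + \<epsilon>\<^sup>2) has_real_derivative
        - 2 * (delta \<mu> j (g s) y * delta \<mu> j (L (g s)) y)) (at s)"
      by (auto intro!: derivative_eq_intros)
    moreover have "0 < (delta \<mu> j (g s) y)\<^sup>2 + \<epsilon>\<^sup>2"
      using \<epsilon> by (simp add: add_nonneg_pos)
    ultimately have "((\<lambda>s. N j s y) has_real_derivative
        (- 2 * (delta \<mu> j (g s) y * delta \<mu> j (L (g s)) y)) / (2 * N j s y)) (at s)"
      unfolding N_def by (rule sqrt_has_derivative)
    moreover have "(- 2 * (delta \<mu> j (g s) y * delta \<mu> j (L (g s)) y)) / (2 * N j s y) = N' j s y"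
      unfolding N'_def using N_pos[of j s y] by (simp add: field_simps)
    ultimately show ?thesis by (simp only:)
  qed
  have Y_der: "(Y j has_real_derivative Y' j s) (at s)" if j: "j \<in> {1..n}" for j s
    unfolding Y_def Y'_def
    by (rule DERIV_sum) (rule DERIV_cmult, rule interpolation_has_derivative, simp, rule N_der[OF j])
  \<comment> \<open>Convexity of the regularized absolute value and the commutator bound.\<close>
  have drift: "- (\<Sum>i\<in>{1..n}. \<rho> i j * (N j s y + N i s y)) \<le> L (N j s) y + N' j s y"
    if j: "j \<in> {1..n}" and y: "y \<in> cube n" for j s y
  proof -
    let ?d = "delta \<mu> j (g s)" and ?R = "\<Sum>i\<in>{1..n}. \<rho> i j * (N j s y + N i s y)"
    have "?d y * L ?d y = (\<Sum>i\<in>{1..n}. q i y * (?d y * ?d (flip i y) - (?d y)\<^sup>2))"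
      unfolding generator_def sum_distrib_left
      by (intro sum.cong) (auto simp: power2_eq_square algebra_simps)
    also have "\<dots> \<le> (\<Sum>i\<in>{1..n}. q i y * (N j s y * N j s (flip i y) - N j s y * N j s y))"
    proof (intro sum_mono mult_left_mono)
      fix i assume i: "i \<in> {1..n}"
      show "0 \<le> q i y" using rate_bounds(3)[OF y i] by simp
      have "(?d y * ?d (flip i y) + \<epsilon>\<^sup>2)\<^sup>2 \<le> ((?d y)\<^sup>2 + \<epsilon>\<^sup>2) * ((?d (flip i y))\<^sup>2 + \<epsilon>\<^sup>2)"
        using zero_le_power2[of "\<epsilon> * (?d y - ?d (flip i y))"]
        by (simp add: power2_eq_square algebra_simps)
      then have "?d y * ?d (flip i y) + \<epsilon>\<^sup>2 \<le> N j s y * N j s (flip i y)"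
        unfolding N_def real_sqrt_mult[symmetric] by (rule real_le_rsqrt)
      then show "?d y * ?d (flip i y) - (?d y)\<^sup>2 \<le> N j s y * N j s (flip i y) - N j s y * N j s y"
        unfolding N_sq by simp
    qed
    also have "\<dots> = N j s y * L (N j s) y"
      unfolding generator_def sum_distrib_left
      by (intro sum.cong) (auto simp: algebra_simps)
    finally have 1: "?d y * L ?d y \<le> N j s y * L (N j s) y" .
    have "- (?d y * (L ?d y - delta \<mu> j (L (g s)) y)) \<le> \<bar>?d y\<bar> * \<bar>L ?d y - delta \<mu> j (L (g s)) y\<bar>"
      by (simp add: abs_mult[symmetric])
    also have "\<dots> \<le> N j s y * ?R"
    proof (rule mult_mono)
      show "\<bar>L ?d y - delta \<mu> j (L (g s)) y\<bar> \<le> ?R"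
        by (rule order_trans[OF commutator_bound[OF y j]])
           (intro sum_mono mult_left_mono add_mono N_ge curv_nonneg)
    qed (auto intro: N_ge less_imp_le[OF N_pos])
    finally have "N j s y * (- ?R) \<le> N j s y * (L (N j s) y + N' j s y)"
      using 1 N_pos[of j s y] unfolding N'_def by (simp add: algebra_simps)
    then show ?thesis
      using N_pos[of j s y] by (simp only: mult_le_cancel_left_pos)
  qed
  have Y_nonneg: "0 \<le> Y j s" if "0 \<le> s" for j s
    unfolding Y_def
    by (intro sum_nonneg mult_nonneg_nonneg \<nu> semigroup_nonneg that less_imp_le[OF N_pos])
  have Y'_ge: "- (\<Sum>i\<in>{1..n}. \<rho> i j * (Y j s + Y i s)) \<le> Y' j s" if j: "j \<in> {1..n}" and s: "0 \<le> s" for j s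
  proof -
    have "(\<Sum>i\<in>{1..n}. \<rho> i j * (Y j s + Y i s)) =
        (\<Sum>i\<in>{1..n}. \<Sum>x\<in>cube n. \<nu> x * (\<rho> i j * (P s (N j s) x + P s (N i s) x)))"
      unfolding Y_def sum.distrib[symmetric] sum_distrib_left
      by (intro sum.cong refl) (simp add: algebra_simps)
    also have "\<dots> = (\<Sum>x\<in>cube n. \<Sum>i\<in>{1..n}. \<nu> x * (\<rho> i j * (P s (N j s) x + P s (N i s) x)))"
      by (rule sum.swap)
    finally have "- (\<Sum>i\<in>{1..n}. \<rho> i j * (Y j s + Y i s)) =
        (\<Sum>x\<in>cube n. \<nu> x * - (\<Sum>i\<in>{1..n}. \<rho> i j * (P s (N j s) x + P s (N i s) x)))"
      by (simp only: sum_distrib_left[symmetric] mult_minus_right sum_negf)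
    also have "\<dots> = (\<Sum>x\<in>cube n. \<nu> x * P s (\<lambda>y. - (\<Sum>i\<in>{1..n}. \<rho> i j * (N j s y + N i s y))) x)"
    proof (intro sum.cong refl)
      fix x assume x: "x \<in> cube n"
      have "P s (\<lambda>y. - (\<Sum>i\<in>{1..n}. \<rho> i j * (N j s y + N i s y))) x =
          P s (\<lambda>y. (\<Sum>i\<in>{1..n}. - \<rho> i j * (N j s y + N i s y))) x"
        by (simp add: sum_negf)
      also have "\<dots> = - (\<Sum>i\<in>{1..n}. \<rho> i j * (P s (N j s) x + P s (N i s) x))"
        unfolding semigroup_sum[OF x] semigroup_add[OF x] by (simp add: sum_negf)
      finally show "\<nu> x * - (\<Sum>i\<in>{1..n}. \<rho> i j * (P s (N j s) x + P s (N i s) x)) =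
          \<nu> x * P s (\<lambda>y. - (\<Sum>i\<in>{1..n}. \<rho> i j * (N j s y + N i s y))) x" by simp
    qed
    also have "\<dots> \<le> Y' j s"
      unfolding Y'_def by (intro sum_mono mult_left_mono \<nu> semigroup_mono drift j s)
    finally show ?thesis .
  qed
  define G where "G s = exp (4 * \<kappa> * s) * (\<Sum>j\<in>{1..n}. (Y j s)\<^sup>2)" for s
  have "G 0 \<le> G t"
  proof (rule DERIV_nonneg_imp_nondecreasing[OF t])
    fix s assume s: "0 \<le> s" "s \<le> t"
    have "((\<lambda>s. \<Sum>j\<in>{1..n}. (Y j s)\<^sup>2) has_real_derivative (\<Sum>j\<in>{1..n}. 2 * (Y j s * Y' j s))) (at s)"
      by (rule DERIV_sum) (auto intro!: derivative_eq_intros Y_der)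
    then have "(G has_real_derivative exp (4 * \<kappa> * s) *
        (4 * \<kappa> * (\<Sum>j\<in>{1..n}. (Y j s)\<^sup>2) + (\<Sum>j\<in>{1..n}. 2 * (Y j s * Y' j s)))) (at s)"
      unfolding G_def
    proof (rule DERIV_cong[OF DERIV_mult, rotated])
      show "((\<lambda>s. exp (4 * \<kappa> * s)) has_real_derivative exp (4 * \<kappa> * s) * (4 * \<kappa>)) (at s)"
        by (auto intro!: derivative_eq_intros)
    qed (simp add: algebra_simps)
    moreover have "- (4 * \<kappa> * (\<Sum>j\<in>{1..n}. (Y j s)\<^sup>2)) \<le> (\<Sum>j\<in>{1..n}. 2 * (Y j s * Y' j s))"
    proof -
      have "- (4 * \<kappa> * (\<Sum>j\<in>{1..n}. (Y j s)\<^sup>2)) \<le>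
          - 2 * (\<Sum>j\<in>{1..n}. \<Sum>i\<in>{1..n}. \<rho> i j * (Y j s * (Y j s + Y i s)))"
        using curv_quadratic_form[of "\<lambda>j. Y j s"] by simp
      also have "\<dots> = (\<Sum>j\<in>{1..n}. 2 * (Y j s * - (\<Sum>i\<in>{1..n}. \<rho> i j * (Y j s + Y i s))))"
        unfolding sum_distrib_left sum_negf[symmetric] by (intro sum.cong refl) (simp add: algebra_simps)
      also have "\<dots> \<le> (\<Sum>j\<in>{1..n}. 2 * (Y j s * Y' j s))"
        using s by (intro sum_mono mult_left_mono Y'_ge Y_nonneg) auto
      finally show ?thesis .
    qed
    ultimately show "\<exists>d. (G has_real_derivative d) (at s) \<and> 0 \<le> d"
      by (intro exI[of _ "exp (4 * \<kappa> * s) *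
        (4 * \<kappa> * (\<Sum>j\<in>{1..n}. (Y j s)\<^sup>2) + (\<Sum>j\<in>{1..n}. 2 * (Y j s * Y' j s)))"]) auto
  qed
  moreover have "(\<Sum>j\<in>{1..n}. (\<Sum>x\<in>cube n. \<nu> x * \<bar>delta \<mu> j (P t f) x\<bar>)\<^sup>2) \<le> G 0"
  proof -
    have "(\<Sum>x\<in>cube n. \<nu> x * \<bar>delta \<mu> j (P t f) x\<bar>) \<le> Y j 0" for j
      unfolding Y_def using N_ge[of j 0] by (intro sum_mono mult_left_mono \<nu>) (auto simp: g_def)
    then show ?thesis
      unfolding G_def by (simp, intro sum_mono power_mono sum_nonneg mult_nonneg_nonneg \<nu>) auto
  qed
  ultimately show ?thesis
    by (simp add: G_def Y_def N_def[abs_def] g_def)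
qed

theorem gradient_commutation:
  assumes \<nu>: "\<And>x. x \<in> cube n \<Longrightarrow> 0 \<le> \<nu> x" and t: "0 \<le> t"
  shows "(\<Sum>j\<in>{1..n}. (\<Sum>x\<in>cube n. \<nu> x * \<bar>delta \<mu> j (P t f) x\<bar>)\<^sup>2) \<le>
    exp (4 * \<kappa> * t) * (\<Sum>j\<in>{1..n}. (\<Sum>x\<in>cube n. \<nu> x * P t (\<lambda>y. \<bar>delta \<mu> j f y\<bar>) x)\<^sup>2)"
proof (rule tendsto_lowerbound)
  let ?B = "\<lambda>\<epsilon>. exp (4 * \<kappa> * t) * (\<Sum>j\<in>{1..n}. (\<Sum>x\<in>cube n. \<nu> x *
    (\<Sum>y\<in>cube n. sqrt ((delta \<mu> j f y)\<^sup>2 + \<epsilon>\<^sup>2) * kern t x y))\<^sup>2)"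
  have "(?B \<longlongrightarrow> ?B 0) (at_right 0)"
    by (intro tendsto_intros)
  then show "(?B \<longlongrightarrow> exp (4 * \<kappa> * t) * (\<Sum>j\<in>{1..n}. (\<Sum>x\<in>cube n. \<nu> x * P t (\<lambda>y. \<bar>delta \<mu> j f y\<bar>) x)\<^sup>2)) (at_right 0)"
    by (simp add: semigroup_kern)
  show "\<forall>\<^sub>F \<epsilon> in at_right 0. (\<Sum>j\<in>{1..n}. (\<Sum>x\<in>cube n. \<nu> x * \<bar>delta \<mu> j (P t f) x\<bar>)\<^sup>2) \<le> ?B \<epsilon>"
    using eventually_at_right_less
  proof eventually_elim
    case (elim \<epsilon>)
    then show ?case
      using gradient_commutation_regularized[OF \<nu> t elim, where f = f] by (simp add: semigroup_kern)
  qed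
qed simp

end

context spin_system
begin

section \<open>Conditional expectations on fibers\<close>

text \<open>
  The configurations that agree with \<open>x\<close> outside \<open>S\<close>: the measure conditioned on the coordinates
  outside \<open>S\<close> lives there, and the induction for the logarithmic Sobolev inequality runs over \<open>S\<close>.
\<close>

definition fiber :: "nat set \<Rightarrow> config \<Rightarrow> config set" where
  "fiber S x = {y \<in> cube n. \<forall>k\<in>{1..n} - S. y k = x k}"

definition cexp :: "nat set \<Rightarrow> (config \<Rightarrow> real) \<Rightarrow> config \<Rightarrow> real" where
  "cexp S h x = (\<Sum>y\<in>fiber S x. pmf \<mu> y * h y) / (\<Sum>y\<in>fiber S x. pmf \<mu> y)"

text \<open>
  The conditional probability that coordinate \<open>i\<close> is opposite to its value in \<open>x\<close>, given all the
  other coordinates.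
\<close>

definition flip_prob :: "nat \<Rightarrow> config \<Rightarrow> real" where
  "flip_prob i x = pmf \<mu> (flip i x) / (pmf \<mu> x + pmf \<mu> (flip i x))"

lemma cube_values: "x \<in> cube n \<Longrightarrow> i \<in> {1..n} \<Longrightarrow> x i \<in> {-1, 1}"
  unfolding cube_def by (rule PiE_mem)

lemma finite_fiber [simp]: "finite (fiber S x)"
  by (simp add: fiber_def)

lemma fiber_cube: "y \<in> fiber S x \<Longrightarrow> y \<in> cube n"
  by (simp add: fiber_def)

lemma fiber_agree: "y \<in> fiber S x \<Longrightarrow> k \<in> {1..n} \<Longrightarrow> k \<notin> S \<Longrightarrow> y k = x k"
  by (simp add: fiber_def)

lemma fiber_refl: "x \<in> cube n \<Longrightarrow> x \<in> fiber S x"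
  by (simp add: fiber_def)

lemma fiber_sym: "x \<in> cube n \<Longrightarrow> y \<in> fiber S x \<Longrightarrow> x \<in> fiber S y"
  by (auto simp: fiber_def)

lemma fiber_eq: "y \<in> fiber S x \<Longrightarrow> fiber S y = fiber S x"
  by (auto simp: fiber_def)

lemma fiber_mono: "T \<subseteq> S \<Longrightarrow> fiber T x \<subseteq> fiber S x"
  by (auto simp: fiber_def)

lemma flip_in_fiber: "y \<in> fiber S x \<Longrightarrow> i \<in> S \<Longrightarrow> i \<in> {1..n} \<Longrightarrow> flip i y \<in> fiber S x"
  unfolding fiber_def by (auto simp: flip_def[of i y] dest: flip_in_cube[of y n i])

lemma sum_fiber_flip:
  assumes "i \<in> S" "i \<in> {1..n}"
  shows "(\<Sum>y\<in>fiber S x. h (flip i y)) = (\<Sum>y\<in>fiber S x. h y)"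
  by (rule sum.reindex_bij_witness[of _ "flip i" "flip i"]) (use assms flip_in_fiber in auto)

lemma fiber_mass_pos: "x \<in> cube n \<Longrightarrow> 0 < (\<Sum>y\<in>fiber S x. pmf \<mu> y)"
  by (rule sum_pos2[of _ x]) (auto simp: fiber_refl pmf_pos)

lemma cexp_eq_on_fiber: "y \<in> fiber S x \<Longrightarrow> cexp S h y = cexp S h x"
  by (simp add: cexp_def fiber_eq)

lemma cexp_cong: "(\<And>y. y \<in> fiber S x \<Longrightarrow> g y = h y) \<Longrightarrow> cexp S g x = cexp S h x"
  unfolding cexp_def by (metis (no_types, lifting) sum.cong)

lemma cexp_const [simp]: "x \<in> cube n \<Longrightarrow> cexp S (\<lambda>_. c) x = c"
  unfolding cexp_def using fiber_mass_pos[of x S] by (simp flip: sum_distrib_right)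

lemma cexp_add: "cexp S (\<lambda>y. g y + h y) x = cexp S g x + cexp S h x"
  unfolding cexp_def by (simp add: distrib_left sum.distrib add_divide_distrib)

lemma cexp_diff: "cexp S (\<lambda>y. g y - h y) x = cexp S g x - cexp S h x"
  unfolding cexp_def by (simp add: right_diff_distrib sum_subtractf diff_divide_distrib)

lemma cexp_cmult: "cexp S (\<lambda>y. c * h y) x = c * cexp S h x"
  unfolding cexp_def by (simp add: sum_distrib_left mult.left_commute)

lemma cexp_sum: "cexp S (\<lambda>y. \<Sum>i\<in>A. h i y) x = (\<Sum>i\<in>A. cexp S (h i) x)"
  unfolding cexp_def sum_distrib_left sum_divide_distrib[symmetric] by (subst sum.swap) simp

lemma cexp_mono:
  assumes "x \<in> cube n" "\<And>y. y \<in> fiber S x \<Longrightarrow> g y \<le> h y"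
  shows "cexp S g x \<le> cexp S h x"
  unfolding cexp_def using fiber_mass_pos[OF assms(1), of S] assms(2)
  by (intro divide_right_mono sum_mono mult_left_mono) auto

lemma cexp_nonneg:
  assumes "x \<in> cube n" "\<And>y. y \<in> fiber S x \<Longrightarrow> 0 \<le> h y"
  shows "0 \<le> cexp S h x"
  using cexp_mono[OF assms(1), of S "\<lambda>_. 0" h] assms by simp

lemma cexp_pos:
  assumes "x \<in> cube n" "\<And>y. y \<in> fiber S x \<Longrightarrow> 0 < h y"
  shows "0 < cexp S h x"
  unfolding cexp_def using fiber_mass_pos[OF assms(1), of S] assms fiber_refl[OF assms(1), of S]
  by (intro divide_pos_pos sum_pos2[of _ x]) (auto intro!: mult_pos_pos pmf_pos less_imp_le mult_nonneg_nonneg dest: fiber_cube)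

lemma abs_cexp_le: "x \<in> cube n \<Longrightarrow> \<bar>cexp S h x\<bar> \<le> cexp S (\<lambda>y. \<bar>h y\<bar>) x"
  using cexp_mono[of x S h "\<lambda>y. \<bar>h y\<bar>"] cexp_mono[of x S "\<lambda>y. - 1 * h y" "\<lambda>y. \<bar>h y\<bar>"]
  unfolding cexp_cmult by (auto intro: abs_leI)

lemma cexp_full: "cexp {1..n} h x = mean h"
proof -
  have "fiber {1..n} x = cube n" by (auto simp: fiber_def)
  then show ?thesis by (simp add: cexp_def mean_def sum_pmf)
qed

lemma cexp_empty:
  assumes "x \<in> cube n"
  shows "cexp {} h x = h x"
proof -
  have "fiber {} x = {x}"
    using assms by (auto simp: fiber_def cube_def intro!: PiE_ext[of _ "{1..n}"])
  then show ?thesis using pmf_pos[OF assms] by (simp add: cexp_def)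
qed

lemma cexp_Cauchy_Schwarz:
  assumes "x \<in> cube n" and pos: "0 < cexp S (\<lambda>y. (v y)\<^sup>2) x"
  shows "(cexp S (\<lambda>y. u y * v y) x)\<^sup>2 \<le> cexp S (\<lambda>y. (u y)\<^sup>2) x * cexp S (\<lambda>y. (v y)\<^sup>2) x"
proof -
  define p r s where "p = cexp S (\<lambda>y. u y * v y) x" and "r = cexp S (\<lambda>y. (u y)\<^sup>2) x"
    and "s = cexp S (\<lambda>y. (v y)\<^sup>2) x"
  have "0 \<le> cexp S (\<lambda>y. (s * u y - p * v y)\<^sup>2) x"
    by (rule cexp_nonneg[OF assms(1)]) simp
  also have "\<dots> = cexp S (\<lambda>y. s\<^sup>2 * (u y)\<^sup>2 - (2 * s * p) * (u y * v y) + p\<^sup>2 * (v y)\<^sup>2) x"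
    by (rule cexp_cong) (simp add: power2_eq_square algebra_simps)
  also have "\<dots> = s\<^sup>2 * r - (2 * s * p) * p + p\<^sup>2 * s"
    unfolding cexp_add cexp_diff cexp_cmult p_def r_def s_def ..
  also have "\<dots> = s * (s * r - p\<^sup>2)"
    by (simp add: power2_eq_square algebra_simps)
  finally have "0 \<le> s * (s * r - p\<^sup>2)" .
  then have "0 \<le> s * r - p\<^sup>2"
    using pos unfolding s_def[symmetric] by (simp add: zero_le_mult_iff)
  then show ?thesis
    unfolding p_def r_def s_def by (simp add: mult.commute)
qed

text \<open>
  The sum over pairs of configurations in a common \<open>T\<close>-fiber is symmetric in the two of them.
\<close>

lemma cexp_tower:
  assumes "T \<subseteq> S" "x \<in> cube n"
  shows "cexp S (cexp T h) x = cexp S h x"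
proof -
  let ?Z = "\<lambda>y. \<Sum>z\<in>fiber T y. pmf \<mu> z"
  have "(\<Sum>y\<in>fiber S x. pmf \<mu> y * cexp T h y) =
      (\<Sum>y\<in>fiber S x. \<Sum>z\<in>fiber S x. if z \<in> fiber T y then pmf \<mu> y * (pmf \<mu> z * h z) / ?Z y else 0)"
  proof (intro sum.cong refl)
    fix y assume y: "y \<in> fiber S x"
    have "fiber T y \<subseteq> fiber S x"
      using fiber_mono[OF assms(1), of y] fiber_eq[OF y] by simp
    then have "fiber S x \<inter> {z. z \<in> fiber T y} = fiber T y" by auto
    then show "pmf \<mu> y * cexp T h y =
        (\<Sum>z\<in>fiber S x. if z \<in> fiber T y then pmf \<mu> y * (pmf \<mu> z * h z) / ?Z y else 0)"
      by (simp add: sum.If_cases cexp_def sum_distrib_left sum_divide_distrib)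
  qed
  also have "\<dots> = (\<Sum>z\<in>fiber S x. \<Sum>y\<in>fiber S x. if z \<in> fiber T y then pmf \<mu> y * (pmf \<mu> z * h z) / ?Z y else 0)"
    by (rule sum.swap)
  also have "\<dots> = (\<Sum>z\<in>fiber S x. pmf \<mu> z * h z)"
  proof (intro sum.cong refl)
    fix z assume z: "z \<in> fiber S x"
    then have zc: "z \<in> cube n" by (rule fiber_cube)
    have sub: "fiber T z \<subseteq> fiber S x"
      using fiber_mono[OF assms(1), of z] fiber_eq[OF z] by simp
    have "(\<Sum>y\<in>fiber S x. if z \<in> fiber T y then pmf \<mu> y * (pmf \<mu> z * h z) / ?Z y else 0) =
        (\<Sum>y\<in>fiber S x. if y \<in> fiber T z then pmf \<mu> y * (pmf \<mu> z * h z) / ?Z z else 0)"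
    proof (intro sum.cong refl)
      fix y assume "y \<in> fiber S x"
      then have "z \<in> fiber T y \<longleftrightarrow> y \<in> fiber T z"
        using fiber_sym[OF zc, of y T] fiber_sym[OF fiber_cube, of y S x z T] by blast
      then show "(if z \<in> fiber T y then pmf \<mu> y * (pmf \<mu> z * h z) / ?Z y else 0) =
          (if y \<in> fiber T z then pmf \<mu> y * (pmf \<mu> z * h z) / ?Z z else 0)"
        using fiber_eq[of y T z] by simp
    qed
    also have "\<dots> = (\<Sum>y\<in>fiber T z. pmf \<mu> y * (pmf \<mu> z * h z) / ?Z z)"
      using sub by (simp add: sum.If_cases Int_absorb1)
    also have "\<dots> = pmf \<mu> z * h z"
      unfolding sum_divide_distrib[symmetric] sum_distrib_right[symmetric]
      using fiber_mass_pos[OF zc, of T] by simp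
    finally show "(\<Sum>y\<in>fiber S x. if z \<in> fiber T y then pmf \<mu> y * (pmf \<mu> z * h z) / ?Z y else 0) =
        pmf \<mu> z * h z" .
  qed
  finally show ?thesis by (simp add: cexp_def)
qed

lemma cexp_pull_out: "cexp S (\<lambda>y. f y * cexp S h y) x = cexp S f x * cexp S h x"
proof -
  have "cexp S (\<lambda>y. f y * cexp S h y) x = cexp S (\<lambda>y. cexp S h x * f y) x"
    by (rule cexp_cong) (simp add: cexp_eq_on_fiber)
  then show ?thesis by (simp add: cexp_cmult)
qed

lemma pmf_flip_bounds:
  assumes "x \<in> cube n" "i \<in> {1..n}"
  shows "b\<^sup>2 * pmf \<mu> x \<le> pmf \<mu> (flip i x)" "b\<^sup>2 * pmf \<mu> (flip i x) \<le> pmf \<mu> x"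
proof -
  have *: "b\<^sup>2 * pmf \<mu> y \<le> pmf \<mu> (flip i y)" if y: "y \<in> cube n" for y
  proof -
    have "b \<le> sqrt (pmf \<mu> (flip i y) / pmf \<mu> y)"
      using weights[OF y assms(2)] by (simp add: weight_def)
    then have "b\<^sup>2 \<le> (sqrt (pmf \<mu> (flip i y) / pmf \<mu> y))\<^sup>2"
      using b by (intro power_mono) auto
    then show ?thesis using pmf_pos[OF y] by (simp add: field_simps)
  qed
  show "b\<^sup>2 * pmf \<mu> x \<le> pmf \<mu> (flip i x)" "b\<^sup>2 * pmf \<mu> (flip i x) \<le> pmf \<mu> x"
    using *[OF assms(1)] *[OF flip_in_cube[OF assms]] by simp_all
qed

lemma b_sq: "0 < b\<^sup>2" "b\<^sup>2 \<le> 1"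
  using b by (auto simp: power_le_one)

lemma flip_prob_bounds:
  assumes "x \<in> cube n" "i \<in> {1..n}"
  shows "b\<^sup>2 / 2 \<le> flip_prob i x" "flip_prob i x \<le> 1" "0 \<le> flip_prob i x"
proof -
  note pos = pmf_pos[OF assms(1)] pmf_pos[OF flip_in_cube[OF assms]]
  show "flip_prob i x \<le> 1" "0 \<le> flip_prob i x"
    using pos by (auto simp: flip_prob_def)
  have "b\<^sup>2 * pmf \<mu> (flip i x) \<le> 1 * pmf \<mu> (flip i x)"
    using b_sq by (intro mult_right_mono) auto
  then have "b\<^sup>2 * (pmf \<mu> x + pmf \<mu> (flip i x)) \<le> 2 * pmf \<mu> (flip i x)"
    using pmf_flip_bounds(1)[OF assms] unfolding distrib_left by linarith
  then show "b\<^sup>2 / 2 \<le> flip_prob i x"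
    using pos by (simp add: flip_prob_def pos_le_divide_eq)
qed

lemma flip_prob_flip:
  assumes "x \<in> cube n" "i \<in> {1..n}"
  shows "flip_prob i (flip i x) = 1 - flip_prob i x"
  using pmf_pos[OF assms(1)] pmf_pos[OF flip_in_cube[OF assms]]
  by (simp add: flip_prob_def field_simps)

lemma flip_prob_balance:
  "pmf \<mu> (flip i x) * flip_prob i (flip i x) = pmf \<mu> x * flip_prob i x"
  by (simp add: flip_prob_def add.commute mult.commute)

lemma cexp_flip_symmetric:
  assumes "i \<in> S" "i \<in> {1..n}"
  shows "cexp S (\<lambda>y. flip_prob i y * h (flip i y)) x = cexp S (\<lambda>y. flip_prob i y * h y) x"
proof -
  have "(\<Sum>y\<in>fiber S x. pmf \<mu> y * (flip_prob i y * h (flip i y))) =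
      (\<Sum>y\<in>fiber S x. pmf \<mu> (flip i y) * flip_prob i (flip i y) * h (flip i y))"
    unfolding flip_prob_balance by (simp add: mult.assoc)
  also have "\<dots> = (\<Sum>y\<in>fiber S x. pmf \<mu> y * flip_prob i y * h y)"
    by (rule sum_fiber_flip[OF assms])
  finally show ?thesis by (simp add: cexp_def mult.assoc)
qed

lemma cexp_flip_le:
  assumes "i \<in> S" "i \<in> {1..n}" "x \<in> cube n" and f: "\<And>y. y \<in> fiber S x \<Longrightarrow> 0 \<le> f y"
  shows "b\<^sup>2 * cexp S (\<lambda>y. f (flip i y)) x \<le> cexp S f x"
proof -
  have "b\<^sup>2 * (\<Sum>y\<in>fiber S x. pmf \<mu> y * f (flip i y)) \<le> (\<Sum>y\<in>fiber S x. pmf \<mu> (flip i y) * f (flip i y))"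
    unfolding sum_distrib_left mult.assoc[symmetric]
    using assms flip_in_fiber[of _ S x i]
    by (intro sum_mono mult_right_mono pmf_flip_bounds) (auto dest: fiber_cube)
  also have "\<dots> = (\<Sum>y\<in>fiber S x. pmf \<mu> y * f y)"
    by (rule sum_fiber_flip[OF assms(1,2)])
  finally show ?thesis
    unfolding cexp_def using fiber_mass_pos[OF assms(3), of S] by (simp add: divide_right_mono)
qed

section \<open>Entropy and heat-bath averages\<close>

definition ent :: "nat set \<Rightarrow> (config \<Rightarrow> real) \<Rightarrow> config \<Rightarrow> real" where
  "ent S f x = cexp S (\<lambda>y. f y * ln (f y)) x - cexp S f x * ln (cexp S f x)"

text \<open>
  The middle terms telescope by the tower property.
\<close>

lemma entropy_chain_rule:
  assumes "T \<subseteq> S" "x \<in> cube n"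
  shows "ent S f x = cexp S (ent T f) x + ent S (cexp T f) x"
  unfolding ent_def[of S] ent_def[of T, abs_def] cexp_diff
  using cexp_tower[OF assms] by simp

lemma entropy_le_variance:
  assumes x: "x \<in> cube n" and G: "\<And>y. y \<in> fiber S x \<Longrightarrow> 0 < G y"
  shows "ent S G x \<le> (cexp S (\<lambda>y. (G y)\<^sup>2) x - (cexp S G x)\<^sup>2) / cexp S G x"
proof -
  let ?m = "cexp S G x"
  have m: "0 < ?m" using G by (rule cexp_pos[OF x])
  have "cexp S (\<lambda>y. G y * ln (G y)) x \<le> cexp S (\<lambda>y. (ln ?m - 1) * G y + (1 / ?m) * (G y)\<^sup>2) x"
  proof (rule cexp_mono[OF x])
    fix y assume y: "y \<in> fiber S x"
    have "ln (G y / ?m) \<le> G y / ?m - 1"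
      using G[OF y] m by (intro ln_le_minus_one) simp
    then have "ln (G y) \<le> ln ?m + G y / ?m - 1"
      using G[OF y] m by (simp add: ln_div)
    then have "G y * ln (G y) \<le> G y * (ln ?m + G y / ?m - 1)"
      using G[OF y] by (intro mult_left_mono) auto
    then show "G y * ln (G y) \<le> (ln ?m - 1) * G y + (1 / ?m) * (G y)\<^sup>2"
      by (simp add: power2_eq_square algebra_simps)
  qed
  also have "\<dots> = (ln ?m - 1) * ?m + (1 / ?m) * cexp S (\<lambda>y. (G y)\<^sup>2) x"
    unfolding cexp_add cexp_cmult ..
  finally show ?thesis
    using m by (simp add: ent_def field_simps power2_eq_square)
qed

definition heat_bath :: "nat \<Rightarrow> (config \<Rightarrow> real) \<Rightarrow> config \<Rightarrow> real" where
  "heat_bath i h y = h y + flip_prob i y * (h (flip i y) - h y)"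

lemma cexp_heat_bath:
  assumes "i \<in> S" "i \<in> {1..n}"
  shows "cexp S (heat_bath i h) x = cexp S h x"
proof -
  have "cexp S (\<lambda>y. flip_prob i y * (h (flip i y) - h y)) x = 0"
    unfolding right_diff_distrib cexp_diff cexp_flip_symmetric[OF assms] by simp
  then show ?thesis unfolding heat_bath_def cexp_add by simp
qed

lemma cexp_heat_bath_defect:
  assumes "i \<in> S" "i \<in> {1..n}"
  shows "cexp S (\<lambda>y. f y * (h y - heat_bath i h y)) x =
    1 / 2 * cexp S (\<lambda>y. flip_prob i y * ((f (flip i y) - f y) * (h (flip i y) - h y))) x"
proof -
  have "cexp S (\<lambda>y. flip_prob i y * ((f (flip i y) - f y) * (h (flip i y) - h y))) x =
      cexp S (\<lambda>y. flip_prob i y * (f (flip i y) * (h (flip i y) - h (flip i (flip i y))))) x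
      + cexp S (\<lambda>y. flip_prob i y * (f y * (h y - h (flip i y)))) x"
    unfolding cexp_add[symmetric] by (rule cexp_cong) (simp add: algebra_simps)
  also have "cexp S (\<lambda>y. flip_prob i y * (f (flip i y) * (h (flip i y) - h (flip i (flip i y))))) x =
      cexp S (\<lambda>y. flip_prob i y * (f y * (h y - h (flip i y)))) x"
    by (rule cexp_flip_symmetric[OF assms, of "\<lambda>y. f y * (h y - h (flip i y))"])
  finally show ?thesis
    by (simp add: heat_bath_def algebra_simps)
qed

lemma heat_bath_flip_same:
  assumes "y \<in> cube n" "i \<in> {1..n}"
  shows "heat_bath i h (flip i y) = heat_bath i h y"
  by (simp add: heat_bath_def flip_prob_flip[OF assms] algebra_simps)

text \<open>
  A heat-bath update of coordinate \<open>i\<close> erases the dependence on that coordinate and passes the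
  oscillation in direction \<open>i\<close> to the others, multiplied by the influence of \<open>j\<close> on \<open>i\<close>.
\<close>

lemma heat_bath_flip_other:
  assumes y: "y \<in> cube n" and i: "i \<in> {1..n}" and j: "j \<in> {1..n}"
    and R: "\<bar>flip_prob i (flip j y) - flip_prob i y\<bar> \<le> r"
    and hj: "\<bar>h (flip j y) - h y\<bar> \<le> oj" "\<bar>h (flip j (flip i y)) - h (flip i y)\<bar> \<le> oj"
    and hi: "\<bar>h (flip i y) - h y\<bar> \<le> oi"
  shows "\<bar>heat_bath i h (flip j y) - heat_bath i h y\<bar> \<le> oj + r * oi"
proof -
  let ?s = "flip_prob i (flip j y)"
  have s: "0 \<le> ?s" "?s \<le> 1"
    using flip_prob_bounds[OF flip_in_cube[OF y j] i] by auto
  let ?A = "(1 - ?s) * (h (flip j y) - h y)" and ?B = "?s * (h (flip j (flip i y)) - h (flip i y))"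
    and ?C = "(?s - flip_prob i y) * (h (flip i y) - h y)"
  have eq: "heat_bath i h (flip j y) - heat_bath i h y = ?A + ?B + ?C"
    by (simp add: heat_bath_def flip_commute[of i j] algebra_simps)
  have "\<bar>?A\<bar> \<le> (1 - ?s) * oj" "\<bar>?B\<bar> \<le> ?s * oj"
    using s hj by (simp_all add: abs_mult mult_left_mono)
  moreover have "\<bar>?C\<bar> \<le> r * oi"
    unfolding abs_mult using R hi by (intro mult_mono) auto
  moreover have "(1 - ?s) * oj + ?s * oj = oj"
    by (simp add: algebra_simps)
  ultimately show ?thesis unfolding eq by linarith
qed

section \<open>Dobrushin comparison on a fiber\<close>

text \<open>
  The vector \<open>z\<close> bounds, linearly in the oscillations of a test function \<open>h\<close>, how far the measure
  with density proportional to \<open>f\<close> is from the conditional measure; the normalization of \<open>f\<close> is kept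
  inside \<open>z\<close>.
\<close>

definition covariance_bound :: "nat set \<Rightarrow> (config \<Rightarrow> real) \<Rightarrow> config \<Rightarrow> (nat \<Rightarrow> real) \<Rightarrow> bool" where
  "covariance_bound S f x z \<longleftrightarrow> (\<forall>i\<in>S. 0 \<le> z i) \<and>
    (\<forall>h w. (\<forall>i\<in>S. \<forall>y\<in>fiber S x. \<bar>h (flip i y) - h y\<bar> \<le> w i) \<longrightarrow>
      \<bar>cexp S (\<lambda>y. f y * h y) x - cexp S f x * cexp S h x\<bar> \<le> (\<Sum>i\<in>S. z i * w i))"

lemma oscillation_le_sum:
  fixes h :: "config \<Rightarrow> real"
  assumes "S \<subseteq> {1..n}" "finite D" "D \<subseteq> S"
    and "\<And>i y. i \<in> S \<Longrightarrow> y \<in> fiber S x \<Longrightarrow> \<bar>h (flip i y) - h y\<bar> \<le> w i"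
    and "y \<in> fiber S x" "y' \<in> fiber S x" "\<And>k. k \<in> {1..n} \<Longrightarrow> y k = y' k \<longleftrightarrow> k \<notin> D"
  shows "\<bar>h y' - h y\<bar> \<le> (\<Sum>i\<in>D. w i)"
  using assms(2,3,5,7)
proof (induction D arbitrary: y rule: finite_induct)
  case empty
  then have "y = y'"
    using assms(6) by (auto simp: fiber_def cube_def intro!: PiE_ext[of _ "{1..n}"])
  then show ?case by simp
next
  case (insert i D)
  have i: "i \<in> S" "i \<in> {1..n}" using insert.prems assms(1) by auto
  have "y \<in> cube n" "y' \<in> cube n" using insert.prems(2) assms(6) by (auto dest: fiber_cube)
  then have "y i \<in> {-1, 1}" "y' i \<in> {-1, 1}" using cube_values i(2) by blast+
  moreover have "y i \<noteq> y' i" using insert.prems(3)[OF i(2)] by simp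
  ultimately have "- y i = y' i" by auto
  then have "flip i y k = y' k \<longleftrightarrow> k \<notin> D" if "k \<in> {1..n}" for k
    using insert.prems(3)[OF that] insert.hyps(2) by (auto simp: flip_def)
  then have "\<bar>h y' - h (flip i y)\<bar> \<le> (\<Sum>i\<in>D. w i)"
    using insert.prems i flip_in_fiber by (intro insert.IH) auto
  moreover have "\<bar>h (flip i y) - h y\<bar> \<le> w i"
    using i insert.prems by (intro assms(4)) auto
  ultimately show ?case using insert.hyps by simp
qed

lemma covariance_bound_exists:
  assumes S: "S \<subseteq> {1..n}" and x: "x \<in> cube n" and f: "\<And>y. y \<in> fiber S x \<Longrightarrow> 0 < f y"
  shows "covariance_bound S f x (\<lambda>_. cexp S f x)"
  unfolding covariance_bound_def
proof (intro conjI ballI allI impI)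
  show "0 \<le> cexp S f x" using f by (intro cexp_nonneg[OF x]) (auto intro: less_imp_le)
  fix h and o' :: "nat \<Rightarrow> real"
  assume "\<forall>i\<in>S. \<forall>y\<in>fiber S x. \<bar>h (flip i y) - h y\<bar> \<le> o' i"
  then have o': "\<bar>h (flip i y) - h y\<bar> \<le> o' i" if "i \<in> S" "y \<in> fiber S x" for i y
    using that by blast
  have o_nonneg: "0 \<le> o' i" if "i \<in> S" for i
    using o'[OF that fiber_refl[OF x]] by linarith
  let ?O = "\<Sum>i\<in>S. o' i"
  have osc: "\<bar>h y' - h y\<bar> \<le> ?O" if "y \<in> fiber S x" "y' \<in> fiber S x" for y y'
  proof -
    let ?D = "{k \<in> {1..n}. y k \<noteq> y' k}"
    have "?D \<subseteq> S"
      using fiber_agree[OF that(1)] fiber_agree[OF that(2)] by fastforce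
    then have "\<bar>h y' - h y\<bar> \<le> (\<Sum>i\<in>?D. o' i)"
      using that o' by (intro oscillation_le_sum[OF S]) auto
    also have "\<dots> \<le> ?O"
      using \<open>?D \<subseteq> S\<close> S o_nonneg by (intro sum_mono2) (auto dest: finite_subset)
    finally show ?thesis .
  qed
  have "cexp S (\<lambda>y. f y * h y) x - cexp S f x * cexp S h x = cexp S (\<lambda>y. f y * (h y - cexp S h x)) x"
    unfolding right_diff_distrib cexp_diff using cexp_cmult[of S "cexp S h x" f x] by (simp add: mult.commute)
  also have "\<bar>\<dots>\<bar> \<le> cexp S (\<lambda>y. \<bar>f y * (h y - cexp S h x)\<bar>) x"
    by (rule abs_cexp_le[OF x])
  also have "\<dots> \<le> cexp S (\<lambda>y. ?O * f y) x"
  proof (rule cexp_mono[OF x])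
    fix y assume y: "y \<in> fiber S x"
    have "\<bar>h y - cexp S h x\<bar> = \<bar>cexp S (\<lambda>z. h y - h z) x\<bar>"
      unfolding cexp_diff using x by simp
    also have "\<dots> \<le> cexp S (\<lambda>z. \<bar>h y - h z\<bar>) x" by (rule abs_cexp_le[OF x])
    also have "\<dots> \<le> cexp S (\<lambda>z. ?O) x" using osc y by (intro cexp_mono[OF x]) blast
    finally have "\<bar>h y - cexp S h x\<bar> \<le> ?O" using x by simp
    then show "\<bar>f y * (h y - cexp S h x)\<bar> \<le> ?O * f y"
      using f[OF y] by (simp add: abs_mult mult.commute mult_right_mono)
  qed
  finally show "\<bar>cexp S (\<lambda>y. f y * h y) x - cexp S f x * cexp S h x\<bar> \<le> (\<Sum>i\<in>S. cexp S f x * o' i)"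
    unfolding cexp_cmult sum_distrib_left[symmetric] by (simp add: mult.commute)
qed

text \<open>
  The conditional mean \<open>G\<close> depends on coordinate \<open>i\<close> only, so on the fiber its oscillation is one
  number \<open>D\<close>. Testing the covariance with \<open>h = G\<close> gives variance \<open>\<le> z i * D\<close>, and since both values of
  the coordinate have conditional probability at least of order \<open>b\<^sup>2\<close>, the variance is at least of order
  \<open>D\<^sup>2\<close>. The two bounds together eliminate \<open>D\<close>.
\<close>

lemma variance_le_covariance_bound:
  assumes S: "S \<subseteq> {1..n}" and i: "i \<in> S" and x: "x \<in> cube n"
    and f: "\<And>y. y \<in> fiber S x \<Longrightarrow> 0 < f y" and z: "covariance_bound S f x z"
  defines "G \<equiv> cexp (S - {i}) f"
  shows "cexp S (\<lambda>y. (G y)\<^sup>2) x - (cexp S G x)\<^sup>2 \<le> 4 / b\<^sup>2 * (z i)\<^sup>2"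
proof -
  have i': "i \<in> {1..n}" using i S by auto
  define D where "D = \<bar>G (flip i x) - G x\<bar>"
  have G_other: "G (flip j y) = G y" if "j \<in> S - {i}" "y \<in> fiber S x" for j y
    unfolding G_def using that S
    by (intro cexp_eq_on_fiber flip_in_fiber fiber_refl) (auto dest: fiber_cube)
  have G_agree: "G y = G y'" if "y \<in> fiber S x" "y' \<in> fiber S x" "y i = y' i" for y y'
  proof -
    have "y k = y' k" if k: "k \<in> {1..n} - (S - {i})" for k
      using k fiber_agree[OF \<open>y \<in> fiber S x\<close>, of k] fiber_agree[OF \<open>y' \<in> fiber S x\<close>, of k] \<open>y i = y' i\<close>
      by (cases "k = i") auto
    then have "y \<in> fiber (S - {i}) y'" using fiber_cube[OF that(1)] by (simp add: fiber_def)
    then show ?thesis unfolding G_def by (rule cexp_eq_on_fiber)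
  qed
  have G_flip: "\<bar>G (flip i y) - G y\<bar> = D" if y: "y \<in> fiber S x" for y
  proof -
    have xf: "x \<in> fiber S x" by (rule fiber_refl[OF x])
    note fl = flip_in_fiber[OF y i i'] flip_in_fiber[OF xf i i']
    have "y i \<in> {-1, 1}" "x i \<in> {-1, 1}"
      using cube_values[OF fiber_cube[OF y] i'] cube_values[OF x i'] by blast+
    then consider "y i = x i" | "y i = - x i" by auto
    then show ?thesis
    proof cases
      case 1
      then have "G y = G x" "G (flip i y) = G (flip i x)"
        using y xf fl by (auto intro!: G_agree simp: flip_def)
      then show ?thesis by (simp add: D_def)
    next
      case 2
      then have "G y = G (flip i x)" "G (flip i y) = G x"
        using y xf fl by (auto intro!: G_agree simp: flip_def)
      then show ?thesis by (simp add: D_def)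
    qed
  qed
  let ?V = "cexp S (\<lambda>y. (G y)\<^sup>2) x - (cexp S G x)\<^sup>2"
  have G_mean: "cexp S G x = cexp S f x"
    unfolding G_def by (rule cexp_tower) (use x in auto)
  have "cexp S (\<lambda>y. f y * G y) x = cexp S (\<lambda>y. (G y)\<^sup>2) x"
  proof -
    have "cexp S (cexp (S - {i}) (\<lambda>y. f y * G y)) x = cexp S (\<lambda>y. f y * G y) x"
      by (rule cexp_tower) (use x in auto)
    then show ?thesis unfolding G_def cexp_pull_out by (simp add: power2_eq_square)
  qed
  then have "?V = cexp S (\<lambda>y. f y * G y) x - cexp S f x * cexp S G x"
    by (simp add: G_mean power2_eq_square)
  also have "\<dots> \<le> (\<Sum>j\<in>S. z j * (if j = i then D else 0))"
  proof -
    have "\<bar>G (flip j y) - G y\<bar> \<le> (if j = i then D else 0)" if "j \<in> S" "y \<in> fiber S x" for j y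
      using G_flip[OF that(2)] G_other[of j y] that by simp
    then have "\<bar>cexp S (\<lambda>y. f y * G y) x - cexp S f x * cexp S G x\<bar> \<le>
        (\<Sum>j\<in>S. z j * (if j = i then D else 0))"
      using z[unfolded covariance_bound_def, THEN conjunct2, rule_format,
          where h = G and w = "\<lambda>j. if j = i then D else 0"] by blast
    then show ?thesis by (rule abs_le_D1)
  qed
  also have "\<dots> = z i * D"
    using i S by (simp add: if_distrib[of "\<lambda>c. _ * c"] finite_subset[OF S] cong: if_cong)
  finally have upper: "?V \<le> z i * D" .
  \<comment> \<open>Lower bound for the variance: on each edge, compare with the weighted mean of the two endpoints.\<close>
  have "b\<^sup>2 / 2 * D\<^sup>2 \<le> cexp S (\<lambda>y. flip_prob i y * (G (flip i y) - G y)\<^sup>2) x"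
  proof -
    have "b\<^sup>2 / 2 * D\<^sup>2 = cexp S (\<lambda>y. b\<^sup>2 / 2 * D\<^sup>2) x" using x by simp
    also have "\<dots> \<le> cexp S (\<lambda>y. flip_prob i y * (G (flip i y) - G y)\<^sup>2) x"
    proof (rule cexp_mono[OF x])
      fix y assume y: "y \<in> fiber S x"
      have "(G (flip i y) - G y)\<^sup>2 = D\<^sup>2" using G_flip[OF y] by (metis power2_abs)
      then show "b\<^sup>2 / 2 * D\<^sup>2 \<le> flip_prob i y * (G (flip i y) - G y)\<^sup>2"
        unfolding \<open>(G (flip i y) - G y)\<^sup>2 = D\<^sup>2\<close>
        by (intro mult_right_mono flip_prob_bounds(1) fiber_cube[OF y] i') simp
    qed
    finally show ?thesis .
  qed
  also have "\<dots> \<le> 2 * ?V"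
  proof -
    let ?c = "cexp S G x"
    have "(\<Sum>y\<in>fiber S x. pmf \<mu> y * (flip_prob i y * (G (flip i y) - G y)\<^sup>2)) \<le>
        (\<Sum>y\<in>fiber S x. pmf \<mu> y * (G y - ?c)\<^sup>2 + pmf \<mu> (flip i y) * (G (flip i y) - ?c)\<^sup>2)"
    proof (rule sum_mono)
      fix y assume "y \<in> fiber S x"
      then have y: "y \<in> cube n" by (rule fiber_cube)
      have weighted: "p * (r / (p + r) * (v - u)\<^sup>2) \<le> p * (u - c)\<^sup>2 + r * (v - c)\<^sup>2"
        if "0 < p" "0 < r" for p r u v c :: real
      proof -
        have "(p + r) * (p * (u - c)\<^sup>2 + r * (v - c)\<^sup>2) - p * r * (v - u)\<^sup>2 = (p * (u - c) + r * (v - c))\<^sup>2"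
          by (simp add: power2_eq_square algebra_simps)
        then have "p * r * (v - u)\<^sup>2 \<le> (p + r) * (p * (u - c)\<^sup>2 + r * (v - c)\<^sup>2)"
          using zero_le_power2[of "p * (u - c) + r * (v - c)"] by linarith
        then show ?thesis using that by (simp add: field_simps)
      qed
      show "pmf \<mu> y * (flip_prob i y * (G (flip i y) - G y)\<^sup>2) \<le>
          pmf \<mu> y * (G y - ?c)\<^sup>2 + pmf \<mu> (flip i y) * (G (flip i y) - ?c)\<^sup>2"
        unfolding flip_prob_def
        by (rule weighted[OF pmf_pos[OF y] pmf_pos[OF flip_in_cube[OF y i']]])
    qed
    also have "\<dots> = 2 * (\<Sum>y\<in>fiber S x. pmf \<mu> y * (G y - ?c)\<^sup>2)"
      unfolding sum.distrib using sum_fiber_flip[OF i i', of "\<lambda>y. pmf \<mu> y * (G y - ?c)\<^sup>2" x] by simp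
    finally have "cexp S (\<lambda>y. flip_prob i y * (G (flip i y) - G y)\<^sup>2) x \<le> 2 * cexp S (\<lambda>y. (G y - ?c)\<^sup>2) x"
      unfolding cexp_def using fiber_mass_pos[OF x, of S]
      by (simp add: divide_right_mono)
    also have "cexp S (\<lambda>y. (G y - ?c)\<^sup>2) x = cexp S (\<lambda>y. (G y)\<^sup>2 - 2 * ?c * G y + ?c\<^sup>2) x"
      by (rule cexp_cong) (simp add: power2_eq_square algebra_simps)
    also have "\<dots> = ?V"
      unfolding cexp_add cexp_diff cexp_cmult using x by (simp add: power2_eq_square)
    finally show ?thesis by simp
  qed
  finally have lower: "b\<^sup>2 / 2 * D\<^sup>2 \<le> 2 * ?V" .
  have z_nonneg: "0 \<le> z i" using z i by (simp add: covariance_bound_def)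
  have "D \<le> 4 / b\<^sup>2 * z i"
  proof (cases "D = 0")
    case True
    then show ?thesis using z_nonneg b_sq by simp
  next
    case False
    then have "0 < D" by (simp add: D_def)
    have "b\<^sup>2 / 2 * D * D \<le> 2 * z i * D"
      using lower upper by (simp add: power2_eq_square mult.assoc)
    then have "b\<^sup>2 / 2 * D \<le> 2 * z i"
      using \<open>0 < D\<close> by (rule mult_right_le_imp_le)
    then show ?thesis using b_sq by (simp add: field_simps)
  qed
  then have "z i * D \<le> z i * (4 / b\<^sup>2 * z i)"
    using z_nonneg by (rule mult_left_mono)
  then show ?thesis using upper by (simp add: power2_eq_square mult_ac)
qed

end

definition lsi_const :: "real \<Rightarrow> real \<Rightarrow> real" where
  "lsi_const b \<delta> = 4 / (b\<^sup>2 * b\<^sup>2 * \<delta>\<^sup>2)"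

text \<open>
  Dobrushin's condition in the form used below: a matrix that dominates the influences and contracts
  the Euclidean norm.
\<close>

locale dobrushin_system = spin_system +
  fixes R :: "nat \<Rightarrow> nat \<Rightarrow> real" and \<delta> :: real
  assumes gap: "0 < \<delta>" "\<delta> \<le> 1"
    and R_nonneg: "\<And>i j. 0 \<le> R i j"
    and R_influence: "\<And>x i j. x \<in> cube n \<Longrightarrow> i \<in> {1..n} \<Longrightarrow> j \<in> {1..n} \<Longrightarrow> i \<noteq> j \<Longrightarrow>
      \<bar>flip_prob i (flip j x) - flip_prob i x\<bar> \<le> R i j"
    and R_contraction: "\<And>v. L2_set (\<lambda>i. \<Sum>j\<in>{1..n}. R i j * v j) {1..n} \<le> (1 - \<delta>) * L2_set v {1..n}"
begin

definition edge_osc :: "nat set \<Rightarrow> (config \<Rightarrow> real) \<Rightarrow> config \<Rightarrow> nat \<Rightarrow> real" where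
  "edge_osc S f x i = 1 / 2 * cexp S (\<lambda>y. flip_prob i y * \<bar>f (flip i y) - f y\<bar>) x"

text \<open>
  Write \<open>h\<close> as its heat-bath average in coordinate \<open>i\<close> plus a remainder. The remainder sees only the
  single-edge differences of \<open>f\<close>, and the average has oscillations that the old bound \<open>z\<close> controls.
  Hence the \<open>i\<close>-th entry of \<open>z\<close> may be replaced by the entry of \<open>edge_osc + R z\<close>.
\<close>

lemma covariance_bound_update:
  assumes S: "S \<subseteq> {1..n}" and x: "x \<in> cube n"
    and z: "covariance_bound S f x z" and i: "i \<in> S"
    and w: "\<And>j y. j \<in> S \<Longrightarrow> y \<in> fiber S x \<Longrightarrow> \<bar>h (flip j y) - h y\<bar> \<le> w j"
  shows "\<bar>cexp S (\<lambda>y. f y * h y) x - cexp S f x * cexp S h x\<bar> \<le>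
    (\<Sum>j\<in>S. z j * w j) + (edge_osc S f x i + (\<Sum>j\<in>S. R i j * z j) - z i) * w i"
proof -
  have i': "i \<in> {1..n}" using i S by auto
  have fin: "finite S" using S by (rule finite_subset) simp
  have w_nonneg: "0 \<le> w j" if "j \<in> S" for j
    using w[OF that fiber_refl[OF x]] by linarith
  have z_nonneg: "0 \<le> z j" if "j \<in> S" for j
    using z that by (simp add: covariance_bound_def)
  let ?h = "heat_bath i h"
  define v where "v j = (if j = i then 0 else w j + R i j * w i)" for j
  have "\<bar>?h (flip j y) - ?h y\<bar> \<le> v j" if j: "j \<in> S" and y: "y \<in> fiber S x" for j y
  proof (cases "j = i")
    case True
    then show ?thesis using heat_bath_flip_same[OF fiber_cube[OF y] i'] by (simp add: v_def)
  next
    case False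
    have j': "j \<in> {1..n}" using j S by auto
    show ?thesis
      unfolding v_def using False
      by (simp, intro heat_bath_flip_other[OF fiber_cube[OF y] i' j'] R_influence[OF fiber_cube[OF y] i' j']
            w j y i flip_in_fiber[OF y i i']) auto
  qed
  then have 1: "\<bar>cexp S (\<lambda>y. f y * ?h y) x - cexp S f x * cexp S ?h x\<bar> \<le> (\<Sum>j\<in>S. z j * v j)"
    using z unfolding covariance_bound_def by blast
  have 2: "\<bar>cexp S (\<lambda>y. f y * (h y - ?h y)) x\<bar> \<le> edge_osc S f x i * w i"
  proof -
    have "\<bar>cexp S (\<lambda>y. f y * (h y - ?h y)) x\<bar> =
        1 / 2 * \<bar>cexp S (\<lambda>y. flip_prob i y * ((f (flip i y) - f y) * (h (flip i y) - h y))) x\<bar>"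
      unfolding cexp_heat_bath_defect[OF i i'] by simp
    also have "\<dots> \<le> 1 / 2 * cexp S (\<lambda>y. \<bar>flip_prob i y * ((f (flip i y) - f y) * (h (flip i y) - h y))\<bar>) x"
      using abs_cexp_le[OF x] by simp
    also have "\<dots> \<le> 1 / 2 * cexp S (\<lambda>y. w i * (flip_prob i y * \<bar>f (flip i y) - f y\<bar>)) x"
    proof (intro mult_left_mono cexp_mono[OF x])
      fix y assume y: "y \<in> fiber S x"
      have "0 \<le> flip_prob i y" by (rule flip_prob_bounds(3)[OF fiber_cube[OF y] i'])
      then have "flip_prob i y * \<bar>f (flip i y) - f y\<bar> * \<bar>h (flip i y) - h y\<bar> \<le>
          flip_prob i y * \<bar>f (flip i y) - f y\<bar> * w i"
        using w[OF i y] by (intro mult_left_mono) auto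
      then show "\<bar>flip_prob i y * ((f (flip i y) - f y) * (h (flip i y) - h y))\<bar> \<le>
          w i * (flip_prob i y * \<bar>f (flip i y) - f y\<bar>)"
        using \<open>0 \<le> flip_prob i y\<close> by (simp add: abs_mult mult_ac)
    qed simp
    finally show ?thesis unfolding cexp_cmult by (simp add: edge_osc_def mult_ac)
  qed
  have "cexp S (\<lambda>y. f y * h y) x - cexp S f x * cexp S h x =
      (cexp S (\<lambda>y. f y * ?h y) x - cexp S f x * cexp S ?h x) + cexp S (\<lambda>y. f y * (h y - ?h y)) x"
    unfolding cexp_heat_bath[OF i i'] right_diff_distrib cexp_diff by simp
  then have "\<bar>cexp S (\<lambda>y. f y * h y) x - cexp S f x * cexp S h x\<bar> \<le>
      (\<Sum>j\<in>S. z j * v j) + edge_osc S f x i * w i"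
    using 1 2 by linarith
  also have "(\<Sum>j\<in>S. z j * v j) \<le> (\<Sum>j\<in>S. z j * w j + (R i j * z j) * w i) - z i * w i"
  proof -
    have "(\<Sum>j\<in>S. z j * v j) = (\<Sum>j\<in>S - {i}. z j * w j + (R i j * z j) * w i)"
      unfolding sum.remove[OF fin i] v_def by (simp, intro sum.cong) (auto simp: algebra_simps)
    moreover have "0 \<le> (R i i * z i) * w i"
      by (intro mult_nonneg_nonneg R_nonneg z_nonneg w_nonneg i)
    ultimately show ?thesis unfolding sum.remove[OF fin i] by simp
  qed
  finally show ?thesis
    unfolding sum.distrib sum_distrib_right[symmetric] by (simp add: algebra_simps)
qed

lemma edge_osc_nonneg:
  "S \<subseteq> {1..n} \<Longrightarrow> x \<in> cube n \<Longrightarrow> i \<in> S \<Longrightarrow> 0 \<le> edge_osc S f x i"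
  unfolding edge_osc_def
  by (intro mult_nonneg_nonneg cexp_nonneg flip_prob_bounds(3)) (auto dest: fiber_cube)

lemma covariance_bound_average:
  assumes S: "S \<subseteq> {1..n}" and ne: "S \<noteq> {}" and x: "x \<in> cube n"
    and z: "covariance_bound S f x z"
  shows "covariance_bound S f x (\<lambda>i. (1 - 1 / real (card S)) * z i
    + 1 / real (card S) * (edge_osc S f x i + (\<Sum>j\<in>S. R i j * z j)))"
proof -
  have fin: "finite S" using S by (rule finite_subset) simp
  let ?k = "real (card S)"
  have k: "1 \<le> ?k" using fin ne by (simp add: Suc_leI card_gt_0_iff)
  have z_nonneg: "0 \<le> z j" if "j \<in> S" for j
    using z that by (simp add: covariance_bound_def)
  show ?thesis
    unfolding covariance_bound_def
  proof (intro conjI ballI allI impI)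
    fix i assume "i \<in> S"
    then show "0 \<le> (1 - 1 / ?k) * z i + 1 / ?k * (edge_osc S f x i + (\<Sum>j\<in>S. R i j * z j))"
      using k by (intro add_nonneg_nonneg mult_nonneg_nonneg sum_nonneg R_nonneg z_nonneg
          edge_osc_nonneg S x) auto
  next
    fix h and w :: "nat \<Rightarrow> real"
    assume w: "\<forall>i\<in>S. \<forall>y\<in>fiber S x. \<bar>h (flip i y) - h y\<bar> \<le> w i"
    let ?c = "\<bar>cexp S (\<lambda>y. f y * h y) x - cexp S f x * cexp S h x\<bar>"
    let ?u = "\<lambda>i. edge_osc S f x i + (\<Sum>j\<in>S. R i j * z j) - z i"
    have "?k * ?c = (\<Sum>i\<in>S. ?c)" by simp
    also have "\<dots> \<le> (\<Sum>i\<in>S. (\<Sum>j\<in>S. z j * w j) + ?u i * w i)"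
      using w by (intro sum_mono covariance_bound_update S x z) auto
    also have "\<dots> = (\<Sum>i\<in>S. ?k * (z i * w i) + ?u i * w i)"
      by (simp add: sum.distrib sum_distrib_left)
    also have "\<dots> = ?k * (\<Sum>i\<in>S. ((1 - 1 / ?k) * z i + 1 / ?k * (edge_osc S f x i + (\<Sum>j\<in>S. R i j * z j))) * w i)"
      unfolding sum_distrib_left[of ?k] using k by (intro sum.cong refl) (simp add: field_simps)
    finally show "?c \<le> (\<Sum>i\<in>S. ((1 - 1 / ?k) * z i + 1 / ?k * (edge_osc S f x i + (\<Sum>j\<in>S. R i j * z j))) * w i)"
      using k by (simp only: mult_le_cancel_left_pos)
  qed
qed

lemma L2_set_average_le:
  assumes S: "S \<subseteq> {1..n}" and k: "1 \<le> k"
  shows "L2_set (\<lambda>i. (1 - 1 / k) * z i + 1 / k * (a i + (\<Sum>j\<in>S. R i j * z j))) S \<le>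
    (1 - \<delta> / k) * L2_set z S + L2_set a S / k"
proof -
  let ?z = "\<lambda>j. if j \<in> S then z j else 0"
  have fin: "finite S" using S by (rule finite_subset) simp
  have Rz: "L2_set (\<lambda>i. \<Sum>j\<in>S. R i j * z j) S \<le> (1 - \<delta>) * L2_set z S"
  proof -
    have "(\<Sum>j\<in>S. R i j * z j) = (\<Sum>j\<in>{1..n}. R i j * ?z j)" for i
      using S by (intro sum.mono_neutral_cong_left) auto
    then have "L2_set (\<lambda>i. \<Sum>j\<in>S. R i j * z j) S = L2_set (\<lambda>i. \<Sum>j\<in>{1..n}. R i j * ?z j) S"
      by simp
    also have "\<dots> \<le> L2_set (\<lambda>i. \<Sum>j\<in>{1..n}. R i j * ?z j) {1..n}"
      unfolding L2_set_def using S by (intro real_sqrt_le_mono sum_mono2) auto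
    also have "\<dots> \<le> (1 - \<delta>) * L2_set ?z {1..n}" by (rule R_contraction)
    also have "L2_set ?z {1..n} = L2_set z S"
      unfolding L2_set_def using S by (intro arg_cong[of _ _ sqrt] sum.mono_neutral_cong_right) auto
    finally show ?thesis .
  qed
  have "L2_set (\<lambda>i. (1 - 1 / k) * z i + 1 / k * (a i + (\<Sum>j\<in>S. R i j * z j))) S \<le>
      L2_set (\<lambda>i. (1 - 1 / k) * z i) S + L2_set (\<lambda>i. 1 / k * (a i + (\<Sum>j\<in>S. R i j * z j))) S"
    by (rule L2_set_triangle_ineq)
  also have "\<dots> = (1 - 1 / k) * L2_set z S + 1 / k * L2_set (\<lambda>i. a i + (\<Sum>j\<in>S. R i j * z j)) S"
  proof -
    have "0 \<le> 1 - 1 / k" "0 \<le> 1 / k" using k by auto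
    then show ?thesis by (simp only: L2_set_right_distrib)
  qed
  also have "\<dots> \<le> (1 - 1 / k) * L2_set z S + 1 / k * (L2_set a S + (1 - \<delta>) * L2_set z S)"
    using k by (intro add_left_mono mult_left_mono order_trans[OF L2_set_triangle_ineq] Rz) auto
  also have "\<dots> = (1 - \<delta> / k) * L2_set z S + L2_set a S / k"
    using k by (simp add: field_simps)
  finally show ?thesis .
qed

text \<open>
  Among all valid bounds take one of almost minimal Euclidean norm. Averaging the updates over the
  coordinates of \<open>S\<close> gives another valid bound, whose norm is smaller by a definite amount unless the
  norm is already at most that of \<open>edge_osc\<close> divided by \<open>\<delta>\<close>, as \<open>R\<close> contracts by \<open>1 - \<delta>\<close>.
\<close>

lemma covariance_bound_near_optimal:
  assumes S: "S \<subseteq> {1..n}" and x: "x \<in> cube n" and f: "\<And>y. y \<in> fiber S x \<Longrightarrow> 0 < f y"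
    and c: "L2_set (edge_osc S f x) S / \<delta> < c"
  shows "\<exists>z. covariance_bound S f x z \<and> L2_set z S \<le> c"
proof (cases "S = {}")
  case True
  then show ?thesis
    using covariance_bound_exists[where f = f, OF S x f] c
    by (intro exI[of _ "\<lambda>_. cexp S f x"]) auto
next
  case ne: False
  let ?V = "{L2_set z S | z. covariance_bound S f x z}" and ?a = "L2_set (edge_osc S f x) S"
  have fin: "finite S" using S by (rule finite_subset) simp
  let ?k = "real (card S)"
  have k: "1 \<le> ?k" using fin ne by (simp add: Suc_leI card_gt_0_iff)
  have V_ne: "?V \<noteq> {}" using covariance_bound_exists[where f = f, OF S x f] by blast
  have V_bdd: "bdd_below ?V" by (rule bdd_belowI[of _ 0]) auto
  define r where "r = Inf ?V"
  have improve: "r \<le> (1 - \<delta> / ?k) * l + ?a / ?k" if l: "l \<in> ?V" for l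
  proof -
    obtain z where z: "covariance_bound S f x z" "l = L2_set z S" using l by blast
    have "r \<le> L2_set (\<lambda>i. (1 - 1 / ?k) * z i + 1 / ?k * (edge_osc S f x i + (\<Sum>j\<in>S. R i j * z j))) S"
      unfolding r_def using covariance_bound_average[OF S ne x z(1)] by (intro cInf_lower V_bdd) blast
    also have "\<dots> \<le> (1 - \<delta> / ?k) * l + ?a / ?k"
      unfolding z(2) by (rule L2_set_average_le[OF S k])
    finally show ?thesis .
  qed
  have "r \<le> ?a / \<delta>"
  proof (rule ccontr)
    assume "\<not> r \<le> ?a / \<delta>"
    then have pos: "0 < \<delta> * r - ?a" using gap by (simp add: field_simps)
    have dk: "0 \<le> 1 - \<delta> / ?k" "1 - \<delta> / ?k \<le> 1" using gap k by (auto simp: field_simps)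
    obtain l where l: "l \<in> ?V" "l < r + (\<delta> * r - ?a) / (2 * ?k)"
      using cInf_lessD[OF V_ne, of "r + (\<delta> * r - ?a) / (2 * ?k)"] pos k unfolding r_def[symmetric] by auto
    have "r \<le> (1 - \<delta> / ?k) * l + ?a / ?k" by (rule improve[OF l(1)])
    also have "(1 - \<delta> / ?k) * l \<le> (1 - \<delta> / ?k) * (r + (\<delta> * r - ?a) / (2 * ?k))"
      using l(2) dk by (intro mult_left_mono) auto
    also have "\<dots> \<le> (1 - \<delta> / ?k) * r + 1 * ((\<delta> * r - ?a) / (2 * ?k))"
      unfolding distrib_left using dk pos k by (intro add_left_mono mult_right_mono) auto
    finally have "(\<delta> * r - ?a) / ?k \<le> (\<delta> * r - ?a) / (2 * ?k)"
      by (simp add: left_diff_distrib diff_divide_distrib)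
    then show False using pos k by (simp add: field_simps)
  qed
  then have "r < c" using c by simp
  then obtain l where "l \<in> ?V" "l < c"
    using cInf_lessD[OF V_ne] unfolding r_def by blast
  then show ?thesis by (auto intro: less_imp_le)
qed

text \<open>
  Cauchy-Schwarz after the factorization of \<open>f (flip i y) - f y\<close> through square roots; the bounded
  density ratio of neighbours turns the mean of \<open>f (flip i y)\<close> into that of \<open>f y\<close>.
\<close>

lemma edge_osc_square_le:
  assumes S: "S \<subseteq> {1..n}" and i: "i \<in> S" and x: "x \<in> cube n" and f: "\<And>y. y \<in> fiber S x \<Longrightarrow> 0 < f y"
  shows "(edge_osc S f x i)\<^sup>2 \<le> cexp S f x / b\<^sup>2 * cexp S (\<lambda>y. (sqrt (f (flip i y)) - sqrt (f y))\<^sup>2) x"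
proof -
  have i': "i \<in> {1..n}" using i S by auto
  let ?u = "\<lambda>y. \<bar>sqrt (f (flip i y)) - sqrt (f y)\<bar>" and ?v = "\<lambda>y. sqrt (f (flip i y)) + sqrt (f y)"
  have fl: "0 < f (flip i y)" if "y \<in> fiber S x" for y
    using f flip_in_fiber[OF that i i'] by blast
  have "cexp S (\<lambda>y. flip_prob i y * \<bar>f (flip i y) - f y\<bar>) x \<le> cexp S (\<lambda>y. ?u y * ?v y) x"
  proof (rule cexp_mono[OF x])
    fix y assume y: "y \<in> fiber S x"
    have "\<bar>f (flip i y) - f y\<bar> = \<bar>(sqrt (f (flip i y)) - sqrt (f y)) * ?v y\<bar>"
      using f[OF y] fl[OF y] by (simp add: algebra_simps)
    also have "\<dots> = ?u y * ?v y"
      using f[OF y] fl[OF y] by (simp add: abs_mult)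
    finally show "flip_prob i y * \<bar>f (flip i y) - f y\<bar> \<le> ?u y * ?v y"
      using flip_prob_bounds[OF fiber_cube[OF y] i'] by (metis abs_ge_zero mult_left_le_one_le)
  qed
  then have le: "edge_osc S f x i \<le> 1 / 2 * cexp S (\<lambda>y. ?u y * ?v y) x"
    unfolding edge_osc_def by simp
  have v_pos: "0 < cexp S (\<lambda>y. (?v y)\<^sup>2) x"
    using f fl by (intro cexp_pos[OF x] zero_less_power add_pos_pos) auto
  have "cexp S (\<lambda>y. (?v y)\<^sup>2) x \<le> cexp S (\<lambda>y. 2 * f (flip i y) + 2 * f y) x"
  proof (rule cexp_mono[OF x])
    fix y assume y: "y \<in> fiber S x"
    have "(p + r)\<^sup>2 \<le> 2 * p\<^sup>2 + 2 * r\<^sup>2" for p r :: real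
      using zero_le_power2[of "p - r"] by (simp add: power2_eq_square algebra_simps)
    from this[of "sqrt (f (flip i y))" "sqrt (f y)"] show "(?v y)\<^sup>2 \<le> 2 * f (flip i y) + 2 * f y"
      using f[OF y] fl[OF y] by simp
  qed
  also have "\<dots> = 2 * cexp S (\<lambda>y. f (flip i y)) x + 2 * cexp S f x"
    unfolding cexp_add cexp_cmult ..
  also have "\<dots> \<le> 2 * (cexp S f x / b\<^sup>2) + 2 * (cexp S f x / b\<^sup>2)"
  proof -
    have nn: "0 \<le> cexp S f x" using f by (intro cexp_nonneg[OF x]) (auto intro: less_imp_le)
    have "cexp S (\<lambda>y. f (flip i y)) x \<le> cexp S f x / b\<^sup>2"
      using cexp_flip_le[OF i i' x, of f] f b_sq by (auto simp: field_simps intro: less_imp_le)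
    moreover have "cexp S f x \<le> cexp S f x / b\<^sup>2"
      using b_sq nn by (simp add: pos_le_divide_eq mult_left_le)
    ultimately show ?thesis by linarith
  qed
  finally have v_le: "cexp S (\<lambda>y. (?v y)\<^sup>2) x \<le> 4 * (cexp S f x / b\<^sup>2)" by simp
  have "(edge_osc S f x i)\<^sup>2 \<le> (1 / 2 * cexp S (\<lambda>y. ?u y * ?v y) x)\<^sup>2"
    using le edge_osc_nonneg[OF S x i] by (intro power_mono) auto
  also have "\<dots> = 1 / 4 * (cexp S (\<lambda>y. ?u y * ?v y) x)\<^sup>2"
    by (simp add: power2_eq_square)
  also have "\<dots> \<le> 1 / 4 * (cexp S (\<lambda>y. (?u y)\<^sup>2) x * cexp S (\<lambda>y. (?v y)\<^sup>2) x)"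
    by (intro mult_left_mono cexp_Cauchy_Schwarz[OF x v_pos]) simp
  also have "\<dots> \<le> 1 / 4 * (cexp S (\<lambda>y. (?u y)\<^sup>2) x * (4 * (cexp S f x / b\<^sup>2)))"
    by (intro mult_left_mono v_le cexp_nonneg[OF x]) auto
  finally show ?thesis by (simp add: mult.commute)
qed

lemma entropy_of_one_coordinate_averages:
  assumes S: "S \<subseteq> {1..n}" and x: "x \<in> cube n" and f: "\<And>y. y \<in> cube n \<Longrightarrow> 0 < f y"
  shows "(\<Sum>i\<in>S. ent S (cexp (S - {i}) f) x) \<le>
    lsi_const b \<delta> * (\<Sum>i\<in>S. cexp S (\<lambda>y. (sqrt (f (flip i y)) - sqrt (f y))\<^sup>2) x)"
proof -
  let ?a = "L2_set (edge_osc S f x) S" and ?m = "cexp S f x"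
  have f': "0 < f y" if "y \<in> fiber S x" for y using f fiber_cube[OF that] by blast
  have m: "0 < ?m" using f' by (rule cexp_pos[OF x])
  have bound: "(\<Sum>i\<in>S. ent S (cexp (S - {i}) f) x) \<le> 4 / b\<^sup>2 / ?m * c\<^sup>2" if c: "?a / \<delta> < c" for c
  proof -
    obtain z where z: "covariance_bound S f x z" "L2_set z S \<le> c"
      using covariance_bound_near_optimal[where f = f, OF S x f' c] by blast
    have "(\<Sum>i\<in>S. ent S (cexp (S - {i}) f) x) \<le> (\<Sum>i\<in>S. 4 / b\<^sup>2 / ?m * (z i)\<^sup>2)"
    proof (rule sum_mono)
      fix i assume i: "i \<in> S"
      let ?G = "cexp (S - {i}) f"
      have G_mean: "cexp S ?G x = ?m" by (rule cexp_tower) (use x in auto)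
      have "ent S ?G x \<le> (cexp S (\<lambda>y. (?G y)\<^sup>2) x - (cexp S ?G x)\<^sup>2) / ?m"
        unfolding G_mean[symmetric]
      proof (rule entropy_le_variance[OF x])
        fix y assume y: "y \<in> fiber S x"
        show "0 < ?G y"
          using f fiber_cube[OF y] by (intro cexp_pos) (auto dest: fiber_cube)
      qed
      also have "\<dots> \<le> (4 / b\<^sup>2 * (z i)\<^sup>2) / ?m"
        using m by (intro divide_right_mono variance_le_covariance_bound[where f = f, OF S i x f' z(1)]) auto
      finally show "ent S ?G x \<le> 4 / b\<^sup>2 / ?m * (z i)\<^sup>2" by simp
    qed
    also have "\<dots> = 4 / b\<^sup>2 / ?m * (L2_set z S)\<^sup>2"
      by (simp add: L2_set_def sum_nonneg sum_distrib_left)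
    also have "\<dots> \<le> 4 / b\<^sup>2 / ?m * c\<^sup>2"
      using m z(2) by (intro mult_left_mono power_mono) auto
    finally show ?thesis .
  qed
  have "(\<Sum>i\<in>S. ent S (cexp (S - {i}) f) x) \<le> 4 / b\<^sup>2 / ?m * (?a / \<delta>)\<^sup>2"
  proof (rule tendsto_lowerbound)
    show "((\<lambda>c. 4 / b\<^sup>2 / ?m * c\<^sup>2) \<longlongrightarrow> 4 / b\<^sup>2 / ?m * (?a / \<delta>)\<^sup>2) (at_right (?a / \<delta>))"
      by (intro tendsto_intros)
    show "\<forall>\<^sub>F c in at_right (?a / \<delta>). (\<Sum>i\<in>S. ent S (cexp (S - {i}) f) x) \<le> 4 / b\<^sup>2 / ?m * c\<^sup>2"
      using eventually_at_right_less by eventually_elim (rule bound)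
  qed simp
  also have "\<dots> = 4 / (b\<^sup>2 * ?m * \<delta>\<^sup>2) * (\<Sum>i\<in>S. (edge_osc S f x i)\<^sup>2)"
    by (simp add: L2_set_def sum_nonneg power_divide)
  also have "\<dots> \<le> 4 / (b\<^sup>2 * ?m * \<delta>\<^sup>2) *
      (\<Sum>i\<in>S. ?m / b\<^sup>2 * cexp S (\<lambda>y. (sqrt (f (flip i y)) - sqrt (f y))\<^sup>2) x)"
    using m by (intro mult_left_mono sum_mono edge_osc_square_le S x f') auto
  also have "\<dots> = lsi_const b \<delta> * (\<Sum>i\<in>S. cexp S (\<lambda>y. (sqrt (f (flip i y)) - sqrt (f y))\<^sup>2) x)"
    unfolding sum_distrib_left[symmetric] lsi_const_def using m by (simp add: field_simps)
  finally show ?thesis .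
qed

text \<open>
  Average the chain rule over the coordinate that is singled out. The induction hypothesis bounds the
  entropies on the smaller fibers, where each coordinate appears \<open>card S - 1\<close> times, and the previous
  lemma supplies the missing copy, so the constant does not grow with the number of coordinates.
\<close>

lemma entropy_inequality_on_fibers:
  assumes S: "S \<subseteq> {1..n}" and x: "x \<in> cube n" and f: "\<And>y. y \<in> cube n \<Longrightarrow> 0 < f y"
  shows "ent S f x \<le> lsi_const b \<delta> * (\<Sum>i\<in>S. cexp S (\<lambda>y. (sqrt (f (flip i y)) - sqrt (f y))\<^sup>2) x)"
  using S x
proof (induction "card S" arbitrary: S x)
  case 0
  then have "finite S" by (auto intro: finite_subset)
  then have "S = {}" using 0(1) by simp
  then show ?case using cexp_empty[OF 0(3)] by (simp add: ent_def)
next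
  case (Suc m)
  let ?e = "\<lambda>i y. (sqrt (f (flip i y)) - sqrt (f y))\<^sup>2"
  have fin: "finite S" using Suc.prems(1) by (rule finite_subset) simp
  have K: "0 \<le> lsi_const b \<delta>" by (simp add: lsi_const_def)
  have "real (Suc m) * ent S f x = (\<Sum>i\<in>S. ent S f x)"
    using Suc.hyps(2) by simp
  also have "\<dots> = (\<Sum>i\<in>S. cexp S (ent (S - {i}) f) x) + (\<Sum>i\<in>S. ent S (cexp (S - {i}) f) x)"
    unfolding sum.distrib[symmetric] using Suc.prems by (intro sum.cong refl entropy_chain_rule) auto
  also have "\<dots> \<le> (\<Sum>i\<in>S. lsi_const b \<delta> * (\<Sum>j\<in>S - {i}. cexp S (?e j) x)) + lsi_const b \<delta> * (\<Sum>i\<in>S. cexp S (?e i) x)"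
  proof (intro add_mono entropy_of_one_coordinate_averages Suc.prems f sum_mono)
    fix i assume i: "i \<in> S"
    have "cexp S (ent (S - {i}) f) x \<le> cexp S (\<lambda>y. lsi_const b \<delta> * (\<Sum>j\<in>S - {i}. cexp (S - {i}) (?e j) y)) x"
    proof (rule cexp_mono[OF Suc.prems(2)])
      fix y assume "y \<in> fiber S x"
      then show "ent (S - {i}) f y \<le> lsi_const b \<delta> * (\<Sum>j\<in>S - {i}. cexp (S - {i}) (?e j) y)"
        using Suc.hyps i fin Suc.prems by (intro Suc.hyps(1)) (auto dest: fiber_cube)
    qed
    also have "\<dots> = lsi_const b \<delta> * (\<Sum>j\<in>S - {i}. cexp S (?e j) x)"
      unfolding cexp_cmult cexp_sum using Suc.prems
      by (intro arg_cong[of _ _ "(*) (lsi_const b \<delta>)"] sum.cong refl cexp_tower) auto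
    finally show "cexp S (ent (S - {i}) f) x \<le> lsi_const b \<delta> * (\<Sum>j\<in>S - {i}. cexp S (?e j) x)" .
  qed auto
  also have "(\<Sum>i\<in>S. lsi_const b \<delta> * (\<Sum>j\<in>S - {i}. cexp S (?e j) x)) = lsi_const b \<delta> * (real m * (\<Sum>j\<in>S. cexp S (?e j) x))"
  proof -
    have "(\<Sum>i\<in>S. \<Sum>j\<in>S - {i}. cexp S (?e j) x) = (\<Sum>i\<in>S. (\<Sum>j\<in>S. cexp S (?e j) x) - cexp S (?e i) x)"
      using fin by (intro sum.cong refl) (simp add: sum.remove)
    also have "\<dots> = real m * (\<Sum>j\<in>S. cexp S (?e j) x)"
      unfolding sum_subtractf using Suc.hyps(2)[symmetric] by (simp add: algebra_simps)
    finally show ?thesis by (simp only: sum_distrib_left[symmetric])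
  qed
  finally have "real (Suc m) * ent S f x \<le> real (Suc m) * (lsi_const b \<delta> * (\<Sum>j\<in>S. cexp S (?e j) x))"
    by (simp add: algebra_simps)
  then show ?case by simp
qed

theorem log_Sobolev:
  assumes g: "\<And>y. y \<in> cube n \<Longrightarrow> 0 < g y"
  shows "mean (\<lambda>x. (g x)\<^sup>2 * ln ((g x)\<^sup>2)) - mean (\<lambda>x. (g x)\<^sup>2) * ln (mean (\<lambda>x. (g x)\<^sup>2)) \<le>
    lsi_const b \<delta> * (\<Sum>i\<in>{1..n}. mean (\<lambda>x. (g (flip i x) - g x)\<^sup>2))"
proof -
  obtain x where x: "x \<in> cube n" using cube_nonempty by blast
  have "ent {1..n} (\<lambda>x. (g x)\<^sup>2) x \<le>
      lsi_const b \<delta> * (\<Sum>i\<in>{1..n}. cexp {1..n} (\<lambda>y. (sqrt ((g (flip i y))\<^sup>2) - sqrt ((g y)\<^sup>2))\<^sup>2) x)"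
    using g by (intro entropy_inequality_on_fibers x zero_less_power) auto
  moreover have "mean (\<lambda>y. (sqrt ((g (flip i y))\<^sup>2) - sqrt ((g y)\<^sup>2))\<^sup>2) = mean (\<lambda>y. (g (flip i y) - g y)\<^sup>2)"
    if "i \<in> {1..n}" for i
    using g flip_in_cube[OF _ that] by (intro mean_cong) (simp add: less_imp_le)
  ultimately show ?thesis unfolding ent_def cexp_full by simp
qed

end

section \<open>The Poincare inequality\<close>

lemma exp_minus_le_inverse:
  fixes x :: real assumes "0 \<le> x" shows "exp (- x) \<le> 1 / (1 + x)"
proof -
  have "1 / exp x \<le> 1 / (1 + x)"
    using assms exp_ge_add_one_self[of x] by (intro divide_left_mono) (auto intro: mult_pos_pos)
  then show ?thesis by (simp add: exp_minus inverse_eq_divide)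
qed

lemma entropy_function_ge_quadratic:
  fixes u :: real assumes "\<bar>u\<bar> \<le> 1 / 2" shows "u + u\<^sup>2 / 4 \<le> (1 + u) * ln (1 + u)"
proof -
  define g where "g v = (1 + v) * ln (1 + v) - v - v\<^sup>2 / 4" for v :: real
  have der: "(g has_real_derivative ln (1 + v) - v / 2) (at v)" if "- 1 < v" for v
  proof -
    have "1 + v \<noteq> 0" "0 < 1 + v" using that by auto
    then show ?thesis
      unfolding g_def by (auto intro!: derivative_eq_intros)
  qed
  have "g 0 \<le> g u"
  proof (cases "0 \<le> u")
    case True
    show ?thesis
    proof (rule DERIV_nonneg_imp_nondecreasing[OF True])
      fix v assume v: "0 \<le> v" "v \<le> u"
      have "v - v\<^sup>2 \<le> ln (1 + v)" using v assms by (intro ln_one_plus_pos_lower_bound) auto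
      moreover have "v * v \<le> v * (1 / 2)" using v assms by (intro mult_left_mono) auto
      ultimately have "0 \<le> ln (1 + v) - v / 2" by (simp add: power2_eq_square)
      then show "\<exists>d. (g has_real_derivative d) (at v) \<and> 0 \<le> d" using der[of v] v by auto
    qed
  next
    case False
    have "g u \<ge> g 0"
    proof (rule DERIV_nonpos_imp_nonincreasing[of u 0 g])
      fix v assume v: "u \<le> v" "v \<le> 0"
      have "ln (1 + v) \<le> v" using v assms by (intro ln_add_one_self_le_self2) auto
      then show "\<exists>d. (g has_real_derivative d) (at v) \<and> d \<le> 0" using der[of v] v assms by (intro exI) auto
    qed (use False in auto)
    then show ?thesis .
  qed
  then show ?thesis by (simp add: g_def)
qed

text \<open>
  The logarithmic Sobolev constant with respect to the Dirichlet form of the semigroup, and the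
  quantities derived from it that do not depend on the dimension.
\<close>

definition heat_lsi :: "real \<Rightarrow> real \<Rightarrow> real" where
  "heat_lsi b K = 4 * K / b"

definition hyper_rate :: "real \<Rightarrow> real \<Rightarrow> real" where
  "hyper_rate b K = 1 - exp (- 2 / heat_lsi b K)"

definition L1_L2_const :: "real \<Rightarrow> real \<Rightarrow> real \<Rightarrow> real" where
  "L1_L2_const b \<kappa> K = (1 - exp (- 1 / (2 * heat_lsi b K))) * b * hyper_rate b K / (2 * exp (4 * \<kappa> + 1))"

lemma heat_lsi_pos: "0 < b \<Longrightarrow> 0 < K \<Longrightarrow> 0 < heat_lsi b K"
  by (simp add: heat_lsi_def)

lemma hyper_rate_bounds: "0 < b \<Longrightarrow> 0 < K \<Longrightarrow> 0 < hyper_rate b K" "hyper_rate b K < 1"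
  using heat_lsi_pos[of b K] by (auto simp: hyper_rate_def)

lemma L1_L2_const_pos: "0 < b \<Longrightarrow> 0 < K \<Longrightarrow> 0 < L1_L2_const b \<kappa> K"
  using heat_lsi_pos[of b K] hyper_rate_bounds[of b K] by (simp add: L1_L2_const_def)

locale log_sobolev_system = curved_spin_system +
  fixes K :: real
  assumes K_pos: "0 < K"
    and log_sobolev: "\<And>g. (\<And>y. y \<in> cube n \<Longrightarrow> 0 < g y) \<Longrightarrow>
      mean (\<lambda>x. (g x)\<^sup>2 * ln ((g x)\<^sup>2)) - mean (\<lambda>x. (g x)\<^sup>2) * ln (mean (\<lambda>x. (g x)\<^sup>2)) \<le>
      K * (\<Sum>i\<in>{1..n}. mean (\<lambda>x. (g (flip i x) - g x)\<^sup>2))"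
begin

abbreviation M :: real where "M \<equiv> heat_lsi b K"

lemma M_pos: "0 < M"
  using heat_lsi_pos b K_pos by blast

lemma coord_influence_eq: "coord_influence \<mu> i f = mean (\<lambda>x. (delta \<mu> i f x)\<^sup>2)"
  by (simp add: coord_influence_def expectation_eq_mean)

lemma coord_L1_eq: "coord_L1 \<mu> i f = mean (\<lambda>x. \<bar>delta \<mu> i f x\<bar>)"
  by (simp add: coord_L1_def expectation_eq_mean)

lemma I_star_eq: "I_star n \<mu> f = (\<Sum>i\<in>{1..n}. mean (\<lambda>x. (delta \<mu> i f x)\<^sup>2))"
  by (simp add: I_star_def coord_influence_eq)

lemma A_star_eq: "A_star n \<mu> f = mean (\<lambda>x. sqrt (Gamma_star n \<mu> f x))"
  by (simp add: A_star_def expectation_eq_mean)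

lemma coord_influence_nonneg: "0 \<le> coord_influence \<mu> i f"
  unfolding coord_influence_eq by (intro mean_nonneg) auto

lemma coord_L1_nonneg: "0 \<le> coord_L1 \<mu> i f"
  unfolding coord_L1_eq by (intro mean_nonneg) auto

lemma I_star_nonneg: "0 \<le> I_star n \<mu> f"
  unfolding I_star_def by (intro sum_nonneg coord_influence_nonneg)

lemma J_star_nonneg: "0 \<le> J_star n \<mu> f"
  unfolding J_star_def by (intro sum_nonneg) auto

lemma A_star_nonneg: "0 \<le> A_star n \<mu> f"
  unfolding A_star_eq by (intro mean_nonneg) (auto simp: Gamma_star_nonneg)

lemma Var_nonneg: "0 \<le> Var \<mu> f"
  unfolding variance_eq by (intro mean_nonneg) auto

lemma dirichlet_eq: "dirichlet f f = 1 / 2 * (\<Sum>i\<in>{1..n}. mean (\<lambda>x. q i x * (f (flip i x) - f x)\<^sup>2))"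
  by (simp add: dirichlet_def mean_sum power2_eq_square)

lemma total_influence_eq: "total_influence n \<mu> f = dirichlet f f"
  unfolding total_influence_def expectation_eq_mean mean_cmult dirichlet_eq mean_sum ..

lemma dirichlet_nonneg: "0 \<le> dirichlet f f"
  unfolding dirichlet_eq using rate_bounds(3)
  by (intro mult_nonneg_nonneg sum_nonneg mean_nonneg) (auto intro: less_imp_le)

lemma dirichlet_vs_I_star: "b * I_star n \<mu> f \<le> dirichlet f f" "dirichlet f f \<le> I_star n \<mu> f / b"
proof -
  have q: "2 * b * (q i x)\<^sup>2 \<le> q i x" "q i x \<le> 2 / b * (q i x)\<^sup>2" if "x \<in> cube n" "i \<in> {1..n}" for i x
  proof -
    note r = rate_bounds[OF that]
    have "q i x * (2 * b * q i x) \<le> q i x * 1" "q i x * 1 \<le> q i x * (2 / b * q i x)"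
      using r b by (intro mult_left_mono; simp add: field_simps)+
    then show "2 * b * (q i x)\<^sup>2 \<le> q i x" "q i x \<le> 2 / b * (q i x)\<^sup>2"
      by (simp_all add: power2_eq_square mult_ac)
  qed
  have "b * I_star n \<mu> f = 1 / 2 * (\<Sum>i\<in>{1..n}. mean (\<lambda>x. 2 * b * (q i x)\<^sup>2 * (f (flip i x) - f x)\<^sup>2))"
    unfolding I_star_eq delta_def power_mult_distrib mult.assoc[of "2 * b"] mean_cmult sum_distrib_left[symmetric]
    by simp
  also have "\<dots> \<le> dirichlet f f"
    unfolding dirichlet_eq by (intro mult_left_mono sum_mono mean_mono mult_right_mono q) auto
  finally show "b * I_star n \<mu> f \<le> dirichlet f f" .
  have "dirichlet f f \<le> 1 / 2 * (\<Sum>i\<in>{1..n}. mean (\<lambda>x. 2 / b * (q i x)\<^sup>2 * (f (flip i x) - f x)\<^sup>2))"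
    unfolding dirichlet_eq by (intro mult_left_mono sum_mono mean_mono mult_right_mono q) auto
  also have "\<dots> = I_star n \<mu> f / b"
    unfolding I_star_eq delta_def power_mult_distrib mult.assoc[of "2 / b"] mean_cmult sum_distrib_left[symmetric]
    by simp
  finally show "dirichlet f f \<le> I_star n \<mu> f / b" .
qed

lemma log_sobolev_dirichlet:
  assumes "\<And>y. y \<in> cube n \<Longrightarrow> 0 < g y"
  shows "mean (\<lambda>x. (g x)\<^sup>2 * ln ((g x)\<^sup>2)) - mean (\<lambda>x. (g x)\<^sup>2) * ln (mean (\<lambda>x. (g x)\<^sup>2)) \<le> M * dirichlet g g"
proof -
  have "(\<Sum>i\<in>{1..n}. mean (\<lambda>x. (g (flip i x) - g x)\<^sup>2)) \<le>
      (\<Sum>i\<in>{1..n}. mean (\<lambda>x. 2 / b * (q i x * (g (flip i x) - g x)\<^sup>2)))"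
  proof (intro sum_mono mean_mono)
    fix i x assume "i \<in> {1..n}" "x \<in> cube n"
    then have "1 \<le> 2 / b * q i x" using rate_bounds(1)[of x i] b by (simp add: field_simps)
    then have "1 * (g (flip i x) - g x)\<^sup>2 \<le> 2 / b * q i x * (g (flip i x) - g x)\<^sup>2"
      by (intro mult_right_mono) auto
    then show "(g (flip i x) - g x)\<^sup>2 \<le> 2 / b * (q i x * (g (flip i x) - g x)\<^sup>2)" by (simp add: mult.assoc)
  qed
  also have "\<dots> = 4 / b * dirichlet g g"
    unfolding dirichlet_eq mean_cmult sum_distrib_left[symmetric] by simp
  finally have "K * (\<Sum>i\<in>{1..n}. mean (\<lambda>x. (g (flip i x) - g x)\<^sup>2)) \<le> K * (4 / b * dirichlet g g)"
    using K_pos by (intro mult_left_mono) auto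
  then show ?thesis
    using log_sobolev[where g = g, OF assms] by (simp add: heat_lsi_def mult_ac)
qed

text \<open>
  Linearization: the logarithmic Sobolev inequality for the square root of \<open>1 + \<epsilon> (f - mean f)\<close>, with
  \<open>\<epsilon>\<close> so small that the perturbation is at most \<open>1/2\<close>. The entropy is then at least a quarter of the
  variance of the perturbation.
\<close>

lemma Poincare: "Var \<mu> f \<le> 4 * M * dirichlet f f"
proof -
  define h where "h x = f x - mean f" for x
  obtain B where B: "\<And>x. x \<in> cube n \<Longrightarrow> \<bar>h x\<bar> \<le> B"
    using bounded_on_cube[of h] by auto
  define \<epsilon> where "\<epsilon> = 1 / (2 * (\<bar>B\<bar> + 1))"
  have \<epsilon>: "0 < \<epsilon>" by (simp add: \<epsilon>_def add_nonneg_pos)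
  have small: "\<bar>\<epsilon> * h x\<bar> \<le> 1 / 2" if "x \<in> cube n" for x
  proof -
    have "\<epsilon> * \<bar>h x\<bar> \<le> \<epsilon> * (\<bar>B\<bar> + 1)"
      using B[OF that] \<epsilon> by (intro mult_left_mono) auto
    also have "\<dots> = 1 / 2" by (simp add: \<epsilon>_def add_nonneg_pos less_imp_neq[symmetric] field_simps)
    finally show ?thesis using \<epsilon> by (simp add: abs_mult)
  qed
  define G where "G x = 1 + \<epsilon> * h x" for x
  have G: "1 / 2 \<le> G x" if "x \<in> cube n" for x
    using small[OF that] unfolding G_def by linarith
  have h_mean: "mean h = 0" unfolding h_def mean_diff by simp
  have G_mean: "mean G = 1" unfolding G_def mean_add mean_cmult by (simp add: h_mean)
  have sq: "(sqrt (G x))\<^sup>2 = G x" if "x \<in> cube n" for x using G[OF that] by simp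
  have "mean (\<lambda>x. \<epsilon> * h x + \<epsilon>\<^sup>2 / 4 * (h x)\<^sup>2) \<le> mean (\<lambda>x. G x * ln (G x))"
    unfolding G_def using entropy_function_ge_quadratic[OF small]
    by (intro mean_mono) (simp add: power_mult_distrib)
  moreover have "mean (\<lambda>x. \<epsilon> * h x + \<epsilon>\<^sup>2 / 4 * (h x)\<^sup>2) = \<epsilon>\<^sup>2 / 4 * Var \<mu> f"
    unfolding mean_add mean_cmult h_mean unfolding variance_eq h_def by simp
  moreover have "mean (\<lambda>x. G x * ln (G x)) \<le> M * dirichlet (\<lambda>x. sqrt (G x)) (\<lambda>x. sqrt (G x))"
  proof -
    have "mean (\<lambda>x. (sqrt (G x))\<^sup>2 * ln ((sqrt (G x))\<^sup>2)) = mean (\<lambda>x. G x * ln (G x))"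
      "mean (\<lambda>x. (sqrt (G x))\<^sup>2) = 1"
      using mean_cong[OF sq] G_mean by (auto intro!: mean_cong simp: sq)
    then show ?thesis
      using log_sobolev_dirichlet[of "\<lambda>x. sqrt (G x)"] G by fastforce
  qed
  moreover have "dirichlet (\<lambda>x. sqrt (G x)) (\<lambda>x. sqrt (G x)) \<le> \<epsilon>\<^sup>2 * dirichlet f f"
  proof -
    have "dirichlet (\<lambda>x. sqrt (G x)) (\<lambda>x. sqrt (G x)) \<le>
        1 / 2 * (\<Sum>i\<in>{1..n}. mean (\<lambda>x. \<epsilon>\<^sup>2 * (q i x * (f (flip i x) - f x)\<^sup>2)))"
      unfolding dirichlet_eq
    proof (intro mult_left_mono sum_mono mean_mono)
      fix i x assume i: "i \<in> {1..n}" and x: "x \<in> cube n"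
      let ?u = "G (flip i x)" and ?v = "G x"
      have uv: "1 / 2 \<le> ?u" "1 / 2 \<le> ?v" using G x i by auto
      have "(?u - ?v)\<^sup>2 = ((sqrt ?u - sqrt ?v) * (sqrt ?u + sqrt ?v))\<^sup>2"
        using uv by (simp add: algebra_simps)
      also have "\<dots> = (sqrt ?u - sqrt ?v)\<^sup>2 * (?u + ?v + 2 * (sqrt ?u * sqrt ?v))"
        using uv by (simp add: power_mult_distrib power2_sum)
      also have "\<dots> \<ge> (sqrt ?u - sqrt ?v)\<^sup>2 * 1"
      proof (intro mult_left_mono)
        have "0 \<le> sqrt ?u * sqrt ?v" using uv by (intro mult_nonneg_nonneg) auto
        then show "1 \<le> ?u + ?v + 2 * (sqrt ?u * sqrt ?v)" using uv by linarith
      qed simp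
      finally have "(sqrt ?u - sqrt ?v)\<^sup>2 \<le> (?u - ?v)\<^sup>2" by simp
      also have "(?u - ?v)\<^sup>2 = \<epsilon>\<^sup>2 * (f (flip i x) - f x)\<^sup>2"
        by (simp add: G_def h_def power2_eq_square algebra_simps)
      finally have "q i x * (sqrt ?u - sqrt ?v)\<^sup>2 \<le> q i x * (\<epsilon>\<^sup>2 * (f (flip i x) - f x)\<^sup>2)"
        using rate_bounds(3)[OF x i] by (intro mult_left_mono) auto
      then show "q i x * (sqrt ?u - sqrt ?v)\<^sup>2 \<le> \<epsilon>\<^sup>2 * (q i x * (f (flip i x) - f x)\<^sup>2)"
        by (simp add: mult.left_commute)
    qed simp
    also have "\<dots> = \<epsilon>\<^sup>2 * dirichlet f f"
      unfolding dirichlet_eq mean_cmult sum_distrib_left[symmetric] by simp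
    finally show ?thesis .
  qed
  ultimately have "\<epsilon>\<^sup>2 / 4 * Var \<mu> f \<le> M * (\<epsilon>\<^sup>2 * dirichlet f f)"
    using mult_left_mono[OF _ less_imp_le[OF M_pos]] by fastforce
  then have "\<epsilon>\<^sup>2 * Var \<mu> f \<le> \<epsilon>\<^sup>2 * (4 * M * dirichlet f f)" by (simp add: mult_ac)
  then show ?thesis using \<epsilon> by simp
qed

section \<open>Hypercontractive decay and the L1-L2 inequality\<close>

lemma mean_pos:
  assumes "\<And>x. x \<in> cube n \<Longrightarrow> 0 < h x" shows "0 < mean h"
proof -
  have "mean h \<noteq> 0" "0 \<le> mean h"
    using assms cube_nonempty by (auto intro!: mean_nonneg simp: mean_eq_0_iff less_imp_le)
       (metis all_not_in_conv less_irrefl)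
  then show ?thesis by simp
qed

text \<open>
  Jensen's inequality for the logarithm under the probability density proportional to \<open>g\<^sup>2\<close>, in the
  tangent form \<open>ln g \<ge> ln c + 1 - c / g\<close> with \<open>c\<close> the ratio of the second and the first moment.
\<close>

lemma entropy_ge_log_moment_ratio:
  assumes g: "\<And>x. x \<in> cube n \<Longrightarrow> 0 < g x"
  shows "mean (\<lambda>x. (g x)\<^sup>2) * ln (mean (\<lambda>x. (g x)\<^sup>2) / (mean g)\<^sup>2) \<le>
    mean (\<lambda>x. (g x)\<^sup>2 * ln ((g x)\<^sup>2)) - mean (\<lambda>x. (g x)\<^sup>2) * ln (mean (\<lambda>x. (g x)\<^sup>2))"
proof -
  define y m where "y = mean (\<lambda>x. (g x)\<^sup>2)" and "m = mean g"
  have ym: "0 < y" "0 < m"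
    unfolding y_def m_def using g by (auto intro!: mean_pos zero_less_power)
  define c where "c = y / m"
  have c: "0 < c" using ym by (simp add: c_def)
  have "mean (\<lambda>x. 2 * (ln c + 1) * (g x)\<^sup>2 - 2 * c * g x) \<le> mean (\<lambda>x. (g x)\<^sup>2 * ln ((g x)\<^sup>2))"
  proof (rule mean_mono)
    fix x assume "x \<in> cube n"
    then have gx: "0 < g x" by (rule g)
    have "ln (c / g x) \<le> c / g x - 1" using c gx by (intro ln_le_minus_one) auto
    then have "ln c + 1 - c / g x \<le> ln (g x)" using c gx by (simp add: ln_div)
    then have "2 * (g x)\<^sup>2 * (ln c + 1 - c / g x) \<le> 2 * (g x)\<^sup>2 * ln (g x)"
      by (intro mult_left_mono) auto
    moreover have "2 * (g x)\<^sup>2 * (ln c + 1 - c / g x) = 2 * (ln c + 1) * (g x)\<^sup>2 - 2 * c * g x"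
      using gx by (simp add: field_simps power2_eq_square)
    moreover have "ln ((g x)\<^sup>2) = 2 * ln (g x)" using gx by (simp add: ln_realpow)
    ultimately show "2 * (ln c + 1) * (g x)\<^sup>2 - 2 * c * g x \<le> (g x)\<^sup>2 * ln ((g x)\<^sup>2)"
      by simp
  qed
  then have "2 * (ln c + 1) * y - 2 * (c * m) \<le> mean (\<lambda>x. (g x)\<^sup>2 * ln ((g x)\<^sup>2))"
    unfolding mean_diff mean_cmult y_def[symmetric] m_def[symmetric] by (simp add: mult.assoc)
  moreover have "c * m = y" using ym by (simp add: c_def)
  moreover have "ln c = ln y - ln m" "ln (y / m\<^sup>2) = ln y - 2 * ln m"
    using ym by (simp_all add: c_def ln_div ln_realpow)
  ultimately show ?thesis
    unfolding y_def[symmetric] m_def[symmetric] by (simp only:) (simp add: algebra_simps)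
qed

lemma mean_square_has_derivative:
  "((\<lambda>t. mean (\<lambda>x. (P t f x)\<^sup>2)) has_real_derivative - 2 * dirichlet (P t f) (P t f)) (at t)"
proof -
  have "((\<lambda>t. mean (\<lambda>x. (P t f x)\<^sup>2)) has_real_derivative mean (\<lambda>x. 2 * (P t f x * L (P t f) x))) (at t)"
    by (rule mean_has_derivative)
       (auto intro!: derivative_eq_intros semigroup_has_derivative simp: semigroup_generator_commute)
  then show ?thesis unfolding mean_cmult mean_generator by simp
qed

lemma semigroup_pos:
  assumes h: "\<And>x. x \<in> cube n \<Longrightarrow> 0 < h x" and "0 \<le> t" "x \<in> cube n"
  shows "0 < P t h x"
proof -
  have "Min (h ` cube n) \<in> h ` cube n" using cube_nonempty by (intro Min_in) auto
  then have "0 < Min (h ` cube n)" using h by auto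
  moreover have "P t (\<lambda>_. Min (h ` cube n)) x \<le> P t h x"
    using assms by (intro semigroup_mono) auto
  ultimately show ?thesis using assms by simp
qed

lemma mean_square_le: "(mean h)\<^sup>2 \<le> mean (\<lambda>x. (h x)\<^sup>2)"
  using Var_nonneg[of h] unfolding variance_eq' by simp

text \<open>
  A substitute for hypercontractivity with fixed exponents. The mean of \<open>P t h\<close> is constant and the
  derivative of its second moment \<open>y\<close> is \<open>- 2\<close> times the energy, so the logarithmic Sobolev inequality
  and the preceding lemma give a linear differential inequality for \<open>ln (y / m\<^sup>2)\<close>.
\<close>

lemma hypercontractive_decay_pos:
  assumes h: "\<And>x. x \<in> cube n \<Longrightarrow> 0 < h x" and t: "0 \<le> t"
  shows "mean (\<lambda>x. (P t h x)\<^sup>2) \<le>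
    (mean h)\<^sup>2 * exp (exp (- 2 * t / M) * ln (mean (\<lambda>x. (h x)\<^sup>2) / (mean h)\<^sup>2))"
proof -
  define m where "m = mean h"
  define y where "y t = mean (\<lambda>x. (P t h x)\<^sup>2)" for t
  define z where "z t = exp (2 / M * t) * ln (y t / m\<^sup>2)" for t
  have m: "0 < m" unfolding m_def using h by (rule mean_pos)
  have y: "0 < y s" if "0 \<le> s" for s
    unfolding y_def using h that by (intro mean_pos zero_less_power semigroup_pos) auto
  have "z t \<le> z 0"
  proof (rule DERIV_nonpos_imp_nonincreasing[OF t])
    fix s assume s: "0 \<le> s" "s \<le> t"
    let ?E = "dirichlet (P s h) (P s h)"
    have "(y has_real_derivative - 2 * ?E) (at s)"
      unfolding y_def[abs_def] by (rule mean_square_has_derivative)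
    then have "((\<lambda>s. ln (y s / m\<^sup>2)) has_real_derivative - 2 * ?E / y s) (at s)"
      using y[OF s(1)] m by (auto intro!: derivative_eq_intros simp: field_simps)
    then have "(z has_real_derivative exp (2 / M * s) * (2 / M * ln (y s / m\<^sup>2) - 2 * ?E / y s)) (at s)"
      unfolding z_def
      by (rule DERIV_cong[OF DERIV_mult[rotated]])
         (use M_pos in \<open>auto intro!: derivative_eq_intros simp: algebra_simps\<close>)
    moreover have "2 / M * ln (y s / m\<^sup>2) \<le> 2 * ?E / y s"
    proof -
      have "y s * ln (y s / m\<^sup>2) \<le> M * ?E"
      proof -
        have p: "0 < P s h x" if "x \<in> cube n" for x
          using that h s(1) by (intro semigroup_pos) auto
        show ?thesis
          using entropy_ge_log_moment_ratio[where g = "P s h", OF p] log_sobolev_dirichlet[where g = "P s h", OF p]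
          unfolding y_def m_def mean_semigroup by linarith
      qed
      then show ?thesis using y[OF s(1)] M_pos by (simp add: field_simps)
    qed
    ultimately show "\<exists>d. (z has_real_derivative d) (at s) \<and> d \<le> 0"
      by (intro exI conjI) (auto simp: mult_le_0_iff)
  qed
  then have "exp (- 2 * t / M) * (exp (2 / M * t) * ln (y t / m\<^sup>2)) \<le> exp (- 2 * t / M) * ln (y 0 / m\<^sup>2)"
    unfolding z_def by simp
  then have "ln (y t / m\<^sup>2) \<le> exp (- 2 * t / M) * ln (y 0 / m\<^sup>2)"
    unfolding mult.assoc[symmetric] exp_add[symmetric] by simp
  then have "exp (ln (y t / m\<^sup>2)) \<le> exp (exp (- 2 * t / M) * ln (y 0 / m\<^sup>2))" by simp
  then have "y t / m\<^sup>2 \<le> exp (exp (- 2 * t / M) * ln (y 0 / m\<^sup>2))"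
    using y[OF t] m by simp
  then have "y t \<le> m\<^sup>2 * exp (exp (- 2 * t / M) * ln (y 0 / m\<^sup>2))"
    using m by (simp add: field_simps)
  then show ?thesis by (simp add: y_def m_def)
qed

lemma hypercontractive_decay:
  assumes h: "\<And>x. x \<in> cube n \<Longrightarrow> 0 \<le> h x" and m: "0 < mean h" and t: "0 \<le> t"
  shows "mean (\<lambda>x. (P t h x)\<^sup>2) \<le> mean (\<lambda>x. (h x)\<^sup>2) *
    exp (- (1 - exp (- 2 * t / M)) * ln (mean (\<lambda>x. (h x)\<^sup>2) / (mean h)\<^sup>2))"
proof -
  define y where "y = mean (\<lambda>x. (h x)\<^sup>2)"
  have y: "0 < y"
    using mean_square_le[of h] m unfolding y_def by (smt (verit) zero_less_power)
  have "mean (\<lambda>x. (P t h x)\<^sup>2) \<le> (mean h)\<^sup>2 * exp (exp (- 2 * t / M) * ln (y / (mean h)\<^sup>2))"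
  proof (rule tendsto_lowerbound)
    let ?Y = "\<lambda>\<epsilon>. y + 2 * \<epsilon> * mean h + \<epsilon>\<^sup>2"
    let ?B = "\<lambda>\<epsilon>. (mean h + \<epsilon>)\<^sup>2 * exp (exp (- 2 * t / M) * ln (?Y \<epsilon> / (mean h + \<epsilon>)\<^sup>2))"
    show "(?B \<longlongrightarrow> (mean h)\<^sup>2 * exp (exp (- 2 * t / M) * ln (y / (mean h)\<^sup>2))) (at_right 0)"
      using y m by (auto intro!: tendsto_eq_intros)
    show "\<forall>\<^sub>F \<epsilon> in at_right 0. mean (\<lambda>x. (P t h x)\<^sup>2) \<le> ?B \<epsilon>"
      using eventually_at_right_less
    proof eventually_elim
      case (elim \<epsilon>)
      have "mean (\<lambda>x. (P t h x)\<^sup>2) \<le> mean (\<lambda>x. (P t (\<lambda>x. h x + \<epsilon>) x)\<^sup>2)"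
        using semigroup_nonneg[of h t, OF h t] elim
        by (intro mean_mono power_mono) (auto simp: semigroup_add)
      also have "\<dots> \<le> (mean (\<lambda>x. h x + \<epsilon>))\<^sup>2 *
          exp (exp (- 2 * t / M) * ln (mean (\<lambda>x. (h x + \<epsilon>)\<^sup>2) / (mean (\<lambda>x. h x + \<epsilon>))\<^sup>2))"
        using h elim by (intro hypercontractive_decay_pos t) (auto intro: add_nonneg_pos)
      also have "mean (\<lambda>x. (h x + \<epsilon>)\<^sup>2) = mean (\<lambda>x. (h x)\<^sup>2 + 2 * \<epsilon> * h x + \<epsilon>\<^sup>2)"
        by (rule mean_cong) (simp add: power2_eq_square algebra_simps)
      also have "\<dots> = ?Y \<epsilon>" unfolding mean_add mean_cmult y_def by simp
      finally show ?case unfolding mean_add by simp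
    qed
  qed simp
  also have "\<dots> = y * exp (- (1 - exp (- 2 * t / M)) * ln (y / (mean h)\<^sup>2))"
  proof -
    have "(mean h)\<^sup>2 * exp (ln (y / (mean h)\<^sup>2)) = y" using y m by simp
    then have "y * exp (- (1 - exp (- 2 * t / M)) * ln (y / (mean h)\<^sup>2)) =
        (mean h)\<^sup>2 * (exp (ln (y / (mean h)\<^sup>2)) * exp (- (1 - exp (- 2 * t / M)) * ln (y / (mean h)\<^sup>2)))"
      by (simp only: mult.assoc[symmetric])
    also have "\<dots> = (mean h)\<^sup>2 * exp (exp (- 2 * t / M) * ln (y / (mean h)\<^sup>2))"
      unfolding exp_add[symmetric] by (simp add: algebra_simps)
    finally show ?thesis ..
  qed
  finally show ?thesis unfolding y_def .
qed

abbreviation c_hyp :: real where "c_hyp \<equiv> hyper_rate b K"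

lemma c_hyp: "0 < c_hyp" "c_hyp < 1"
  using hyper_rate_bounds b K_pos by blast+

lemma hyper_rate_le:
  assumes "0 \<le> t" "t \<le> 1"
  shows "c_hyp * t \<le> 1 - exp (- 2 * t / M)"
proof -
  have "exp ((1 - t) *\<^sub>R 0 + t *\<^sub>R (- 2 / M)) \<le> (1 - t) * exp 0 + t * exp (- 2 / M)"
    using assms by (intro convex_onD[OF exp_convex]) auto
  then show ?thesis by (simp add: hyper_rate_def algebra_simps)
qed

lemma I_star_semigroup_le:
  assumes t: "0 \<le> t"
  shows "I_star n \<mu> (P t f) \<le> exp (4 * \<kappa> * t) * (\<Sum>i\<in>{1..n}. mean (\<lambda>x. (P t (\<lambda>y. \<bar>delta \<mu> i f y\<bar>) x)\<^sup>2))"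
proof -
  have pt: "(\<Sum>i\<in>{1..n}. (delta \<mu> i (P t f) x)\<^sup>2) \<le>
      exp (4 * \<kappa> * t) * (\<Sum>i\<in>{1..n}. (P t (\<lambda>y. \<bar>delta \<mu> i f y\<bar>) x)\<^sup>2)" if x: "x \<in> cube n" for x
  proof -
    have pick: "(\<Sum>y\<in>cube n. (if y = x then 1 else 0) * u y) = u x" for u :: "config \<Rightarrow> real"
      using x by (simp add: if_distrib[of "\<lambda>c. c * _"] cong: if_cong)
    show ?thesis
      using gradient_commutation[of "\<lambda>y. if y = x then 1 else 0" t f] t unfolding pick by simp
  qed
  have "I_star n \<mu> (P t f) = mean (\<lambda>x. \<Sum>i\<in>{1..n}. (delta \<mu> i (P t f) x)\<^sup>2)"
    by (simp add: I_star_eq mean_sum)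
  also have "\<dots> \<le> mean (\<lambda>x. exp (4 * \<kappa> * t) * (\<Sum>i\<in>{1..n}. (P t (\<lambda>y. \<bar>delta \<mu> i f y\<bar>) x)\<^sup>2))"
    by (rule mean_mono) (rule pt)
  finally show ?thesis unfolding mean_cmult mean_sum .
qed

lemma J_star_semigroup_le:
  assumes t: "0 \<le> t"
  shows "J_star n \<mu> (P t f) \<le> exp (4 * \<kappa> * t) * J_star n \<mu> f"
proof -
  have "mean (P t (\<lambda>y. \<bar>delta \<mu> i f y\<bar>)) = coord_L1 \<mu> i f" for i
    by (simp add: mean_semigroup coord_L1_eq)
  then show ?thesis
    using gradient_commutation[of "pmf \<mu>" t f] t
    unfolding mean_def[symmetric] J_star_def coord_L1_eq by (simp add: mean_semigroup)
qed

lemma Var_semigroup_has_derivative: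
  "((\<lambda>t. Var \<mu> (P t f)) has_real_derivative - 2 * dirichlet (P t f) (P t f)) (at t)"
  unfolding variance_eq' mean_semigroup
  by (auto intro!: derivative_eq_intros mean_square_has_derivative)

lemma Var_semigroup_decay:
  assumes t: "0 \<le> t"
  shows "Var \<mu> (P t f) \<le> exp (- t / (2 * M)) * Var \<mu> f"
proof -
  define W where "W s = exp (s / (2 * M)) * Var \<mu> (P s f)" for s
  have "W t \<le> W 0"
  proof (rule DERIV_nonpos_imp_nonincreasing[OF t])
    fix s :: real
    have "(W has_real_derivative exp (s / (2 * M)) *
        (1 / (2 * M) * Var \<mu> (P s f) - 2 * dirichlet (P s f) (P s f))) (at s)"
      unfolding W_def
      by (rule DERIV_cong[OF DERIV_mult[OF _ Var_semigroup_has_derivative]])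
         (use M_pos in \<open>auto intro!: derivative_eq_intros simp: algebra_simps\<close>)
    moreover have "1 / (2 * M) * Var \<mu> (P s f) \<le> 2 * dirichlet (P s f) (P s f)"
      using Poincare[of "P s f"] M_pos by (simp add: field_simps)
    ultimately show "\<exists>d. (W has_real_derivative d) (at s) \<and> d \<le> 0"
      by (intro exI conjI) (auto simp: mult_le_0_iff)
  qed
  then have "exp (- t / (2 * M)) * (exp (t / (2 * M)) * Var \<mu> (P t f)) \<le> exp (- t / (2 * M)) * Var \<mu> f"
    unfolding W_def by simp
  then show ?thesis unfolding mult.assoc[symmetric] exp_add[symmetric] by simp
qed

definition log_ratio :: "(config \<Rightarrow> real) \<Rightarrow> nat \<Rightarrow> real" where
  "log_ratio f i = ln (sqrt (coord_influence \<mu> i f) / coord_L1 \<mu> i f)"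

lemma coord_L1_sq_le: "(coord_L1 \<mu> i f)\<^sup>2 \<le> coord_influence \<mu> i f"
  using mean_square_le[of "\<lambda>x. \<bar>delta \<mu> i f x\<bar>"] by (simp add: coord_L1_eq coord_influence_eq)

lemma coord_L1_eq_0:
  assumes "i \<in> {1..n}" "coord_L1 \<mu> i f = 0"
  shows "coord_influence \<mu> i f = 0" "\<And>x. x \<in> cube n \<Longrightarrow> \<bar>delta \<mu> i f x\<bar> = 0"
proof -
  have "\<forall>x\<in>cube n. \<bar>delta \<mu> i f x\<bar> = 0"
    using assms(2) unfolding coord_L1_eq by (subst (asm) mean_eq_0_iff) auto
  then show "\<And>x. x \<in> cube n \<Longrightarrow> \<bar>delta \<mu> i f x\<bar> = 0" by blast
  then show "coord_influence \<mu> i f = 0"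
    unfolding coord_influence_eq by (subst mean_eq_0_iff) auto
qed

lemma log_ratio_nonneg: "0 \<le> log_ratio f i"
proof (cases "coord_L1 \<mu> i f = 0")
  case False
  then have "0 < coord_L1 \<mu> i f" using coord_L1_nonneg[of i f] by simp
  moreover have "coord_L1 \<mu> i f \<le> sqrt (coord_influence \<mu> i f)"
    by (rule real_le_rsqrt) (rule coord_L1_sq_le)
  ultimately show ?thesis by (simp add: log_ratio_def)
qed (simp add: log_ratio_def)

text \<open>
  For \<open>t \<le> 1\<close> the exponent of the decay is at least linear in \<open>t\<close>. The additional \<open>1\<close> in the decay rate,
  compensated by the factor \<open>exp 1\<close>, keeps the rate positive when the logarithm vanishes.
\<close>

lemma gradient_decay:
  assumes i: "i \<in> {1..n}" and t: "0 \<le> t" "t \<le> 1"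
  shows "mean (\<lambda>x. (P t (\<lambda>y. \<bar>delta \<mu> i f y\<bar>) x)\<^sup>2) \<le>
    exp 1 * coord_influence \<mu> i f * exp (- (1 + 2 * c_hyp * log_ratio f i) * t)"
proof (cases "coord_L1 \<mu> i f = 0")
  case True
  have "P t (\<lambda>y. \<bar>delta \<mu> i f y\<bar>) x = 0" if "x \<in> cube n" for x
    using semigroup_cong[of "\<lambda>y. \<bar>delta \<mu> i f y\<bar>" "\<lambda>_. 0" x t] coord_L1_eq_0(2)[OF i True] that by simp
  then have "mean (\<lambda>x. (P t (\<lambda>y. \<bar>delta \<mu> i f y\<bar>) x)\<^sup>2) = 0"
    by (subst mean_eq_0_iff) auto
  then show ?thesis using coord_L1_eq_0(1)[OF i True] by simp
next
  case False
  let ?I = "coord_influence \<mu> i f" and ?a = "coord_L1 \<mu> i f" and ?l = "log_ratio f i"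
  have a: "0 < ?a" using False coord_L1_nonneg[of i f] by simp
  have I: "0 < ?I" using coord_L1_sq_le[of i f] a by (smt (verit) zero_less_power)
  have ratio: "ln (?I / ?a\<^sup>2) = 2 * ?l"
    unfolding log_ratio_def using a I by (simp add: ln_div ln_realpow ln_sqrt)
  have "mean (\<lambda>x. (P t (\<lambda>y. \<bar>delta \<mu> i f y\<bar>) x)\<^sup>2) \<le> ?I * exp (- (1 - exp (- 2 * t / M)) * (2 * ?l))"
    using hypercontractive_decay[of "\<lambda>y. \<bar>delta \<mu> i f y\<bar>" t] a t
    unfolding coord_L1_eq[symmetric] power2_abs coord_influence_eq[symmetric] ratio by simp
  also have "\<dots> \<le> ?I * exp (1 - (1 + 2 * c_hyp * ?l) * t)"
  proof -
    have "c_hyp * t * (2 * ?l) \<le> (1 - exp (- 2 * t / M)) * (2 * ?l)"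
      using hyper_rate_le[OF t] log_ratio_nonneg by (intro mult_right_mono) auto
    then have "- (1 - exp (- 2 * t / M)) * (2 * ?l) \<le> 1 - (1 + 2 * c_hyp * ?l) * t"
      using t by (simp add: algebra_simps)
    then show ?thesis using I by simp
  qed
  also have "\<dots> = exp 1 * ?I * exp (- (1 + 2 * c_hyp * ?l) * t)"
  proof -
    have "exp (1 - (1 + 2 * c_hyp * ?l) * t) = exp 1 * exp (- (1 + 2 * c_hyp * ?l) * t)"
      unfolding exp_add[symmetric] by (simp add: algebra_simps)
    then show ?thesis by simp
  qed
  finally show ?thesis .
qed

text \<open>
  By the Poincare inequality a fixed fraction of the variance is lost in unit time, and the loss is
  the integral of the energy of \<open>P t f\<close>. Gradient commutation and decay bound this energy by a sum of
  exponentials, whose integrals are the terms on the right-hand side.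
\<close>

theorem L1_L2_inequality:
  "L1_L2_const b \<kappa> K * Var \<mu> f \<le> (\<Sum>i\<in>{1..n}. coord_influence \<mu> i f / (1 + log_ratio f i))"
proof -
  let ?I = "\<lambda>i. coord_influence \<mu> i f"
  define r where "r i = 1 + 2 * c_hyp * log_ratio f i" for i
  have r: "1 \<le> r i" for i
    unfolding r_def using log_ratio_nonneg[of f i] c_hyp by simp
  \<comment> \<open>\<open>2 / b\<close> compares energy and influence, \<open>exp (4 \<kappa>)\<close> is the commutation loss up to time \<open>1\<close>.\<close>
  define c where "c = 2 / b * exp (4 * \<kappa> + 1)"
  have c: "0 < c" using b by (simp add: c_def)
  define \<Psi> where "\<Psi> t = Var \<mu> (P t f) + c * (\<Sum>i\<in>{1..n}. ?I i * ((1 - exp (- r i * t)) / r i))" for t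
  have "\<Psi> 0 \<le> \<Psi> 1"
  proof (rule DERIV_nonneg_imp_nondecreasing[of 0 1])
    fix t :: real assume t: "0 \<le> t" "t \<le> 1"
    have "((\<lambda>t. \<Sum>i\<in>{1..n}. ?I i * ((1 - exp (- r i * t)) / r i)) has_real_derivative
        (\<Sum>i\<in>{1..n}. ?I i * exp (- r i * t))) (at t)"
    proof (rule DERIV_sum)
      fix i
      show "((\<lambda>t. ?I i * ((1 - exp (- r i * t)) / r i)) has_real_derivative ?I i * exp (- r i * t)) (at t)"
        using r[of i] by (auto intro!: derivative_eq_intros)
    qed
    then have "(\<Psi> has_real_derivative - 2 * dirichlet (P t f) (P t f) + c * (\<Sum>i\<in>{1..n}. ?I i * exp (- r i * t))) (at t)"
      unfolding \<Psi>_def by (intro DERIV_add DERIV_cmult Var_semigroup_has_derivative)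
    moreover have "2 * dirichlet (P t f) (P t f) \<le> c * (\<Sum>i\<in>{1..n}. ?I i * exp (- r i * t))"
    proof -
      have "2 * dirichlet (P t f) (P t f) \<le> 2 / b * I_star n \<mu> (P t f)"
        using dirichlet_vs_I_star(2)[of "P t f"] by simp
      also have "\<dots> \<le> 2 / b * (exp (4 * \<kappa> * t) * (\<Sum>i\<in>{1..n}. mean (\<lambda>x. (P t (\<lambda>y. \<bar>delta \<mu> i f y\<bar>) x)\<^sup>2)))"
        using b t by (intro mult_left_mono I_star_semigroup_le) auto
      also have "\<dots> \<le> 2 / b * (exp (4 * \<kappa>) * (\<Sum>i\<in>{1..n}. exp 1 * ?I i * exp (- r i * t)))"
        unfolding r_def using b t curv_bound_nonneg
        by (intro mult_left_mono mult_mono sum_mono gradient_decay sum_nonneg mean_nonneg) (auto simp: mult_left_le)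
      also have "\<dots> = c * (\<Sum>i\<in>{1..n}. ?I i * exp (- r i * t))"
        unfolding c_def by (simp add: exp_add sum_distrib_left mult_ac)
      finally show ?thesis .
    qed
    ultimately show "\<exists>d. (\<Psi> has_real_derivative d) (at t) \<and> 0 \<le> d"
      by (intro exI conjI) auto
  qed simp
  moreover have "\<Psi> 0 = Var \<mu> f" by (simp add: \<Psi>_def)
  moreover have "\<Psi> 1 \<le> exp (- 1 / (2 * M)) * Var \<mu> f + c * (\<Sum>i\<in>{1..n}. ?I i / (1 + log_ratio f i) / c_hyp)"
    unfolding \<Psi>_def
  proof (intro add_mono mult_left_mono sum_mono)
    show "Var \<mu> (P 1 f) \<le> exp (- 1 / (2 * M)) * Var \<mu> f"
      using Var_semigroup_decay[of 1 f] by simp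
    fix i
    have "c_hyp * (1 + log_ratio f i) \<le> r i"
      unfolding r_def using mult_nonneg_nonneg[OF less_imp_le[OF c_hyp(1)] log_ratio_nonneg[of f i]] c_hyp
      by (simp add: algebra_simps)
    moreover have "0 < c_hyp * (1 + log_ratio f i)"
      using log_ratio_nonneg[of f i] c_hyp by simp
    ultimately have "1 / r i \<le> 1 / (c_hyp * (1 + log_ratio f i))"
      by (intro divide_left_mono) (auto intro: mult_pos_pos)
    moreover have "(1 - exp (- r i * 1)) / r i \<le> 1 / r i"
      using r[of i] by (intro divide_right_mono) auto
    ultimately have "?I i * ((1 - exp (- r i * 1)) / r i) \<le> ?I i * (1 / (c_hyp * (1 + log_ratio f i)))"
      using coord_influence_nonneg by (intro mult_left_mono) auto
    then show "?I i * ((1 - exp (- r i * 1)) / r i) \<le> ?I i / (1 + log_ratio f i) / c_hyp"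
      by (simp add: mult.commute)
  qed (use c in auto)
  ultimately have "(1 - exp (- 1 / (2 * M))) * Var \<mu> f \<le> c * (\<Sum>i\<in>{1..n}. ?I i / (1 + log_ratio f i) / c_hyp)"
    by (simp add: algebra_simps)
  also have "\<dots> = c / c_hyp * (\<Sum>i\<in>{1..n}. ?I i / (1 + log_ratio f i))"
    unfolding sum_divide_distrib[symmetric] by simp
  finally have "c_hyp / c * ((1 - exp (- 1 / (2 * M))) * Var \<mu> f) \<le>
      c_hyp / c * (c / c_hyp * (\<Sum>i\<in>{1..n}. ?I i / (1 + log_ratio f i)))"
    using c c_hyp by (intro mult_left_mono) auto
  moreover have "c_hyp / c * ((1 - exp (- 1 / (2 * M))) * Var \<mu> f) = L1_L2_const b \<kappa> K * Var \<mu> f"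
    unfolding c_def L1_L2_const_def using b by (simp add: field_simps)
  ultimately show ?thesis using c c_hyp by simp
qed

text \<open>
  The norm of the mean is at most the mean of the norm, by pairing with the vector of \<open>L1\<close> influences.
\<close>

lemma J_star_le_A_star_sq: "J_star n \<mu> f \<le> (A_star n \<mu> f)\<^sup>2"
proof -
  define N where "N = sqrt (J_star n \<mu> f)"
  have N: "0 \<le> N" "N\<^sup>2 = J_star n \<mu> f" using J_star_nonneg[of f] by (auto simp: N_def)
  have "N\<^sup>2 = mean (\<lambda>x. \<Sum>i\<in>{1..n}. coord_L1 \<mu> i f * \<bar>delta \<mu> i f x\<bar>)"
    unfolding N(2) J_star_def mean_sum mean_cmult coord_L1_eq[symmetric] by (simp add: power2_eq_square)
  also have "\<dots> \<le> mean (\<lambda>x. N * sqrt (Gamma_star n \<mu> f x))"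
  proof (rule mean_mono)
    fix x
    have "(\<Sum>i\<in>{1..n}. coord_L1 \<mu> i f * \<bar>delta \<mu> i f x\<bar>) =
        (\<Sum>i\<in>{1..n}. \<bar>coord_L1 \<mu> i f\<bar> * \<bar>delta \<mu> i f x\<bar>)"
      by (simp add: coord_L1_nonneg)
    also have "\<dots> \<le> L2_set (\<lambda>i. coord_L1 \<mu> i f) {1..n} * L2_set (\<lambda>i. delta \<mu> i f x) {1..n}"
      by (rule L2_set_mult_ineq)
    finally show "(\<Sum>i\<in>{1..n}. coord_L1 \<mu> i f * \<bar>delta \<mu> i f x\<bar>) \<le> N * sqrt (Gamma_star n \<mu> f x)"
      by (simp add: L2_set_def N_def J_star_def Gamma_star_def)
  qed
  also have "\<dots> = N * A_star n \<mu> f" unfolding mean_cmult A_star_eq ..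
  finally have "N * N \<le> A_star n \<mu> f * N" by (simp add: power2_eq_square mult.commute)
  then have "N \<le> A_star n \<mu> f"
    using N A_star_nonneg[of f] by (cases "N = 0") (auto simp: mult_le_cancel_right)
  then have "N\<^sup>2 \<le> (A_star n \<mu> f)\<^sup>2" using N by (intro power_mono) auto
  then show ?thesis using N by simp
qed

lemma J_star_le_I_star: "J_star n \<mu> f \<le> I_star n \<mu> f"
  unfolding J_star_def I_star_def by (intro sum_mono coord_L1_sq_le)

lemma I_star_eq_0:
  assumes "J_star n \<mu> f = 0" shows "I_star n \<mu> f = 0"
proof -
  have "\<forall>i\<in>{1..n}. (coord_L1 \<mu> i f)\<^sup>2 = 0"
    using assms unfolding J_star_def by (subst (asm) sum_nonneg_eq_0_iff) auto
  then show ?thesis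
    unfolding I_star_def using coord_L1_eq_0(1) by (intro sum.neutral) auto
qed

lemma Var_le_I_star: "Var \<mu> f \<le> 4 * M / b * I_star n \<mu> f"
proof -
  have "Var \<mu> f \<le> 4 * M * dirichlet f f" by (rule Poincare)
  also have "\<dots> \<le> 4 * M * (I_star n \<mu> f / b)"
    using dirichlet_vs_I_star(2)[of f] M_pos by (intro mult_left_mono) auto
  finally show ?thesis by simp
qed

text \<open>
  In the sum of the \<open>L1\<close>-\<open>L2\<close> inequality, the coordinates whose ratio of \<open>L2\<close> to squared \<open>L1\<close> influence
  exceeds \<open>sqrt R\<close> gain the full logarithm of \<open>R\<close>; the others contribute at most \<open>sqrt R * J = I / sqrt R\<close>
  in total, where \<open>I\<close> and \<open>J\<close> are the two sums of influences and \<open>R = I / J\<close>.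
\<close>

lemma I_star_ge_log_ratio:
  assumes J: "0 < J_star n \<mu> f"
  shows "L1_L2_const b \<kappa> K * Var \<mu> f * (1 + ln (I_star n \<mu> f / J_star n \<mu> f)) \<le> 6 * I_star n \<mu> f"
proof -
  let ?I = "I_star n \<mu> f" and ?J = "J_star n \<mu> f"
  define R where "R = ?I / ?J"
  have R: "1 \<le> R" using J J_star_le_I_star[of f] by (simp add: R_def)
  have lR: "0 \<le> ln R" using R by simp
  have "L1_L2_const b \<kappa> K * Var \<mu> f \<le> (\<Sum>i\<in>{1..n}. coord_influence \<mu> i f / (1 + log_ratio f i))"
    by (rule L1_L2_inequality)
  also have "\<dots> \<le> (\<Sum>i\<in>{1..n}. 4 / (1 + ln R) * coord_influence \<mu> i f + sqrt R * (coord_L1 \<mu> i f)\<^sup>2)"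
  proof (rule sum_mono)
    fix i assume i: "i \<in> {1..n}"
    let ?c = "coord_influence \<mu> i f" and ?a = "coord_L1 \<mu> i f" and ?l = "log_ratio f i"
    have l: "0 \<le> ?l" by (rule log_ratio_nonneg)
    have c: "0 \<le> ?c" by (rule coord_influence_nonneg)
    show "?c / (1 + ?l) \<le> 4 / (1 + ln R) * ?c + sqrt R * ?a\<^sup>2"
    proof (cases "?c \<le> sqrt R * ?a\<^sup>2")
      case True
      have "?c / (1 + ?l) \<le> ?c" using l c by (simp add: divide_le_eq mult_left_mono algebra_simps)
      moreover have "0 \<le> 4 / (1 + ln R) * ?c" using lR c by simp
      ultimately show ?thesis using True by linarith
    next
      case False
      then have big: "sqrt R * ?a\<^sup>2 < ?c" by simp
      have c0: "0 < ?c" using big R by (smt (verit) mult_nonneg_nonneg real_sqrt_ge_zero zero_le_power2)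
      then have a: "0 < ?a" using coord_L1_eq_0(1)[OF i, of f] coord_L1_nonneg[of i f] by fastforce
      have "ln (sqrt R * ?a\<^sup>2) \<le> ln ?c" using big a R by (intro ln_mono) auto
      then have "1 / 4 * ln R \<le> ?l"
        unfolding log_ratio_def using a c0 R by (simp add: ln_mult ln_div ln_realpow ln_sqrt)
      then have "(1 + ln R) / 4 \<le> 1 + ?l" unfolding add_divide_distrib by simp
      then have "?c / (1 + ?l) \<le> ?c / ((1 + ln R) / 4)"
        using c lR l by (intro divide_left_mono mult_pos_pos) auto
      moreover have "0 \<le> sqrt R * ?a\<^sup>2" using R by simp
      moreover have "?c / ((1 + ln R) / 4) = 4 / (1 + ln R) * ?c" by simp
      ultimately show ?thesis by linarith
    qed
  qed
  also have "\<dots> = 4 / (1 + ln R) * ?I + sqrt R * ?J"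
    by (simp only: sum.distrib sum_distrib_left I_star_def J_star_def)
  also have "sqrt R * ?J \<le> 2 / (1 + ln R) * ?I"
  proof -
    have "exp (- (ln R / 2)) \<le> 1 / (1 + ln R / 2)" using lR by (intro exp_minus_le_inverse) auto
    also have "\<dots> \<le> 2 / (1 + ln R)" using lR by (simp add: field_simps)
    finally have "exp (- (ln R / 2)) * ?I \<le> 2 / (1 + ln R) * ?I"
      by (intro mult_right_mono I_star_nonneg)
    moreover have "exp (- (ln R / 2)) * ?I = sqrt R * ?J"
    proof -
      define s where "s = sqrt R"
      have "0 < s" "R = s * s" using R by (auto simp: s_def)
      moreover have "exp (- (ln R / 2)) = 1 / s"
        unfolding s_def using R by (simp add: exp_minus inverse_eq_divide ln_sqrt[symmetric])
      moreover have "?I = R * ?J" using J by (simp add: R_def)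
      ultimately show ?thesis unfolding s_def[symmetric] by simp
    qed
    ultimately show ?thesis by simp
  qed
  finally have "L1_L2_const b \<kappa> K * Var \<mu> f \<le> 6 * ?I / (1 + ln R)"
    by (simp add: add_divide_distrib[symmetric])
  then show ?thesis using lR by (simp add: R_def pos_le_divide_eq)
qed

lemma total_influence_ge_J:
  assumes C: "0 \<le> C" "C \<le> b * L1_L2_const b \<kappa> K / 6"
  shows "C * Var \<mu> f * (1 + ln (I_star n \<mu> f / J_star n \<mu> f)) \<le> total_influence n \<mu> f"
proof (cases "J_star n \<mu> f = 0")
  case True
  then have "Var \<mu> f = 0"
    using Var_le_I_star[of f] I_star_eq_0 Var_nonneg[of f] by simp
  then show ?thesis using dirichlet_nonneg by (simp add: total_influence_eq)
next
  case False
  then have J: "0 < J_star n \<mu> f" using J_star_nonneg[of f] by simp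
  let ?X = "Var \<mu> f * (1 + ln (I_star n \<mu> f / J_star n \<mu> f))"
  have "0 \<le> ln (I_star n \<mu> f / J_star n \<mu> f)" using J J_star_le_I_star[of f] by simp
  then have X: "0 \<le> ?X" using Var_nonneg[of f] by (intro mult_nonneg_nonneg) auto
  have "C * ?X \<le> b * L1_L2_const b \<kappa> K / 6 * ?X" using C X by (intro mult_right_mono) auto
  also have "\<dots> \<le> b * I_star n \<mu> f"
    using mult_left_mono[OF I_star_ge_log_ratio[OF J], of "b / 6"] b by (simp add: mult_ac)
  also have "\<dots> \<le> total_influence n \<mu> f"
    unfolding total_influence_eq by (rule dirichlet_vs_I_star)
  finally show ?thesis by (simp add: mult.assoc)
qed

lemma total_influence_ge_A:
  assumes C: "0 \<le> C" "C \<le> b * L1_L2_const b \<kappa> K / 6"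
  shows "C * Var \<mu> f * (1 + ln (I_star n \<mu> f / (A_star n \<mu> f)\<^sup>2)) \<le> total_influence n \<mu> f"
proof (cases "J_star n \<mu> f = 0")
  case True
  then have "Var \<mu> f = 0"
    using Var_le_I_star[of f] I_star_eq_0 Var_nonneg[of f] by simp
  then show ?thesis using dirichlet_nonneg by (simp add: total_influence_eq)
next
  case False
  then have J: "0 < J_star n \<mu> f" using J_star_nonneg[of f] by simp
  have I: "0 < I_star n \<mu> f" using J J_star_le_I_star[of f] by simp
  have A: "0 < (A_star n \<mu> f)\<^sup>2" using J J_star_le_A_star_sq[of f] by linarith
  have "I_star n \<mu> f / (A_star n \<mu> f)\<^sup>2 \<le> I_star n \<mu> f / J_star n \<mu> f"
    using I J A J_star_le_A_star_sq[of f] by (intro divide_left_mono mult_pos_pos) auto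
  then have "ln (I_star n \<mu> f / (A_star n \<mu> f)\<^sup>2) \<le> ln (I_star n \<mu> f / J_star n \<mu> f)"
    using I A J by (intro ln_mono) auto
  then have "C * Var \<mu> f * (1 + ln (I_star n \<mu> f / (A_star n \<mu> f)\<^sup>2)) \<le>
      C * Var \<mu> f * (1 + ln (I_star n \<mu> f / J_star n \<mu> f))"
    using C Var_nonneg[of f] by (intro mult_left_mono) auto
  also have "\<dots> \<le> total_influence n \<mu> f" by (rule total_influence_ge_J[OF C])
  finally show ?thesis .
qed

section \<open>The KKL inequalities\<close>

lemma mean_sign_square:
  assumes "\<And>x. x \<in> cube n \<Longrightarrow> f x \<in> {-1, 1}"
  shows "mean (\<lambda>x. (f x)\<^sup>2) = 1"
proof -
  have "mean (\<lambda>x. (f x)\<^sup>2) = mean (\<lambda>_. 1)"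
    using assms by (intro mean_cong) fastforce
  then show ?thesis by simp
qed

text \<open>
  A nonzero derivative of a sign function is at least \<open>b\<close> in modulus, so \<open>L1\<close> influences are at most
  \<open>1 / b\<close> times \<open>L2\<close> influences and every logarithm in the \<open>L1\<close>-\<open>L2\<close> inequality is at least
  \<open>ln (1 / max) / 2 - ln (1 / b)\<close>.
\<close>

lemma KKL_influence_sum:
  assumes f: "\<And>x. x \<in> cube n \<Longrightarrow> f x \<in> {-1, 1}"
    and C: "0 \<le> C" "C \<le> L1_L2_const b \<kappa> K / (2 * (1 + ln (1 / b)))"
  shows "C * ln (1 / M_star n \<mu> f) * Var \<mu> f \<le> I_star n \<mu> f"
proof -
  define B where "B = ln (1 / b)"
  define \<Lambda> where "\<Lambda> = ln (1 / M_star n \<mu> f)"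
  have B: "0 \<le> B" using b by (simp add: B_def)
  show ?thesis
  proof (cases "0 < \<Lambda>")
    case False
    then have "C * \<Lambda> * Var \<mu> f \<le> 0"
      using C Var_nonneg[of f] by (intro mult_nonpos_nonneg mult_nonneg_nonpos) auto
    then show ?thesis using I_star_nonneg[of f] unfolding \<Lambda>_def by linarith
  next
    case True
    have max: "coord_influence \<mu> i f \<le> M_star n \<mu> f" if "i \<in> {1..n}" for i
      unfolding M_star_def using that by (intro Max_ge) auto
    have Mpos: "0 < M_star n \<mu> f"
    proof -
      have "M_star n \<mu> f \<noteq> 0" using True by (auto simp: \<Lambda>_def)
      moreover have "0 \<le> M_star n \<mu> f"
        using max[of 1] coord_influence_nonneg[of 1 f] dim by auto
      ultimately show ?thesis by simp
    qed
    have term_le: "coord_influence \<mu> i f / (1 + log_ratio f i) \<le> 2 * (1 + B) / \<Lambda> * coord_influence \<mu> i f"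
      if i: "i \<in> {1..n}" for i
    proof (cases "coord_influence \<mu> i f = 0")
      case False
      let ?c = "coord_influence \<mu> i f" and ?a = "coord_L1 \<mu> i f" and ?l = "log_ratio f i"
      have c: "0 < ?c" using False coord_influence_nonneg[of i f] by simp
      have a: "0 < ?a" using False coord_L1_eq_0(1)[OF i, of f] coord_L1_nonneg[of i f] by fastforce
      have "b * ?a \<le> ?c"
        unfolding coord_L1_eq coord_influence_eq mean_cmult[symmetric]
      proof (rule mean_mono)
        fix x assume x: "x \<in> cube n"
        have "f x \<in> {-1, 1}" "f (flip i x) \<in> {-1, 1}" using f x i by auto
        then have "f (flip i x) - f x = 0 \<or> \<bar>f (flip i x) - f x\<bar> = 2" by auto
        then show "b * \<bar>delta \<mu> i f x\<bar> \<le> (delta \<mu> i f x)\<^sup>2"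
        proof
          assume two: "\<bar>f (flip i x) - f x\<bar> = 2"
          have "\<bar>delta \<mu> i f x\<bar> = 2 * q i x"
            using rate_bounds(3)[OF x i] by (simp add: delta_def abs_mult two)
          then have "b \<le> \<bar>delta \<mu> i f x\<bar>" using rate_bounds(1)[OF x i] by simp
          then have "b * \<bar>delta \<mu> i f x\<bar> \<le> \<bar>delta \<mu> i f x\<bar> * \<bar>delta \<mu> i f x\<bar>"
            by (intro mult_right_mono) auto
          then show ?thesis by (simp add: power2_eq_square)
        qed (simp add: delta_def)
      qed
      then have "ln (b * ?a) \<le> ln ?c" using a b by (intro ln_mono) auto
      then have 1: "ln ?a \<le> ln ?c + B" using a b by (simp add: ln_mult B_def ln_div)
      have "ln ?c \<le> ln (M_star n \<mu> f)" using c max[OF i] by (intro ln_mono) auto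
      then have 2: "\<Lambda> \<le> - ln ?c" unfolding \<Lambda>_def using Mpos by (simp add: ln_div)
      have "?l = 1 / 2 * ln ?c - ln ?a"
        unfolding log_ratio_def using a c by (simp add: ln_div ln_sqrt)
      then have "\<Lambda> / 2 - B \<le> ?l" using 1 2 by linarith
      moreover have "0 \<le> B * ?l" using B log_ratio_nonneg by (intro mult_nonneg_nonneg)
      ultimately have "\<Lambda> / 2 \<le> (1 + B) * (1 + ?l)" by (simp add: algebra_simps)
      then have "1 / (1 + ?l) \<le> 2 * (1 + B) / \<Lambda>"
        using True log_ratio_nonneg[of f i] by (simp add: field_simps)
      then have "1 / (1 + ?l) * ?c \<le> 2 * (1 + B) / \<Lambda> * ?c" using c by (intro mult_right_mono) auto
      then show ?thesis by simp
    qed simp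
    have "L1_L2_const b \<kappa> K * Var \<mu> f \<le> (\<Sum>i\<in>{1..n}. coord_influence \<mu> i f / (1 + log_ratio f i))"
      by (rule L1_L2_inequality)
    also have "\<dots> \<le> (\<Sum>i\<in>{1..n}. 2 * (1 + B) / \<Lambda> * coord_influence \<mu> i f)"
      by (intro sum_mono term_le)
    also have "\<dots> = 2 * (1 + B) / \<Lambda> * I_star n \<mu> f"
      by (simp only: I_star_def sum_distrib_left)
    finally have "\<Lambda> / (2 * (1 + B)) * (L1_L2_const b \<kappa> K * Var \<mu> f) \<le>
        \<Lambda> / (2 * (1 + B)) * (2 * (1 + B) / \<Lambda> * I_star n \<mu> f)"
      using True B by (intro mult_left_mono) auto
    then have "L1_L2_const b \<kappa> K / (2 * (1 + B)) * (\<Lambda> * Var \<mu> f) \<le> I_star n \<mu> f"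
      using True B by (simp add: mult_ac)
    moreover have "C * (\<Lambda> * Var \<mu> f) \<le> L1_L2_const b \<kappa> K / (2 * (1 + B)) * (\<Lambda> * Var \<mu> f)"
      using C(2) True Var_nonneg[of f] unfolding B_def by (intro mult_right_mono mult_nonneg_nonneg) auto
    ultimately show ?thesis unfolding \<Lambda>_def by (simp add: mult.assoc)
  qed
qed

text \<open>
  Either the largest influence exceeds \<open>1 / sqrt n\<close>, which is more than enough, or the logarithm in the
  preceding lemma is at least half of \<open>ln n\<close> and the largest influence dominates the average one.
\<close>

lemma KKL_max_influence:
  assumes f: "\<And>x. x \<in> cube n \<Longrightarrow> f x \<in> {-1, 1}"
    and C: "0 \<le> C" "C \<le> 1 / 2" "2 * C \<le> L1_L2_const b \<kappa> K / (2 * (1 + ln (1 / b)))"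
  shows "C * (ln (real n) / real n) * Var \<mu> f \<le> M_star n \<mu> f"
proof -
  let ?M = "M_star n \<mu> f"
  have n: "1 \<le> real n" using dim by simp
  have max: "coord_influence \<mu> i f \<le> ?M" if "i \<in> {1..n}" for i
    unfolding M_star_def using that by (intro Max_ge) auto
  have M0: "0 \<le> ?M" using max[of 1] coord_influence_nonneg[of 1 f] dim by auto
  have I_le: "I_star n \<mu> f \<le> real n * ?M"
    unfolding I_star_def using sum_bounded_above[of "{1..n}" "\<lambda>i. coord_influence \<mu> i f" ?M] max by simp
  have V1: "Var \<mu> f \<le> 1"
    using mean_sign_square[of f] f zero_le_power2[of "mean f"] unfolding variance_eq' by simp
  show ?thesis
  proof (cases "1 / sqrt (real n) \<le> ?M")
    case True
    have "ln (sqrt (real n)) \<le> sqrt (real n) - 1" using n by (intro ln_le_minus_one) auto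
    then have "ln (real n) \<le> 2 * sqrt (real n)" using n by (simp add: ln_sqrt)
    then have "ln (real n) / real n \<le> 2 * sqrt (real n) / real n" using n by (intro divide_right_mono) auto
    also have "\<dots> = 2 * (1 / sqrt (real n))" using n by (simp add: field_simps)
    finally have 1: "ln (real n) / real n \<le> 2 * ?M" using True by linarith
    have "C * (ln (real n) / real n) * Var \<mu> f \<le> 1 / 2 * (2 * ?M) * 1"
      using C V1 Var_nonneg[of f] n M0 1 by (intro mult_mono) auto
    then show ?thesis by simp
  next
    case small: False
    show ?thesis
    proof (cases "?M = 0")
      case True
      then have "I_star n \<mu> f = 0" using I_le I_star_nonneg[of f] by simp
      then have "Var \<mu> f = 0" using Var_le_I_star[of f] Var_nonneg[of f] by simp
      then show ?thesis using True by simp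
    next
      case False
      then have Mp: "0 < ?M" using M0 by simp
      have "ln ?M \<le> ln (1 / sqrt (real n))" using small Mp by (intro ln_mono) auto
      then have "ln (real n) / 2 \<le> ln (1 / ?M)" using n Mp by (simp add: ln_div ln_sqrt)
      then have "2 * C * (ln (real n) / 2) * Var \<mu> f \<le> 2 * C * ln (1 / ?M) * Var \<mu> f"
        using C Var_nonneg[of f] by (intro mult_right_mono mult_left_mono) auto
      also have "\<dots> \<le> I_star n \<mu> f" using C by (intro KKL_influence_sum f) auto
      also have "\<dots> \<le> real n * ?M" by (rule I_le)
      finally show ?thesis using n by (simp add: field_simps)
    qed
  qed
qed

end

section \<open>The surface-area inequalities of Talagrand and Eldan-Gross\<close>

text \<open>
  The constants of the surface-area inequalities. The rate is strictly below \<open>- 2 \<kappa>\<close>, so it is negative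
  also when \<open>\<kappa> = 0\<close>; \<open>gamma_slope\<close> is the slope of a linear upper bound for \<open>\<gamma>\<close> on the unit interval.
  For \<open>J\<close> at most \<open>J_threshold\<close> times the squared variance, half of the variance is lost by the time
  \<open>decay_time\<close> divided by \<open>ln (1 / J)\<close>.
\<close>

definition bobkov_rate :: "real \<Rightarrow> real" where
  "bobkov_rate \<kappa> = - (2 * \<kappa> + 1)"

definition gamma_slope :: "real \<Rightarrow> real \<Rightarrow> real" where
  "gamma_slope b \<kappa> = 4 * exp (- 2 * bobkov_rate \<kappa>) / b"

definition small_set_gap :: "real \<Rightarrow> real \<Rightarrow> real" where
  "small_set_gap b K = 1 - exp (- (hyper_rate b K / 2) * ln 2)"

definition Talagrand_const :: "real \<Rightarrow> real \<Rightarrow> real \<Rightarrow> real" where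
  "Talagrand_const b \<kappa> K = profile_const * (small_set_gap b K)\<^sup>2 * sqrt (hyper_rate b K / 2)
    / (2 * sqrt (gamma_slope b \<kappa>))"

definition decay_time :: "real \<Rightarrow> real \<Rightarrow> real \<Rightarrow> real" where
  "decay_time b \<kappa> K = max 1 (6 / (b * L1_L2_const b \<kappa> K))"

definition J_threshold :: "real \<Rightarrow> real \<Rightarrow> real \<Rightarrow> real" where
  "J_threshold b \<kappa> K = min (exp (- decay_time b \<kappa> K)) ((b / (8 * heat_lsi b K * exp (4 * \<kappa>)))\<^sup>2)"

definition Eldan_Gross_const :: "real \<Rightarrow> real \<Rightarrow> real \<Rightarrow> real" where
  "Eldan_Gross_const b \<kappa> K = 1 / 2 * min (Talagrand_const b \<kappa> K / sqrt (2 + ln (1 / J_threshold b \<kappa> K)))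
    (profile_const / (2 * sqrt (3 * gamma_slope b \<kappa> * decay_time b \<kappa> K)))"

lemma gamma_slope_pos: "0 < b \<Longrightarrow> 0 < gamma_slope b \<kappa>"
  by (simp add: gamma_slope_def)

lemma small_set_gap_bounds:
  assumes "0 < b" "0 < K" shows "0 < small_set_gap b K" "small_set_gap b K \<le> 1"
  using hyper_rate_bounds(1)[OF assms] by (auto simp: small_set_gap_def)

lemma Talagrand_const_pos: "0 < b \<Longrightarrow> 0 < K \<Longrightarrow> 0 < Talagrand_const b \<kappa> K"
  unfolding Talagrand_const_def
  by (intro divide_pos_pos mult_pos_pos zero_less_power)
     (auto simp: profile_const_pos small_set_gap_bounds hyper_rate_bounds gamma_slope_pos)

lemma decay_time_ge: "1 \<le> decay_time b \<kappa> K"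
  by (simp add: decay_time_def)

lemma J_threshold_bounds:
  assumes "0 < b" "0 < K"
  shows "0 < J_threshold b \<kappa> K" "J_threshold b \<kappa> K \<le> 1"
    "J_threshold b \<kappa> K \<le> exp (- decay_time b \<kappa> K)"
proof -
  show "J_threshold b \<kappa> K \<le> exp (- decay_time b \<kappa> K)" by (simp add: J_threshold_def)
  also have "\<dots> \<le> 1" using decay_time_ge[of b \<kappa> K] by simp
  finally show "J_threshold b \<kappa> K \<le> 1" .
  show "0 < J_threshold b \<kappa> K"
    using assms heat_lsi_pos[OF assms] by (auto simp: J_threshold_def)
qed

lemma Eldan_Gross_const_pos:
  assumes "0 < b" "0 < K" shows "0 < Eldan_Gross_const b \<kappa> K"
proof -
  have "0 \<le> ln (1 / J_threshold b \<kappa> K)"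
    using J_threshold_bounds[OF assms, of \<kappa>] by simp
  moreover have "0 < decay_time b \<kappa> K" using decay_time_ge[of b \<kappa> K] by linarith
  ultimately show ?thesis
    unfolding Eldan_Gross_const_def
    using Talagrand_const_pos[OF assms] gamma_slope_pos[OF assms(1)] profile_const_pos
    by (auto intro!: divide_pos_pos mult_pos_pos)
qed

context log_sobolev_system
begin

abbreviation r :: real where "r \<equiv> bobkov_rate \<kappa>"

lemma rate_r: "r < 0" "r \<le> - 2 * \<kappa>"
  using curv_bound_nonneg by (auto simp: bobkov_rate_def)

lemma bobkov_gamma_le:
  assumes t: "0 \<le> t" "t \<le> 1"
  shows "bobkov_gamma b r t \<le> gamma_slope b \<kappa> * t"
proof -
  define s where "s = - r"
  have s: "0 < s" using rate_r by (simp add: s_def)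
  define x where "x = 2 * s * t"
  have x: "0 \<le> x" using s t by (simp add: x_def)
  have "exp x - 1 \<le> x * exp x"
  proof -
    have "1 - x \<le> exp (- x)" using exp_ge_add_one_self[of "- x"] by simp
    then have "(1 - x) * exp x \<le> exp (- x) * exp x" by (intro mult_right_mono) auto
    also have "\<dots> = 1" unfolding exp_add[symmetric] by simp
    finally show ?thesis by (simp add: algebra_simps)
  qed
  also have "\<dots> \<le> x * exp (2 * s)"
    using s t x by (intro mult_left_mono) (auto simp: x_def mult_left_le)
  finally have "2 * (exp x - 1) / (b * s) \<le> 2 * (x * exp (2 * s)) / (b * s)"
    using s b by (intro divide_right_mono) auto
  also have "\<dots> = gamma_slope b \<kappa> * t"
    using s b by (simp add: gamma_slope_def x_def s_def)
  also have "2 * (exp x - 1) / (b * s) = bobkov_gamma b r t"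
  proof -
    have "r = - s" "r \<noteq> 0" using s by (auto simp: s_def)
    then have "bobkov_gamma b r t = 2 * (1 - exp x) / (b * - s)"
      unfolding bobkov_gamma_def by (simp add: x_def)
    also have "\<dots> = 2 * (exp x - 1) / (b * s)" using s b by (simp add: field_simps)
    finally show ?thesis ..
  qed
  finally show ?thesis .
qed

text \<open>
  The profile vanishes on Boolean values, so only the gradient term survives in the local Bobkov
  inequality; integrating removes the semigroup on the right.
\<close>

lemma boolean_profile_bound:
  assumes f: "\<And>x. x \<in> cube n \<Longrightarrow> f x \<in> {0, 1}" and t: "0 \<le> t" "t \<le> 1"
  shows "mean (\<lambda>x. gauss_profile (P t f x)) \<le> sqrt (gamma_slope b \<kappa> * t) * A_star n \<mu> f"
proof -
  have "mean (\<lambda>x. gauss_profile (P t f x)) \<le>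
      mean (P t (\<lambda>y. sqrt (gamma_slope b \<kappa> * t) * sqrt (Gamma_star n \<mu> f y)))"
  proof (rule mean_mono)
    fix x assume x: "x \<in> cube n"
    have "f y \<in> {0..1}" if "y \<in> cube n" for y using f[OF that] by auto
    then have "gauss_profile (P t f x) \<le>
        P t (\<lambda>y. sqrt ((gauss_profile (f y))\<^sup>2 + bobkov_gamma b r t * Gamma_star n \<mu> f y)) x"
      by (intro local_Bobkov rate_r t x)
    also have "\<dots> \<le> P t (\<lambda>y. sqrt (gamma_slope b \<kappa> * t) * sqrt (Gamma_star n \<mu> f y)) x"
    proof (rule semigroup_mono[OF _ t(1) x])
      fix y assume y: "y \<in> cube n"
      then have "gauss_profile (f y) = 0" using f[OF y] by auto
      then show "sqrt ((gauss_profile (f y))\<^sup>2 + bobkov_gamma b r t * Gamma_star n \<mu> f y) \<le>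
          sqrt (gamma_slope b \<kappa> * t) * sqrt (Gamma_star n \<mu> f y)"
        using bobkov_gamma_le[OF t] Gamma_star_nonneg[of f y]
        by (simp add: real_sqrt_mult[symmetric] mult_right_mono)
    qed
    finally show "gauss_profile (P t f x) \<le> P t (\<lambda>y. sqrt (gamma_slope b \<kappa> * t) * sqrt (Gamma_star n \<mu> f y)) x" .
  qed
  then show ?thesis unfolding mean_semigroup mean_cmult A_star_eq .
qed

lemma semigroup_unit_interval:
  assumes "\<And>x. x \<in> cube n \<Longrightarrow> f x \<in> {0, 1}" "0 \<le> t" "x \<in> cube n"
  shows "0 \<le> P t f x" "P t f x \<le> 1"
proof -
  have "0 \<le> f y" "f y \<le> 1" if "y \<in> cube n" for y using assms(1)[OF that] by auto
  then show "0 \<le> P t f x" "P t f x \<le> 1"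
    using semigroup_nonneg[of f t x] semigroup_mono[of f "\<lambda>_. 1" t x] assms by auto
qed

lemma mean_boolean_square:
  assumes "\<And>x. x \<in> cube n \<Longrightarrow> f x \<in> {0, 1}"
  shows "mean (\<lambda>x. (f x)\<^sup>2) = mean f" "Var \<mu> f = mean f - (mean f)\<^sup>2" "0 \<le> mean f" "mean f \<le> 1"
proof -
  show 1: "mean (\<lambda>x. (f x)\<^sup>2) = mean f" using assms by (intro mean_cong) fastforce
  show "Var \<mu> f = mean f - (mean f)\<^sup>2" unfolding variance_eq' 1 ..
  show "0 \<le> mean f" using assms by (intro mean_nonneg) fastforce
  have "mean f \<le> mean (\<lambda>_. 1)" using assms by (intro mean_mono) fastforce
  then show "mean f \<le> 1" by simp
qed

text \<open>
  At time \<open>1\<close> the function \<open>g = P 1 f\<close> has mean \<open>m\<close> and second moment at most \<open>m\<close> to the power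
  \<open>1 + c_hyp\<close>, so most of its mass sits where \<open>g\<close> is at most \<open>m\<close> to the power \<open>c_hyp / 2\<close>. There the profile gains the factor
  \<open>sqrt (ln (1 / m))\<close>. The truncation is encoded by the lower bound \<open>g - m^(- c_hyp / 2) g\<^sup>2\<close>, which is negative
  elsewhere.
\<close>

lemma Talagrand_small_mean:
  assumes f: "\<And>x. x \<in> cube n \<Longrightarrow> f x \<in> {0, 1}" and m: "mean f \<le> 1 / 2"
  shows "Talagrand_const b \<kappa> K * Var \<mu> f * sqrt (ln (exp 1 / Var \<mu> f)) \<le> A_star n \<mu> f"
proof (cases "mean f = 0")
  case True
  then have "Var \<mu> f = 0" using mean_boolean_square[OF f] by simp
  then show ?thesis using A_star_nonneg[of f] by simp
next
  case False
  define m where "m = mean f"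
  have m: "0 < m" "m \<le> 1 / 2"
    using False m mean_boolean_square(3)[of f] f by (auto simp: m_def less_le)
  define \<eta> where "\<eta> = c_hyp / 2"
  define l where "l = ln (1 / m)"
  define g where "g = P 1 f"
  define \<xi> where "\<xi> = small_set_gap b K"
  have \<eta>: "0 < \<eta>" using c_hyp by (simp add: \<eta>_def)
  have \<xi>: "0 < \<xi>" "\<xi> \<le> 1" using small_set_gap_bounds[OF b(1) K_pos] by (auto simp: \<xi>_def)
  have "ln 2 \<le> l" unfolding l_def using m by (intro ln_mono) (auto simp: field_simps)
  then have l2: "ln 2 \<le> l" and l: "0 < l" by (auto intro: less_le_trans[of 0 "ln 2"])
  have m_exp: "m = exp (- l)" using m by (simp add: l_def ln_div)
  have e_le: "exp (- \<eta> * l) \<le> 1 - \<xi>"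
  proof -
    have "exp (- \<eta> * l) \<le> exp (- \<eta> * ln 2)" using l2 \<eta> by simp
    then show ?thesis by (simp add: \<xi>_def small_set_gap_def \<eta>_def)
  qed
  have g01: "0 \<le> g x" "g x \<le> 1" if "x \<in> cube n" for x
    unfolding g_def using semigroup_unit_interval[of f 1 x] f that by auto
  have g_mean: "mean g = m" by (simp add: g_def mean_semigroup m_def)
  have g_sq: "mean (\<lambda>x. (g x)\<^sup>2) \<le> m * exp (- 2 * \<eta> * l)"
  proof -
    have "0 \<le> f x" if "x \<in> cube n" for x using f[OF that] by auto
    then have "mean (\<lambda>x. (g x)\<^sup>2) \<le> m * exp (- (1 - exp (- 2 * 1 / M)) * ln (m / m\<^sup>2))"
      using hypercontractive_decay[of f 1] m mean_boolean_square(1)[of f] f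
      unfolding g_def m_def by simp
    also have "m / m\<^sup>2 = 1 / m" using m by (simp add: power2_eq_square)
    finally have le: "mean (\<lambda>x. (g x)\<^sup>2) \<le> m * exp (- (1 - exp (- 2 * 1 / M)) * l)"
      unfolding l_def .
    have e: "1 - exp (- 2 * 1 / M) = 2 * \<eta>" by (simp add: \<eta>_def hyper_rate_def)
    show ?thesis using le unfolding e by simp
  qed
  define c where "c = profile_const * \<xi> * sqrt (\<eta> * l)"
  have c: "0 \<le> c" using profile_const_pos \<xi> \<eta> l by (simp add: c_def)
  have "mean (\<lambda>x. c * (g x - exp (\<eta> * l) * (g x)\<^sup>2)) \<le> mean (\<lambda>x. gauss_profile (g x))"
  proof (rule mean_mono)
    fix x assume x: "x \<in> cube n"
    show "c * (g x - exp (\<eta> * l) * (g x)\<^sup>2) \<le> gauss_profile (g x)"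
    proof (cases "0 < g x \<and> g x \<le> exp (- \<eta> * l)")
      case True
      then have gx: "0 < g x" "g x \<le> exp (- \<eta> * l)" by auto
      have "ln (g x) \<le> ln (exp (- \<eta> * l))" using gx by (intro ln_mono) auto
      then have "\<eta> * l \<le> ln (1 / g x)" using gx by (simp add: ln_div)
      then have sq: "sqrt (\<eta> * l) \<le> sqrt (ln (1 / g x))" by simp
      have "c * (g x - exp (\<eta> * l) * (g x)\<^sup>2) \<le> c * g x" using c by (intro mult_left_mono) auto
      also have "\<dots> = profile_const * (g x * \<xi> * sqrt (\<eta> * l))" by (simp add: c_def mult_ac)
      also have "\<dots> \<le> profile_const * (g x * (1 - g x) * sqrt (ln (1 / g x)))"
        using gx e_le sq profile_const_pos \<xi> \<eta> l g01[OF x] by (intro mult_left_mono mult_mono) auto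
      also have "\<dots> \<le> gauss_profile (g x)"
        using g01[OF x] by (rule gauss_profile_ge_log)
      finally show ?thesis .
    next
      case False
      have "g x - exp (\<eta> * l) * (g x)\<^sup>2 \<le> 0"
      proof (cases "g x = 0")
        case False
        then have gx: "0 < g x" "exp (- \<eta> * l) < g x"
          using \<open>\<not> (0 < g x \<and> g x \<le> exp (- \<eta> * l))\<close> g01[OF x] by auto
        have "1 = exp (\<eta> * l) * exp (- \<eta> * l)" unfolding exp_add[symmetric] by simp
        also have "\<dots> \<le> exp (\<eta> * l) * g x" using gx by (intro mult_left_mono) auto
        finally have "1 * g x \<le> exp (\<eta> * l) * g x * g x" using gx by (intro mult_right_mono) auto
        then show ?thesis by (simp add: power2_eq_square mult.assoc)
      qed simp
      then have "c * (g x - exp (\<eta> * l) * (g x)\<^sup>2) \<le> 0" using c by (intro mult_nonneg_nonpos)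
      then show ?thesis using gauss_profile_nonneg[of "g x"] by linarith
    qed
  qed
  moreover have "mean (\<lambda>x. c * (g x - exp (\<eta> * l) * (g x)\<^sup>2)) = c * (m - exp (\<eta> * l) * mean (\<lambda>x. (g x)\<^sup>2))"
    unfolding mean_cmult mean_diff g_mean ..
  moreover have "c * (\<xi> * m) \<le> c * (m - exp (\<eta> * l) * mean (\<lambda>x. (g x)\<^sup>2))"
  proof (rule mult_left_mono[OF _ c])
    have "exp (\<eta> * l) * mean (\<lambda>x. (g x)\<^sup>2) \<le> exp (\<eta> * l) * (m * exp (- 2 * \<eta> * l))"
      using g_sq by (intro mult_left_mono) auto
    also have "\<dots> = m * (exp (\<eta> * l) * exp (- 2 * \<eta> * l))" by (simp only: mult_ac)
    also have "\<dots> = m * exp (- \<eta> * l)" unfolding exp_add[symmetric] by (simp add: algebra_simps)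
    also have "\<dots> \<le> m * (1 - \<xi>)" using e_le m by (intro mult_left_mono) auto
    finally show "\<xi> * m \<le> m - exp (\<eta> * l) * mean (\<lambda>x. (g x)\<^sup>2)" by (simp add: algebra_simps)
  qed
  moreover have "mean (\<lambda>x. gauss_profile (g x)) \<le> sqrt (gamma_slope b \<kappa>) * A_star n \<mu> f"
    unfolding g_def using boolean_profile_bound[of f 1] f by simp
  ultimately have "c * (\<xi> * m) \<le> sqrt (gamma_slope b \<kappa>) * A_star n \<mu> f" by linarith
  then have A: "c * \<xi> / sqrt (gamma_slope b \<kappa>) * m \<le> A_star n \<mu> f"
    using gamma_slope_pos[OF b(1), of \<kappa>] by (simp add: pos_divide_le_eq mult_ac)
  have A': "2 * Talagrand_const b \<kappa> K * sqrt l * m \<le> A_star n \<mu> f"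
  proof -
    have "c * \<xi> / sqrt (gamma_slope b \<kappa>) = 2 * Talagrand_const b \<kappa> K * sqrt l"
      unfolding c_def real_sqrt_mult[of \<eta>] Talagrand_const_def \<xi>_def[symmetric] \<eta>_def[symmetric]
      by (simp add: power2_eq_square)
    then show ?thesis using A by simp
  qed
  define v where "v = Var \<mu> f"
  have v_eq: "v = m * (1 - m)"
  proof -
    have "v = m - m\<^sup>2" unfolding v_def m_def by (rule mean_boolean_square(2)[OF f])
    then show ?thesis by (simp add: power2_eq_square algebra_simps)
  qed
  have "m * (1 / 2) \<le> m * (1 - m)" "m * (1 - m) \<le> m * 1"
    using m by (intro mult_left_mono; simp)+
  then have v: "m / 2 \<le> v" "v \<le> m" unfolding v_eq by simp_all
  have "ln (exp 1 / v) \<le> 4 * l"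
  proof -
    have "exp 1 / v \<le> exp 1 / (m / 2)" using v m by (intro divide_left_mono) auto
    also have "\<dots> = 2 * exp 1 * (1 / m)" by simp
    finally have "ln (exp 1 / v) \<le> ln (2 * exp 1 * (1 / m))" using v m by (intro ln_mono) auto
    also have "\<dots> = ln 2 + 1 + l" using m by (simp add: ln_mult l_def ln_div)
    also have "\<dots> \<le> 4 * l" using l2 ln2_ge_two_thirds by linarith
    finally show ?thesis .
  qed
  then have "sqrt (ln (exp 1 / v)) \<le> sqrt (4 * l)" by simp
  also have "sqrt (4 * l) = 2 * sqrt l" by (simp add: real_sqrt_mult)
  finally have s: "sqrt (ln (exp 1 / v)) \<le> 2 * sqrt l" .
  have v1: "v \<le> exp 1" using v(2) m exp_ge_add_one_self[of "1::real"] by linarith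
  have T: "0 < Talagrand_const b \<kappa> K" by (rule Talagrand_const_pos[OF b(1) K_pos])
  have "Talagrand_const b \<kappa> K * v * sqrt (ln (exp 1 / v)) \<le> Talagrand_const b \<kappa> K * m * (2 * sqrt l)"
    using T v m s v1 by (intro mult_mono) (auto simp: ln_ge_zero)
  also have "\<dots> = 2 * Talagrand_const b \<kappa> K * sqrt l * m" by (simp add: mult_ac)
  also have "\<dots> \<le> A_star n \<mu> f" by (rule A')
  finally show ?thesis unfolding v_def .
qed

text \<open>
  Replacing \<open>f\<close> by \<open>1 - f\<close> changes neither side.
\<close>

theorem Talagrand_surface_area:
  assumes f: "\<And>x. x \<in> cube n \<Longrightarrow> f x \<in> {0, 1}"
  shows "Talagrand_const b \<kappa> K * Var \<mu> f * sqrt (ln (exp 1 / Var \<mu> f)) \<le> A_star n \<mu> f"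
proof (cases "mean f \<le> 1 / 2")
  case True
  then show ?thesis using f by (intro Talagrand_small_mean)
next
  case False
  define h where "h x = 1 - f x" for x
  have h: "h x \<in> {0, 1}" if "x \<in> cube n" for x using f[OF that] by (auto simp: h_def)
  have hm: "mean h = 1 - mean f" unfolding h_def mean_diff by simp
  have "mean h - (mean h)\<^sup>2 = mean f - (mean f)\<^sup>2"
    unfolding hm by (simp add: power2_eq_square algebra_simps)
  then have "Var \<mu> h = Var \<mu> f"
    using mean_boolean_square(2)[of h, OF h] mean_boolean_square(2)[of f, OF f] by (simp only:)
  moreover have "Gamma_star n \<mu> h x = Gamma_star n \<mu> f x" for x
    unfolding Gamma_star_def delta_def h_def by (intro sum.cong refl) (simp add: power2_eq_square algebra_simps)
  then have "A_star n \<mu> h = A_star n \<mu> f" by (simp add: A_star_def)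
  ultimately show ?thesis
    using Talagrand_small_mean[of h] h hm False by simp
qed

text \<open>
  When \<open>J\<close> is not small compared with the squared variance, \<open>ln (1 + e / J)\<close> is comparable to the
  logarithm of the variance and the surface-area inequality already suffices.
\<close>

lemma Eldan_Gross_large_J:
  assumes f: "\<And>x. x \<in> cube n \<Longrightarrow> f x \<in> {0, 1}" and V: "0 < Var \<mu> f"
    and J: "J_threshold b \<kappa> K * (Var \<mu> f)\<^sup>2 \<le> J_star n \<mu> f"
  shows "Talagrand_const b \<kappa> K / sqrt (2 + ln (1 / J_threshold b \<kappa> K)) * Var \<mu> f *
    sqrt (ln (1 + exp 1 / J_star n \<mu> f)) \<le> A_star n \<mu> f"
proof -
  define v J \<epsilon> where "v = Var \<mu> f" and "J = J_star n \<mu> f" and "\<epsilon> = J_threshold b \<kappa> K"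
  have \<epsilon>: "0 < \<epsilon>" "\<epsilon> \<le> 1" using J_threshold_bounds[OF b(1) K_pos] by (auto simp: \<epsilon>_def)
  have v: "0 < v" "v \<le> 1"
    using V mean_boolean_square(2,4)[of f, OF f] zero_le_power2[of "mean f"] unfolding v_def by linarith+
  have v2: "0 < v\<^sup>2" "v\<^sup>2 \<le> 1" using v by (auto simp: power_le_one)
  have Jp: "0 < \<epsilon> * v\<^sup>2" "\<epsilon> * v\<^sup>2 \<le> 1" "\<epsilon> * v\<^sup>2 \<le> J"
    using \<epsilon> v2 J by (auto simp: v_def J_def \<epsilon>_def intro: mult_le_one)
  then have "0 < J" by linarith
  have "1 + exp 1 / J \<le> 1 / (\<epsilon> * v\<^sup>2) + exp 1 / (\<epsilon> * v\<^sup>2)"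
  proof (intro add_mono divide_left_mono mult_pos_pos)
    show "1 \<le> 1 / (\<epsilon> * v\<^sup>2)" using Jp by simp
  qed (use Jp \<open>0 < J\<close> \<epsilon> v in auto)
  also have "\<dots> = (1 + exp 1) / (\<epsilon> * v\<^sup>2)" by (simp add: add_divide_distrib)
  also have "\<dots> \<le> exp 2 / (\<epsilon> * v\<^sup>2)"
  proof (rule divide_right_mono)
    have "2 * exp 1 \<le> exp 1 * exp (1::real)"
      using exp_ge_add_one_self[of "1::real"] by (intro mult_right_mono) auto
    also have "\<dots> = exp 2" unfolding exp_add[symmetric] by simp
    finally show "1 + exp 1 \<le> exp (2::real)" using exp_ge_add_one_self[of "1::real"] by linarith
  qed (use Jp in auto)
  finally have "ln (1 + exp 1 / J) \<le> ln (exp 2 / (\<epsilon> * v\<^sup>2))"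
    using Jp by (intro ln_mono) (auto intro: add_pos_nonneg)
  also have "\<dots> = 2 * ln (exp 1 / v) + ln (1 / \<epsilon>)"
    using \<epsilon> v by (simp add: ln_div ln_mult ln_realpow)
  also have "\<dots> \<le> (2 + ln (1 / \<epsilon>)) * ln (exp 1 / v)"
  proof -
    have "1 \<le> ln (exp 1 / v)" using v by (simp add: ln_div)
    moreover have "0 \<le> ln (1 / \<epsilon>)" using \<epsilon> by simp
    ultimately have "ln (1 / \<epsilon>) * 1 \<le> ln (1 / \<epsilon>) * ln (exp 1 / v)" by (intro mult_left_mono)
    then show ?thesis by (simp add: algebra_simps)
  qed
  finally have "sqrt (ln (1 + exp 1 / J)) \<le> sqrt (2 + ln (1 / \<epsilon>)) * sqrt (ln (exp 1 / v))"
    unfolding real_sqrt_mult[symmetric] by simp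
  moreover have s: "0 < sqrt (2 + ln (1 / \<epsilon>))"
  proof -
    have "0 \<le> ln (1 / \<epsilon>)" using \<epsilon> by simp
    then have "0 < 2 + ln (1 / \<epsilon>)" by linarith
    then show ?thesis by (simp only: real_sqrt_gt_0_iff)
  qed
  moreover have T: "0 < Talagrand_const b \<kappa> K" by (rule Talagrand_const_pos[OF b(1) K_pos])
  ultimately have "Talagrand_const b \<kappa> K / sqrt (2 + ln (1 / \<epsilon>)) * v * sqrt (ln (1 + exp 1 / J)) \<le>
      Talagrand_const b \<kappa> K / sqrt (2 + ln (1 / \<epsilon>)) * v * (sqrt (2 + ln (1 / \<epsilon>)) * sqrt (ln (exp 1 / v)))"
    using v by (intro mult_left_mono) auto
  also have "\<dots> = Talagrand_const b \<kappa> K * v * sqrt (ln (exp 1 / v))" using s by simp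
  also have "\<dots> \<le> A_star n \<mu> f" unfolding v_def using f by (rule Talagrand_surface_area)
  finally show ?thesis unfolding v_def J_def \<epsilon>_def .
qed

text \<open>
  As long as half of the variance is left, the energy of \<open>P s f\<close> is at least of the order of the
  variance times \<open>ln (1 / J)\<close>: the inequality between total influence and \<open>I / J\<close> applies to \<open>P s f\<close>, its \<open>J\<close> is
  comparable to that of \<open>f\<close> by commutation, and its \<open>I\<close> is bounded below by the Poincare inequality.
  Over the time considered this would exhaust more than half of the variance.
\<close>

lemma variance_halves_quickly:
  assumes V: "0 < Var \<mu> f" and V1: "Var \<mu> f \<le> 1" and J: "0 < J_star n \<mu> f"
    and J_small: "J_star n \<mu> f < J_threshold b \<kappa> K * (Var \<mu> f)\<^sup>2"
  shows "Var \<mu> (P (decay_time b \<kappa> K / ln (1 / J_star n \<mu> f)) f) \<le> Var \<mu> f / 2"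
proof -
  define v J \<epsilon> \<alpha> where "v = Var \<mu> f" and "J = J_star n \<mu> f" and "\<epsilon> = J_threshold b \<kappa> K"
    and "\<alpha> = decay_time b \<kappa> K"
  define \<Lambda> where "\<Lambda> = ln (1 / J)"
  define T where "T = \<alpha> / \<Lambda>"
  define C where "C = b * L1_L2_const b \<kappa> K / 6"
  have C: "0 < C" using L1_L2_const_pos[OF b(1) K_pos] b by (simp add: C_def)
  have \<alpha>: "1 \<le> \<alpha>" "1 \<le> \<alpha> * C"
  proof -
    show "1 \<le> \<alpha>" unfolding \<alpha>_def by (rule decay_time_ge)
    have "1 / C \<le> \<alpha>" by (simp add: \<alpha>_def decay_time_def C_def)
    then show "1 \<le> \<alpha> * C" using C by (simp add: field_simps)
  qed
  have \<epsilon>: "0 < \<epsilon>" "\<epsilon> \<le> 1" "\<epsilon> \<le> exp (- \<alpha>)"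
    using J_threshold_bounds[OF b(1) K_pos] by (auto simp: \<epsilon>_def \<alpha>_def)
  have v: "0 < v" "v \<le> 1" using V V1 by (auto simp: v_def)
  have Jp: "0 < J" "J < \<epsilon> * v\<^sup>2" using J J_small by (auto simp: J_def \<epsilon>_def v_def)
  have "\<epsilon> * v\<^sup>2 \<le> exp (- \<alpha>) * 1" using \<epsilon> v by (intro mult_mono) (auto simp: power_le_one)
  then have "ln J \<le> ln (exp (- \<alpha>))" using Jp by (intro ln_mono) auto
  then have \<Lambda>: "\<alpha> \<le> \<Lambda>" using Jp by (simp add: \<Lambda>_def ln_div)
  have T: "0 < T" "T \<le> 1" using \<alpha> \<Lambda> by (auto simp: T_def)
  have "Var \<mu> (P T f) \<le> v / 2"
  proof (rule ccontr)
    assume "\<not> Var \<mu> (P T f) \<le> v / 2"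
    then have big: "v / 2 < Var \<mu> (P T f)" by simp
    have der: "((\<lambda>t. Var \<mu> (P t f)) has_real_derivative - 2 * dirichlet (P t f) (P t f)) (at t)" for t
      by (rule Var_semigroup_has_derivative)
    obtain s where s: "0 < s" "s < T"
      "Var \<mu> (P T f) - Var \<mu> (P 0 f) = (T - 0) * (- 2 * dirichlet (P s f) (P s f))"
      using MVT2[OF T(1) der] by blast
    let ?g = "P s f"
    have "Var \<mu> (P T f) \<le> Var \<mu> ?g"
      using s dirichlet_nonneg
      by (intro DERIV_nonpos_imp_nonincreasing[of s T "\<lambda>t. Var \<mu> (P t f)"]) (auto intro!: exI der simp: less_imp_le)
    then have gv: "v / 2 < Var \<mu> ?g" using big by linarith
    have I_ge: "b / (4 * M) * (v / 2) \<le> I_star n \<mu> ?g"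
    proof -
      have "v / 2 \<le> 4 * M / b * I_star n \<mu> ?g" using Var_le_I_star[of ?g] gv by linarith
      then have "b / (4 * M) * (v / 2) \<le> b / (4 * M) * (4 * M / b * I_star n \<mu> ?g)"
        using M_pos b by (intro mult_left_mono) auto
      then show ?thesis using M_pos b by simp
    qed
    have Ig: "0 < I_star n \<mu> ?g"
    proof -
      have "0 < b / (4 * M) * (v / 2)" using M_pos b v by simp
      then show ?thesis using I_ge by linarith
    qed
    have Jg: "0 < J_star n \<mu> ?g"
      using I_star_eq_0[of ?g] Ig J_star_nonneg[of ?g] by fastforce
    have "J_star n \<mu> ?g \<le> exp (4 * \<kappa> * s) * J"
      unfolding J_def using s by (intro J_star_semigroup_le) auto
    also have "\<dots> \<le> exp (4 * \<kappa>) * J"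
      using s T Jp curv_bound_nonneg by (intro mult_right_mono) (auto simp: mult_left_le)
    finally have J_le: "J_star n \<mu> ?g \<le> exp (4 * \<kappa>) * J" .
    define p where "p = b / (8 * M * exp (4 * \<kappa>))"
    have p: "0 < p" using b M_pos by (simp add: p_def)
    have "\<epsilon> \<le> p\<^sup>2" by (simp add: \<epsilon>_def J_threshold_def p_def)
    then have "\<epsilon> * v\<^sup>2 \<le> p\<^sup>2 * v\<^sup>2" by (intro mult_right_mono) auto
    then have "J < (p * v)\<^sup>2" using Jp by (simp add: power_mult_distrib)
    then have "sqrt J < sqrt ((p * v)\<^sup>2)" by (rule real_sqrt_less_mono)
    then have "sqrt J < p * v" using p v by simp
    then have "sqrt J / J \<le> p * v / J" using Jp by (intro divide_right_mono) auto
    also have "p * v / J = (b / (4 * M) * (v / 2)) / (exp (4 * \<kappa>) * J)"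
      using M_pos by (simp add: p_def)
    also have "\<dots> \<le> I_star n \<mu> ?g / J_star n \<mu> ?g"
      using I_ge Ig J_le Jg M_pos b v by (intro frac_le) auto
    finally have "ln (sqrt J / J) \<le> ln (I_star n \<mu> ?g / J_star n \<mu> ?g)"
      using Jp by (intro ln_mono) auto
    then have log: "\<Lambda> / 2 \<le> ln (I_star n \<mu> ?g / J_star n \<mu> ?g)"
      using Jp by (simp add: \<Lambda>_def ln_div ln_sqrt)
    have "C * (v / 2) * (\<Lambda> / 2) \<le> C * Var \<mu> ?g * (1 + ln (I_star n \<mu> ?g / J_star n \<mu> ?g))"
      using C v gv log \<Lambda> \<alpha> by (intro mult_mono) auto
    also have "\<dots> \<le> dirichlet ?g ?g"
      unfolding total_influence_eq[symmetric] using C by (intro total_influence_ge_J) (auto simp: C_def)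
    finally have "2 * T * (C * (v / 2) * (\<Lambda> / 2)) \<le> 2 * T * dirichlet ?g ?g"
      using T by (intro mult_left_mono) auto
    moreover have "2 * T * (C * (v / 2) * (\<Lambda> / 2)) = \<alpha> * C * (v / 2)"
      using \<alpha> \<Lambda> by (simp add: T_def)
    moreover have "1 * (v / 2) \<le> \<alpha> * C * (v / 2)" using \<alpha> v by (intro mult_right_mono) auto
    moreover have "v - Var \<mu> (P T f) = 2 * T * dirichlet ?g ?g"
      using s(3) by (simp add: v_def)
    ultimately show False using big by linarith
  qed
  then show ?thesis by (simp add: T_def v_def \<alpha>_def \<Lambda>_def J_def)
qed

text \<open>
  The local Bobkov inequality at the short time \<open>T\<close> has the small factor \<open>sqrt T\<close> on the gradient side,
  while the mean of \<open>g (1 - g)\<close>, which is the variance lost up to time \<open>T\<close>, is still of the order of the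
  variance.
\<close>

lemma Eldan_Gross_small_J:
  assumes f: "\<And>x. x \<in> cube n \<Longrightarrow> f x \<in> {0, 1}" and V: "0 < Var \<mu> f" and J: "0 < J_star n \<mu> f"
    and J_small: "J_star n \<mu> f < J_threshold b \<kappa> K * (Var \<mu> f)\<^sup>2"
  shows "profile_const / (2 * sqrt (3 * gamma_slope b \<kappa> * decay_time b \<kappa> K)) * Var \<mu> f *
    sqrt (ln (1 + exp 1 / J_star n \<mu> f)) \<le> A_star n \<mu> f"
proof -
  define v J \<alpha> where "v = Var \<mu> f" and "J = J_star n \<mu> f" and "\<alpha> = decay_time b \<kappa> K"
  define \<Lambda> where "\<Lambda> = ln (1 / J)"
  define T where "T = \<alpha> / \<Lambda>"
  define G where "G = gamma_slope b \<kappa>"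
  have G: "0 < G" using gamma_slope_pos b by (simp add: G_def)
  have \<alpha>: "1 \<le> \<alpha>" unfolding \<alpha>_def by (rule decay_time_ge)
  have v: "0 < v" "v \<le> 1"
    using V mean_boolean_square(2,4)[of f, OF f] zero_le_power2[of "mean f"] unfolding v_def by linarith+
  have "J_threshold b \<kappa> K * v\<^sup>2 \<le> exp (- \<alpha>) * 1"
    using J_threshold_bounds[OF b(1) K_pos, of \<kappa>] v unfolding \<alpha>_def by (intro mult_mono) (auto simp: power_le_one)
  then have J': "0 < J" "J \<le> exp (- \<alpha>)" using J J_small by (auto simp: J_def v_def)
  then have "ln J \<le> ln (exp (- \<alpha>))" by (intro ln_mono) auto
  then have \<Lambda>: "\<alpha> \<le> \<Lambda>" using J' by (simp add: \<Lambda>_def ln_div)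
  have T: "0 < T" "T \<le> 1" using \<alpha> \<Lambda> by (auto simp: T_def)
  let ?g = "P T f"
  have half: "Var \<mu> ?g \<le> v / 2"
    using variance_halves_quickly[OF V _ J J_small] v by (simp add: T_def v_def \<alpha>_def \<Lambda>_def J_def)
  have "v / 2 \<le> v - Var \<mu> ?g" using half by simp
  also have "\<dots> = mean (\<lambda>x. ?g x * (1 - ?g x))"
  proof -
    have "mean (\<lambda>x. ?g x * (1 - ?g x)) = mean (\<lambda>x. ?g x - (?g x)\<^sup>2)"
      by (rule mean_cong) (simp add: power2_eq_square algebra_simps)
    then have "mean (\<lambda>x. ?g x * (1 - ?g x)) = mean f - mean (\<lambda>x. (?g x)\<^sup>2)"
      unfolding mean_diff mean_semigroup .
    moreover have "v = mean f - (mean f)\<^sup>2" unfolding v_def by (rule mean_boolean_square(2)[OF f])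
    ultimately show ?thesis unfolding variance_eq'[of ?g] mean_semigroup by simp
  qed
  finally have "profile_const * (v / 2) \<le> profile_const * mean (\<lambda>x. ?g x * (1 - ?g x))"
    using profile_const_pos by (intro mult_left_mono) auto
  also have "\<dots> \<le> mean (\<lambda>x. gauss_profile (?g x))"
    unfolding mean_cmult[symmetric]
    using semigroup_unit_interval[of f T] f T by (intro mean_mono gauss_profile_ge_variance) auto
  also have "\<dots> \<le> sqrt (G * T) * A_star n \<mu> f"
    unfolding G_def using boolean_profile_bound[of f T] f T by simp
  finally have main: "profile_const * (v / 2) \<le> sqrt (G * T) * A_star n \<mu> f" .
  have log: "ln (1 + exp 1 / J) \<le> 3 * \<Lambda>"
  proof -
    have J1: "J \<le> 1" using J' \<alpha> exp_le_one_iff[of "- \<alpha>"] by linarith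
    have "1 + exp 1 / J \<le> exp 1 / J + exp 1 / J"
      using J' J1 exp_ge_add_one_self[of "1::real"] by (intro add_right_mono) (simp add: pos_le_divide_eq)
    also have "\<dots> = 2 * exp 1 * (1 / J)" by simp
    finally have "ln (1 + exp 1 / J) \<le> ln (2 * exp 1 * (1 / J))"
      using J' by (intro ln_mono) (auto intro: add_pos_nonneg)
    also have "\<dots> = ln 2 + 1 + \<Lambda>" using J' by (simp add: ln_mult ln_div \<Lambda>_def)
    also have "\<dots> \<le> 3 * \<Lambda>" using \<alpha> \<Lambda> ln_le_minus_one[of "2::real"] by linarith
    finally show ?thesis .
  qed
  have "profile_const / (2 * sqrt (3 * G * \<alpha>)) * v * sqrt (ln (1 + exp 1 / J)) \<le>
      profile_const / (2 * sqrt (3 * G * \<alpha>)) * v * sqrt (3 * \<Lambda>)"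
    using log v profile_const_pos G \<alpha> by (intro mult_left_mono) auto
  also have "\<dots> = profile_const * (v / 2) / sqrt (G * T)"
  proof -
    have "G * T = (3 * G * \<alpha>) / (3 * \<Lambda>)" by (simp add: T_def)
    then have "sqrt (G * T) = sqrt (3 * G * \<alpha>) / sqrt (3 * \<Lambda>)" by (simp only: real_sqrt_divide)
    then show ?thesis by simp
  qed
  also have "\<dots> \<le> A_star n \<mu> f"
    using main G T by (simp add: pos_divide_le_eq mult.commute)
  finally show ?thesis unfolding v_def J_def \<alpha>_def G_def .
qed

text \<open>
  The sign function is rescaled to a Boolean one, which multiplies the variance and \<open>J\<close> by \<open>1/4\<close> and
  \<open>A\<close> by \<open>1/2\<close>.
\<close>

theorem Eldan_Gross:
  assumes f: "\<And>x. x \<in> cube n \<Longrightarrow> f x \<in> {-1, 1}"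
  shows "Eldan_Gross_const b \<kappa> K * Var \<mu> f * sqrt (ln (1 + exp 1 / J_star n \<mu> f)) \<le> A_star n \<mu> f"
proof -
  define h where "h x = 1 / 2 * f x + 1 / 2" for x
  have h: "h x \<in> {0, 1}" if "x \<in> cube n" for x using f[OF that] by (auto simp: h_def)
  have d: "delta \<mu> i h x = 1 / 2 * delta \<mu> i f x" for i x
    by (simp add: delta_def h_def algebra_simps)
  have hm: "mean h = 1 / 2 * mean f + 1 / 2" unfolding h_def mean_add mean_cmult by simp
  have V: "Var \<mu> f = 4 * Var \<mu> h"
  proof -
    have "Var \<mu> h = mean (\<lambda>x. 1 / 4 * (f x - mean f)\<^sup>2)"
      unfolding variance_eq hm by (rule mean_cong) (simp add: h_def power2_eq_square algebra_simps)
    then show ?thesis unfolding mean_cmult variance_eq[of f] by simp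
  qed
  have J: "J_star n \<mu> f = 4 * J_star n \<mu> h"
    unfolding J_star_def coord_L1_eq d abs_mult mean_cmult sum_distrib_left
    by (simp add: power_divide)
  have A: "A_star n \<mu> f = 2 * A_star n \<mu> h"
  proof -
    have "sqrt (Gamma_star n \<mu> h x) = 1 / 2 * sqrt (Gamma_star n \<mu> f x)" for x
      unfolding Gamma_star_def d power_mult_distrib sum_distrib_left[symmetric]
      by (simp add: real_sqrt_mult power_divide real_sqrt_divide)
    then show ?thesis unfolding A_star_eq by (simp only: mean_cmult)
  qed
  have C: "0 < Eldan_Gross_const b \<kappa> K" by (rule Eldan_Gross_const_pos[OF b(1) K_pos])
  show ?thesis
  proof (cases "Var \<mu> h = 0")
    case True
    then show ?thesis using V A_star_nonneg[of f] by simp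
  next
    case False
    then have Vh: "0 < Var \<mu> h" using Var_nonneg[of h] by linarith
    have Jh: "0 < J_star n \<mu> h"
    proof (rule ccontr)
      assume "\<not> 0 < J_star n \<mu> h"
      then have "J_star n \<mu> h = 0" using J_star_nonneg[of h] by simp
      then show False using I_star_eq_0 Var_le_I_star[of h] Vh by fastforce
    qed
    let ?X = "Var \<mu> h * sqrt (ln (1 + exp 1 / J_star n \<mu> h))"
    have X: "0 \<le> ?X" using Vh Jh by simp
    have "2 * Eldan_Gross_const b \<kappa> K * ?X \<le> A_star n \<mu> h"
    proof (cases "J_threshold b \<kappa> K * (Var \<mu> h)\<^sup>2 \<le> J_star n \<mu> h")
      case True
      have "2 * Eldan_Gross_const b \<kappa> K * ?X \<le>
          Talagrand_const b \<kappa> K / sqrt (2 + ln (1 / J_threshold b \<kappa> K)) * ?X"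
        using X by (intro mult_right_mono) (auto simp: Eldan_Gross_const_def)
      also have "\<dots> \<le> A_star n \<mu> h" using Eldan_Gross_large_J[OF h Vh True] by (simp add: mult.assoc)
      finally show ?thesis .
    next
      case False
      have "2 * Eldan_Gross_const b \<kappa> K * ?X \<le>
          profile_const / (2 * sqrt (3 * gamma_slope b \<kappa> * decay_time b \<kappa> K)) * ?X"
        using X by (intro mult_right_mono) (auto simp: Eldan_Gross_const_def)
      also have "\<dots> \<le> A_star n \<mu> h" using Eldan_Gross_small_J[OF h Vh Jh] False by (simp add: mult.assoc)
      finally show ?thesis .
    qed
    then have main: "4 * Eldan_Gross_const b \<kappa> K * ?X \<le> A_star n \<mu> f" using A by linarith
    have "ln (1 + exp 1 / J_star n \<mu> f) \<le> ln (1 + exp 1 / J_star n \<mu> h)"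
      unfolding J using Jh by (intro ln_mono add_left_mono divide_left_mono) (auto intro: add_pos_nonneg)
    then have "4 * Eldan_Gross_const b \<kappa> K * (Var \<mu> h * sqrt (ln (1 + exp 1 / J_star n \<mu> f))) \<le>
        4 * Eldan_Gross_const b \<kappa> K * ?X"
      using C Vh by (intro mult_left_mono) auto
    then show ?thesis using main unfolding V by (simp add: mult_ac)
  qed
qed

end

section \<open>Curvature and contraction from the Dobrushin matrix\<close>

lemma tv_dist_ge: "\<bar>measure_pmf.prob p A - measure_pmf.prob r A\<bar> \<le> tv_dist p r"
  unfolding tv_dist_def
proof (rule cSUP_upper[OF UNIV_I])
  have "\<bar>measure_pmf.prob p A - measure_pmf.prob r A\<bar> \<le> 1" for A
    using measure_pmf.prob_le_1[of p A] measure_pmf.prob_le_1[of r A]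
      measure_nonneg[of p A] measure_nonneg[of r A] by linarith
  then show "bdd_above (range (\<lambda>A. \<bar>measure_pmf.prob p A - measure_pmf.prob r A\<bar>))"
    by (intro bdd_aboveI[of _ 1]) auto
qed

lemma tv_dist_nonneg: "0 \<le> tv_dist p r"
  using tv_dist_ge[of p "{}" r] by simp

lemma max_col_sum_ge:
  assumes "j \<in> {1..n}"
  shows "(\<Sum>i\<in>{1..n}. \<bar>A i j\<bar>) \<le> max_col_sum n A"
  unfolding max_col_sum_def using assms by (intro Max_ge) auto

text \<open>
  Homogeneity; the supremum is finite because the entries of a unit vector are at most \<open>1\<close>.
\<close>

lemma spectral_norm_ge:
  "L2_set (\<lambda>i. \<Sum>j\<in>{1..n}. A i j * v j) {1..n} \<le> spectral_norm n A * L2_set v {1..n}"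
proof -
  let ?N = "\<lambda>v. L2_set (\<lambda>i. \<Sum>j\<in>{1..n}. A i j * v j) {1..n}"
  have bdd: "bdd_above (?N ` {v. L2_set v {1..n} \<le> 1})"
  proof (rule bdd_aboveI2)
    fix v assume "v \<in> {v. L2_set v {1..n} \<le> 1}"
    then have v: "L2_set v {1..n} \<le> 1" by simp
    have "?N v \<le> (\<Sum>i\<in>{1..n}. \<bar>\<Sum>j\<in>{1..n}. A i j * v j\<bar>)"
      by (rule L2_set_le_sum_abs)
    also have "\<dots> \<le> (\<Sum>i\<in>{1..n}. \<Sum>j\<in>{1..n}. \<bar>A i j\<bar>)"
    proof (intro sum_mono order_trans[OF sum_abs])
      fix i j assume j: "j \<in> {1..n}"
      have "\<bar>v j\<bar> \<le> L2_set v {1..n}"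
        using member_le_L2_set[of "{1..n}" j "\<lambda>j. \<bar>v j\<bar>"] j by (simp add: L2_set_def)
      then have "\<bar>A i j\<bar> * \<bar>v j\<bar> \<le> \<bar>A i j\<bar> * 1" using v by (intro mult_left_mono) auto
      then show "\<bar>A i j * v j\<bar> \<le> \<bar>A i j\<bar>" by (simp add: abs_mult)
    qed
    finally show "?N v \<le> (\<Sum>i\<in>{1..n}. \<Sum>j\<in>{1..n}. \<bar>A i j\<bar>)" .
  qed
  define l where "l = L2_set v {1..n}"
  show ?thesis
  proof (cases "l = 0")
    case True
    then have "\<forall>j\<in>{1..n}. v j = 0" by (simp add: l_def L2_set_eq_0_iff)
    then have "?N v = 0" by (simp add: L2_set_eq_0_iff)
    then show ?thesis using True by (simp add: l_def)
  next
    case False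
    then have l: "0 < l" using L2_set_nonneg[of v "{1..n}"] by (simp add: l_def less_le)
    let ?w = "\<lambda>j. 1 / l * v j"
    have w: "L2_set ?w {1..n} = 1 / l * L2_set v {1..n}"
      using l by (simp only: L2_set_right_distrib less_imp_le zero_le_divide_1_iff)
    then have "L2_set ?w {1..n} \<le> 1" using l by (simp add: l_def)
    then have "?N ?w \<le> spectral_norm n A"
      unfolding spectral_norm_def by (intro cSUP_upper bdd) simp
    moreover have "?N ?w = 1 / l * ?N v"
    proof -
      have "?N ?w = L2_set (\<lambda>i. 1 / l * (\<Sum>j\<in>{1..n}. A i j * v j)) {1..n}"
        unfolding sum_distrib_left by (simp add: mult.left_commute)
      also have "\<dots> = 1 / l * ?N v"
        using l by (simp only: L2_set_right_distrib less_imp_le zero_le_divide_1_iff)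
      finally show ?thesis .
    qed
    ultimately show ?thesis using l by (simp add: l_def field_simps)
  qed
qed

context spin_system
begin

text \<open>
  Given the other coordinates, only \<open>x\<close> and its flip remain.
\<close>

lemma cond_law_flip:
  assumes x: "x \<in> cube n" and i: "i \<in> {1..n}"
  shows "measure_pmf.prob (cond_law n \<mu> i x) {- x i} = flip_prob i x"
proof -
  let ?S = "{y. \<forall>k\<in>{1..n} - {i}. y k = x k}"
  have ne: "set_pmf \<mu> \<inter> ?S \<noteq> {}" using x supp by auto
  have xi: "x i \<in> {-1, 1}" using x i unfolding cube_def by (rule PiE_mem)
  have fib: "cube n \<inter> ?S = {x, flip i x}"
  proof -
    have "y = x \<or> y = flip i x" if y: "y \<in> cube n" "y \<in> ?S" for y
    proof -
      have yi: "y i \<in> {-1, 1}" using y(1) i unfolding cube_def by (rule PiE_mem)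
      have "y k = x k" if "k \<noteq> i" for k
        using that y x by (cases "k \<in> {1..n}") (auto simp: cube_def PiE_iff extensional_def)
      then have "y = x(i := y i)" by auto
      moreover have "y i = x i \<or> y i = - x i" using xi yi by auto
      ultimately show ?thesis by (metis flip_def fun_upd_triv)
    qed
    then show ?thesis using x i flip_in_cube[OF x i] by (auto simp: flip_def split: if_splits)
  qed
  have distinct: "x \<noteq> flip i x" using xi by (auto simp: flip_def fun_eq_iff)
  have prob_S: "measure_pmf.prob \<mu> A = (\<Sum>y\<in>cube n \<inter> A. pmf \<mu> y)" for A
  proof -
    have "measure_pmf.prob \<mu> A = measure_pmf.prob \<mu> (A \<inter> set_pmf \<mu>)" by (simp add: measure_Int_set_pmf)
    also have "\<dots> = (\<Sum>y\<in>cube n \<inter> A. pmf \<mu> y)"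
      unfolding supp by (subst measure_measure_pmf_finite) (auto simp: Int_commute)
    finally show ?thesis .
  qed
  have "measure_pmf.prob (cond_law n \<mu> i x) {- x i} =
      measure_pmf.prob (cond_pmf \<mu> ?S) {y. y i = - x i}"
    unfolding cond_law_def by (simp add: vimage_def)
  also have "\<dots> = measure_pmf.prob (cond_pmf \<mu> ?S) ({y. y i = - x i} \<inter> set_pmf (cond_pmf \<mu> ?S))"
    by (simp add: measure_Int_set_pmf)
  also have "{y. y i = - x i} \<inter> set_pmf (cond_pmf \<mu> ?S) = {flip i x}"
    unfolding set_cond_pmf[OF ne] supp fib using xi by (auto simp: flip_def)
  also have "measure_pmf.prob (cond_pmf \<mu> ?S) {flip i x} = pmf \<mu> (flip i x) / measure_pmf.prob \<mu> ?S"
  proof -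
    have "flip i x \<in> ?S" by (simp add: flip_def)
    then show ?thesis by (simp only: measure_pmf_single pmf_cond[OF ne] if_True)
  qed
  also have "measure_pmf.prob \<mu> ?S = pmf \<mu> x + pmf \<mu> (flip i x)"
    unfolding prob_S fib using distinct by simp
  finally show ?thesis by (simp add: flip_prob_def)
qed

lemma tv_dist_le_dobrushin:
  assumes "x \<in> cube n" "i \<noteq> j"
  shows "tv_dist (cond_law n \<mu> i x) (cond_law n \<mu> i (flip j x)) \<le> dobrushin_matrix n \<mu> i j"
  unfolding dobrushin_matrix_def if_not_P[OF assms(2)] using assms(1) by (intro Max_ge) auto

lemma dobrushin_matrix_ge:
  assumes x: "x \<in> cube n" and i: "i \<in> {1..n}" and j: "j \<in> {1..n}" and ij: "i \<noteq> j"
  shows "\<bar>flip_prob i (flip j x) - flip_prob i x\<bar> \<le> dobrushin_matrix n \<mu> i j"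
proof -
  have "flip j x i = x i" using ij by (simp add: flip_def)
  then have "\<bar>flip_prob i (flip j x) - flip_prob i x\<bar> =
      \<bar>measure_pmf.prob (cond_law n \<mu> i x) {- x i} - measure_pmf.prob (cond_law n \<mu> i (flip j x)) {- x i}\<bar>"
    using cond_law_flip[OF x i] cond_law_flip[OF flip_in_cube[OF x j] i] by (simp add: abs_minus_commute)
  also have "\<dots> \<le> tv_dist (cond_law n \<mu> i x) (cond_law n \<mu> i (flip j x))"
    by (rule tv_dist_ge)
  also have "\<dots> \<le> dobrushin_matrix n \<mu> i j"
    by (rule tv_dist_le_dobrushin[OF x ij])
  finally show ?thesis .
qed

lemma dobrushin_matrix_nonneg: "0 \<le> dobrushin_matrix n \<mu> i j"
proof (cases "i = j")
  case False
  obtain x where x: "x \<in> cube n" using cube_nonempty by blast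
  have "0 \<le> tv_dist (cond_law n \<mu> i x) (cond_law n \<mu> i (flip j x))" by (rule tv_dist_nonneg)
  also have "\<dots> \<le> dobrushin_matrix n \<mu> i j"
    by (rule tv_dist_le_dobrushin[OF x False])
  finally show ?thesis .
qed (simp add: dobrushin_matrix_def)

lemma flip_prob_eq_rate:
  assumes "x \<in> cube n" "i \<in> {1..n}"
  shows "flip_prob i x = 4 * (q i x)\<^sup>2 / (1 + 4 * (q i x)\<^sup>2)"
proof -
  note pos = pmf_pos[OF assms(1)] pmf_pos[OF flip_in_cube[OF assms]]
  have "4 * (q i x)\<^sup>2 = pmf \<mu> (flip i x) / pmf \<mu> x"
    using pos by (simp add: rate_def power_mult_distrib power_divide)
  moreover have "(s / p) / (1 + s / p) = s / (p + s)" if "0 < p" "0 < s" for p s :: real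
    using that by (simp add: field_simps)
  ultimately show ?thesis using pos by (simp add: flip_prob_def)
qed

text \<open>
  With \<open>w\<close> twice the rate, the conditional flip probability is \<open>w\<^sup>2 / (1 + w\<^sup>2)\<close>, whose derivative is bounded
  below on \<open>[b, 1 / b]\<close>.
\<close>

lemma rate_difference_le:
  assumes x: "x \<in> cube n" and y: "y \<in> cube n" and i: "i \<in> {1..n}"
  shows "\<bar>q i y - q i x\<bar> \<le> \<bar>flip_prob i y - flip_prob i x\<bar> / b ^ 5"
proof -
  define u v where "u = 2 * q i y" and "v = 2 * q i x"
  have u: "b \<le> u" "u \<le> 1 / b" and v: "b \<le> v" "v \<le> 1 / b"
    using rate_bounds[OF y i] rate_bounds[OF x i] by (auto simp: u_def v_def)
  have b1: "1 \<le> 1 / b" using b by simp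
  have sq: "1 + z\<^sup>2 \<le> 2 / b\<^sup>2" if "0 \<le> z" "z \<le> 1 / b" for z
  proof -
    have "z\<^sup>2 \<le> (1 / b)\<^sup>2" "1 \<le> (1 / b)\<^sup>2" using that b1 by (auto intro: power_mono one_le_power)
    then show ?thesis by (simp add: power_divide)
  qed
  let ?s = "u\<^sup>2 / (1 + u\<^sup>2) - v\<^sup>2 / (1 + v\<^sup>2)"
  have pu: "0 < 1 + u\<^sup>2" "0 < 1 + v\<^sup>2" by (auto intro: add_pos_nonneg)
  have uv: "0 < u + v" "2 * b \<le> u + v" using u v b by auto
  have s_eq: "?s * ((1 + u\<^sup>2) * (1 + v\<^sup>2)) = (u - v) * (u + v)"
  proof -
    have "?s * ((1 + u\<^sup>2) * (1 + v\<^sup>2)) = u\<^sup>2 * (1 + v\<^sup>2) - v\<^sup>2 * (1 + u\<^sup>2)"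
    proof -
      have "(A / p - B / p') * (p * p') = A * p' - B * p" if "0 < p" "0 < p'" for A B p p' :: real
        using that by (simp add: field_simps)
      then show ?thesis using pu by blast
    qed
    then show ?thesis by (simp add: power2_eq_square algebra_simps)
  qed
  have "\<bar>u - v\<bar> * (2 * b) \<le> \<bar>u - v\<bar> * (u + v)" using uv by (intro mult_left_mono) auto
  also have "\<dots> = \<bar>?s\<bar> * ((1 + u\<^sup>2) * (1 + v\<^sup>2))"
  proof -
    have "\<bar>u - v\<bar> * (u + v) = \<bar>(u - v) * (u + v)\<bar>" using uv by (simp add: abs_mult)
    also have "\<dots> = \<bar>?s\<bar> * ((1 + u\<^sup>2) * (1 + v\<^sup>2))"
      unfolding s_eq[symmetric] abs_mult[of ?s] using pu by (simp add: abs_mult)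
    finally show ?thesis .
  qed
  also have "\<dots> \<le> \<bar>?s\<bar> * (2 / b\<^sup>2 * (2 / b\<^sup>2))"
    using sq u v b pu by (intro mult_left_mono mult_mono) auto
  finally have "\<bar>u - v\<bar> * (2 * b) / (2 * b) \<le> \<bar>?s\<bar> * (2 / b\<^sup>2 * (2 / b\<^sup>2)) / (2 * b)"
    using b by (intro divide_right_mono) auto
  then have "\<bar>u - v\<bar> \<le> 2 * (\<bar>?s\<bar> / b ^ 5)"
    using b by (simp add: field_simps eval_nat_numeral)
  moreover have "?s = flip_prob i y - flip_prob i x"
    unfolding flip_prob_eq_rate[OF y i] flip_prob_eq_rate[OF x i] u_def v_def by (simp add: power_mult_distrib)
  moreover have "\<bar>u - v\<bar> = 2 * \<bar>q i y - q i x\<bar>"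
  proof -
    have "u - v = 2 * (q i y - q i x)" by (simp add: u_def v_def)
    then show ?thesis by (simp only: abs_mult abs_numeral)
  qed
  ultimately show ?thesis by simp
qed

text \<open>
  The minimum of the two entries makes the matrix symmetric while its column sums stay below those of
  the Dobrushin matrix up to the power of \<open>b\<close>.
\<close>

definition pair_curvature :: "nat \<Rightarrow> nat \<Rightarrow> real" where
  "pair_curvature i j = min (dobrushin_matrix n \<mu> i j) (dobrushin_matrix n \<mu> j i) / b ^ 7"

lemma coupling_le_dobrushin:
  assumes x: "x \<in> cube n" and i: "i \<in> {1..n}" and j: "j \<in> {1..n}" and ij: "i \<noteq> j"
  shows "\<bar>coupling i j x\<bar> \<le> pair_curvature i j * q j x"
proof -
  have one: "\<bar>coupling k l x\<bar> \<le> dobrushin_matrix n \<mu> l k / (2 * b ^ 6)"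
    if kl: "k \<in> {1..n}" "l \<in> {1..n}" "k \<noteq> l" for k l
  proof -
    have "\<bar>q l (flip k x) - q l x\<bar> \<le> \<bar>flip_prob l (flip k x) - flip_prob l x\<bar> / b ^ 5"
      using kl x by (intro rate_difference_le) auto
    also have "\<dots> \<le> dobrushin_matrix n \<mu> l k / b ^ 5"
      using kl x b by (intro divide_right_mono dobrushin_matrix_ge) auto
    finally have "\<bar>coupling k l x\<bar> \<le> 1 / (2 * b) * (dobrushin_matrix n \<mu> l k / b ^ 5)"
      unfolding coupling_def abs_mult using rate_bounds[OF x kl(1)] b by (intro mult_mono) auto
    also have "\<dots> = dobrushin_matrix n \<mu> l k / (2 * b ^ 6)"
      by (simp add: eval_nat_numeral)
    finally show ?thesis .
  qed
  have "\<bar>coupling i j x\<bar> \<le> min (dobrushin_matrix n \<mu> i j) (dobrushin_matrix n \<mu> j i) / (2 * b ^ 6)"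
    using one[OF i j ij] one[OF j i] ij coupling_commute[OF x i j] by (simp add: min_def)
  also have "\<dots> = pair_curvature i j * (b / 2)"
    using b by (simp add: pair_curvature_def eval_nat_numeral)
  also have "\<dots> \<le> pair_curvature i j * q j x"
    using rate_bounds(1)[OF x j] b dobrushin_matrix_nonneg
    by (intro mult_left_mono) (auto simp: pair_curvature_def)
  finally show ?thesis .
qed

end

section \<open>Isoperimetric and influence inequalities under Dobrushin's condition\<close>

theorem theorem6p10:
  fixes b C0 \<delta> :: real
  assumes "0 < b" and "b \<le> 1" and "0 \<le> C0" and "0 < \<delta>" and "\<delta> \<le> 1"
  shows "\<exists>(C::real) (\<rho>::real). 0 < C \<and>
    (\<forall>(n::nat) (\<mu> :: config pmf).
      1 \<le> n \<longrightarrow>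
      set_pmf \<mu> = cube n \<longrightarrow>
      (\<forall>x\<in>cube n. \<forall>i\<in>{1..n}. weight \<mu> i x \<in> {b..1/b}) \<longrightarrow>
      max_col_sum n (dobrushin_matrix n \<mu>) \<le> C0 \<longrightarrow>
      spectral_norm n (dobrushin_matrix n \<mu>) \<le> 1 - \<delta> \<longrightarrow>
      (\<forall>f \<in> cube n \<rightarrow> {0..1}. \<forall>t\<ge>0. \<forall>x\<in>cube n.
         gauss_profile (heat_semigroup n \<mu> t f x)
         \<le> heat_semigroup n \<mu> t
             (\<lambda>y. sqrt ((gauss_profile (f y))\<^sup>2 + bobkov_gamma b \<rho> t * Gamma_star n \<mu> f y)) x) \<and>
      (\<forall>f \<in> cube n \<rightarrow> {0, 1}.
         A_star n \<mu> f \<ge> C * Var \<mu> f * sqrt (ln (exp 1 / Var \<mu> f))) \<and>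
      (\<forall>f :: config \<Rightarrow> real.
         C * Var \<mu> f
         \<le> (\<Sum>i\<in>{1..n}. coord_influence \<mu> i f /
               (1 + ln (sqrt (coord_influence \<mu> i f) / coord_L1 \<mu> i f))) \<and>
         total_influence n \<mu> f \<ge> C * Var \<mu> f * (1 + ln (I_star n \<mu> f / J_star n \<mu> f)) \<and>
         total_influence n \<mu> f \<ge> C * Var \<mu> f * (1 + ln (I_star n \<mu> f / (A_star n \<mu> f)\<^sup>2))) \<and>
      (\<forall>f \<in> cube n \<rightarrow> {-1, 1}.
         I_star n \<mu> f \<ge> C * ln (1 / M_star n \<mu> f) * Var \<mu> f \<and>
         M_star n \<mu> f \<ge> C * (ln (real n) / real n) * Var \<mu> f) \<and>
      (\<forall>f \<in> cube n \<rightarrow> {-1, 1}.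
         A_star n \<mu> f \<ge> C * Var \<mu> f * sqrt (ln (1 + exp 1 / J_star n \<mu> f))))"
proof -
  define \<kappa> where "\<kappa> = C0 / b ^ 7"
  define K where "K = lsi_const b \<delta>"
  define c1 where "c1 = Talagrand_const b \<kappa> K"
  define c2 where "c2 = L1_L2_const b \<kappa> K"
  define c3 where "c3 = b * c2 / 6"
  define c4 where "c4 = c2 / (2 * (1 + ln (1 / b)))"
  define c5 where "c5 = Eldan_Gross_const b \<kappa> K"
  define C where "C = min c1 (min c2 (min c3 (min (c4 / 2) (min (1 / 2) c5))))"
  have K: "0 < K" using assms by (simp add: K_def lsi_const_def)
  have c125: "0 < c1" "0 < c2" "0 < c5"
    unfolding c1_def c2_def c5_def using assms K
    by (auto intro: Talagrand_const_pos L1_L2_const_pos Eldan_Gross_const_pos)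
  have c3: "0 < c3" using c125 assms by (simp add: c3_def)
  have "0 \<le> ln (1 / b)" using assms by simp
  then have "0 < 2 * (1 + ln (1 / b))"
    by (intro mult_pos_pos add_pos_nonneg) auto
  then have "0 < c4" unfolding c4_def by (rule divide_pos_pos[OF c125(2)])
  note pos = c125 c3 this
  have "C \<le> c1 \<and> C \<le> c2 \<and> C \<le> c3 \<and> C \<le> c4 / 2 \<and> C \<le> 1 / 2 \<and> C \<le> c5"
    unfolding C_def
    by (intro conjI min.cobounded1 min.coboundedI2[OF min.cobounded1] min.coboundedI2[OF min.coboundedI2[OF min.cobounded1]]
        min.coboundedI2[OF min.coboundedI2[OF min.coboundedI2[OF min.cobounded1]]]
        min.coboundedI2[OF min.coboundedI2[OF min.coboundedI2[OF min.coboundedI2[OF min.cobounded1]]]]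
        min.coboundedI2[OF min.coboundedI2[OF min.coboundedI2[OF min.coboundedI2[OF min.cobounded2]]]])
  moreover have "0 < C"
    unfolding C_def using pos by (simp only: min_less_iff_conj half_gt_zero zero_less_one)
  ultimately have C: "0 < C" "C \<le> c1" "C \<le> c2" "C \<le> c3" "C \<le> c4 / 2" "C \<le> 1 / 2" "C \<le> c5"
    by blast+
  have C4: "C \<le> c4" "2 * C \<le> c4" using C pos by linarith+
  show ?thesis
  proof (rule exI[of _ C], rule exI[of _ "bobkov_rate \<kappa>"], rule conjI[OF C(1)], intro allI impI, goal_cases)
    case (1 n \<mu>)
    then have n: "1 \<le> n" and supp: "set_pmf \<mu> = cube n"
      and w: "\<forall>x\<in>cube n. \<forall>i\<in>{1..n}. weight \<mu> i x \<in> {b..1 / b}"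
      and col: "max_col_sum n (dobrushin_matrix n \<mu>) \<le> C0"
      and spec: "spectral_norm n (dobrushin_matrix n \<mu>) \<le> 1 - \<delta>"
      by auto
    interpret spin_system n \<mu> b
      by unfold_locales (use n supp assms w in auto)
    interpret dobrushin_system n \<mu> b "dobrushin_matrix n \<mu>" \<delta>
    proof unfold_locales
      fix v :: "nat \<Rightarrow> real"
      have "L2_set (\<lambda>i. \<Sum>j\<in>{1..n}. dobrushin_matrix n \<mu> i j * v j) {1..n} \<le>
          spectral_norm n (dobrushin_matrix n \<mu>) * L2_set v {1..n}"
        by (rule spectral_norm_ge)
      also have "\<dots> \<le> (1 - \<delta>) * L2_set v {1..n}"
        using spec by (intro mult_right_mono) auto
      finally show "L2_set (\<lambda>i. \<Sum>j\<in>{1..n}. dobrushin_matrix n \<mu> i j * v j) {1..n} \<le> (1 - \<delta>) * L2_set v {1..n}" .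
    qed (use assms dobrushin_matrix_nonneg dobrushin_matrix_ge in auto)
    interpret log_sobolev_system n \<mu> b \<kappa> pair_curvature K
    proof unfold_locales
      fix j assume j: "j \<in> {1..n}"
      have "(\<Sum>i\<in>{1..n}. pair_curvature i j) \<le> (\<Sum>i\<in>{1..n}. \<bar>dobrushin_matrix n \<mu> i j\<bar> / b ^ 7)"
        unfolding pair_curvature_def using assms by (intro sum_mono divide_right_mono) auto
      also have "\<dots> = (\<Sum>i\<in>{1..n}. \<bar>dobrushin_matrix n \<mu> i j\<bar>) / b ^ 7"
        by (rule sum_divide_distrib[symmetric])
      also have "\<dots> \<le> \<kappa>"
        unfolding \<kappa>_def using max_col_sum_ge[OF j, of "dobrushin_matrix n \<mu>"] col assms
        by (intro divide_right_mono) auto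
      finally show "(\<Sum>i\<in>{1..n}. pair_curvature i j) \<le> \<kappa>" .
    next
      show "0 < K" by (rule K)
    next
      fix g :: "config \<Rightarrow> real" assume "\<And>y. y \<in> cube n \<Longrightarrow> 0 < g y"
      then show "mean (\<lambda>x. (g x)\<^sup>2 * ln ((g x)\<^sup>2)) - mean (\<lambda>x. (g x)\<^sup>2) * ln (mean (\<lambda>x. (g x)\<^sup>2)) \<le>
          K * (\<Sum>i\<in>{1..n}. mean (\<lambda>x. (g (flip i x) - g x)\<^sup>2))"
        unfolding K_def by (rule log_Sobolev)
    next
      fix i j show "0 \<le> pair_curvature i j"
        using assms dobrushin_matrix_nonneg by (simp add: pair_curvature_def)
      show "pair_curvature i j = pair_curvature j i"
        by (simp add: pair_curvature_def min.commute)
    qed (rule coupling_le_dobrushin)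
    have local_Bobkov_inequality: "(\<forall>f \<in> cube n \<rightarrow> {0..1}. \<forall>t\<ge>0. \<forall>x\<in>cube n.
         gauss_profile (heat_semigroup n \<mu> t f x)
         \<le> heat_semigroup n \<mu> t
             (\<lambda>y. sqrt ((gauss_profile (f y))\<^sup>2 + bobkov_gamma b (bobkov_rate \<kappa>) t * Gamma_star n \<mu> f y)) x)"
    proof (intro ballI allI impI)
      fix f t x assume "f \<in> cube n \<rightarrow> {0..1::real}" "(0::real) \<le> t" "x \<in> cube n"
      then show "gauss_profile (heat_semigroup n \<mu> t f x)
         \<le> heat_semigroup n \<mu> t
             (\<lambda>y. sqrt ((gauss_profile (f y))\<^sup>2 + bobkov_gamma b (bobkov_rate \<kappa>) t * Gamma_star n \<mu> f y)) x"
        by (intro local_Bobkov rate_r) auto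
    qed
    have surface_area: "\<forall>f \<in> cube n \<rightarrow> {0, 1}.
         A_star n \<mu> f \<ge> C * Var \<mu> f * sqrt (ln (exp 1 / Var \<mu> f))"
    proof
      fix f assume "f \<in> cube n \<rightarrow> {0, 1::real}"
      then have f: "f x \<in> {0, 1}" if "x \<in> cube n" for x using that by auto
      have le: "c1 * (Var \<mu> f * sqrt (ln (exp 1 / Var \<mu> f))) \<le> A_star n \<mu> f"
        using Talagrand_surface_area[of f, OF f] unfolding c1_def by (simp only: mult.assoc)
      have "0 \<le> Var \<mu> f * sqrt (ln (exp 1 / Var \<mu> f))"
      proof (cases "Var \<mu> f = 0")
        case False
        then have "0 < Var \<mu> f" using Var_nonneg[of f] by linarith
        moreover have "Var \<mu> f \<le> 1"
          using mean_boolean_square(2,4)[of f, OF f] zero_le_power2[of "mean f"] by linarith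
        ultimately show ?thesis
          using exp_ge_add_one_self[of "1::real"] by (intro mult_nonneg_nonneg) auto
      qed simp
      then have "C * (Var \<mu> f * sqrt (ln (exp 1 / Var \<mu> f))) \<le> c1 * (Var \<mu> f * sqrt (ln (exp 1 / Var \<mu> f)))"
        using C by (intro mult_right_mono)
      then show "A_star n \<mu> f \<ge> C * Var \<mu> f * sqrt (ln (exp 1 / Var \<mu> f))"
        using le unfolding mult.assoc by linarith
    qed
    have L1_L2: "C * Var \<mu> f \<le> (\<Sum>i\<in>{1..n}. coord_influence \<mu> i f /
        (1 + ln (sqrt (coord_influence \<mu> i f) / coord_L1 \<mu> i f)))" for f
    proof -
      have "C * Var \<mu> f \<le> c2 * Var \<mu> f" using C Var_nonneg[of f] by (intro mult_right_mono)
      then show ?thesis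
        using L1_L2_inequality[of f] unfolding c2_def log_ratio_def by linarith
    qed
    have total_J: "total_influence n \<mu> f \<ge> C * Var \<mu> f * (1 + ln (I_star n \<mu> f / J_star n \<mu> f))" for f
      using C by (intro total_influence_ge_J) (auto simp: c3_def c2_def)
    have total_A: "total_influence n \<mu> f \<ge> C * Var \<mu> f * (1 + ln (I_star n \<mu> f / (A_star n \<mu> f)\<^sup>2))" for f
      using C by (intro total_influence_ge_A) (auto simp: c3_def c2_def)
    have KKL: "\<forall>f \<in> cube n \<rightarrow> {-1, 1}.
         I_star n \<mu> f \<ge> C * ln (1 / M_star n \<mu> f) * Var \<mu> f \<and>
         M_star n \<mu> f \<ge> C * (ln (real n) / real n) * Var \<mu> f"
    proof (intro ballI conjI)
      fix f assume "f \<in> cube n \<rightarrow> {-1, 1::real}"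
      then have f: "f x \<in> {-1, 1}" if "x \<in> cube n" for x using that by auto
      show "I_star n \<mu> f \<ge> C * ln (1 / M_star n \<mu> f) * Var \<mu> f"
        using f C C4 by (intro KKL_influence_sum) (auto simp: c4_def c2_def)
      show "M_star n \<mu> f \<ge> C * (ln (real n) / real n) * Var \<mu> f"
        using f C C4 by (intro KKL_max_influence) (auto simp: c4_def c2_def)
    qed
    have Eldan_Gross_inequality: "\<forall>f \<in> cube n \<rightarrow> {-1, 1}.
         A_star n \<mu> f \<ge> C * Var \<mu> f * sqrt (ln (1 + exp 1 / J_star n \<mu> f))"
    proof
      fix f assume "f \<in> cube n \<rightarrow> {-1, 1::real}"
      then have f: "f x \<in> {-1, 1}" if "x \<in> cube n" for x using that by auto
      have "1 \<le> 1 + exp 1 / J_star n \<mu> f" using J_star_nonneg[of f] by simp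
      then have "C * (Var \<mu> f * sqrt (ln (1 + exp 1 / J_star n \<mu> f))) \<le>
          c5 * (Var \<mu> f * sqrt (ln (1 + exp 1 / J_star n \<mu> f)))"
        using C Var_nonneg[of f] by (intro mult_right_mono mult_nonneg_nonneg) (auto intro: ln_ge_zero)
      then show "A_star n \<mu> f \<ge> C * Var \<mu> f * sqrt (ln (1 + exp 1 / J_star n \<mu> f))"
        using Eldan_Gross[of f, OF f] unfolding c5_def mult.assoc by linarith
    qed
    show ?case
      by (intro conjI allI local_Bobkov_inequality surface_area L1_L2 total_J total_A KKL Eldan_Gross_inequality)
  qed
qed

end
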